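(* Assume (VD). (a) Let $(\mathcal{E}^{(L)},\mathcal{F}^{(L)})$ be a strongly local regular $p$-energy satisfying $\mathrm{PI}^{(L)}(\Psi)$ and $\mathrm{CE}^{(L)}_{\mathrm{strong}}(\Psi)$ for a doubling function $\Psi$. Let $\Upsilon$ be a doubling function such that $\mathrm{SUG}(\Upsilon,\Psi)$ holds, and let $(\mathcal{E}^{(J,\Upsilon)},\mathcal{F}^{(J,\Upsilon)})$ be a non-local $p$-form associated with $\Upsilon$. Then $(\mathcal{E}^{(J,\Upsilon)},\mathcal{F}^{(J,\Upsilon)})$ is a regular $p$-energy satisfying $\mathrm{CE}^{(J)}_{\mathrm{strong}}(\Upsilon)$. (b) Let $\Psi$ be a doubling function and $(\mathcal{E}^{(J,\Psi)},\mathcal{F}^{(J,\Psi)})$ a non-local $p$-form associated with $\Psi$ which is a regular $p$-energy satisfying $\mathrm{CE}^{(J)}_{\mathrm{strong}}(\Psi)$. Let $\Upsilon$ be a doubling function such that $\mathrm{UG}(\Upsilon,\Psi)$ holds, and let $(\mathcal{E}^{(J,\Upsilon)},\mathcal{F}^{(J,\Upsilon)})$ be a non-local $p$-form associated with $\Upsilon$. Then $(\mathcal{E}^{(J,\Upsilon)},\mathcal{F}^{(J,\Upsilon)})$ is a regular $p$-energy satisfying $\mathrm{CE}^{(J)}_{\mathrm{strong}}(\Upsilon)$.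
   Context: Standing setting. Fix $p\in(1,\infty)$. $(X,d,m)$: $(X,d)$ complete, unbounded, locally compact, separable metric space with all open balls relatively compact; $m$ a positive Radon measure of full support. $B(x,r)$ open ball, $V(x,r)=m(B(x,r))$. The chain condition is assumed: there is $C_{cc}>0$ such that any $x,y$ and $n\ge1$ admit $x_0=x,\dots,x_n=y$ with $d(x_k,x_{k-1})\le C_{cc}d(x,y)/n$. (VD): $V(x,2r)\le C_{VD}V(x,r)$ for all $x,r$. The support of $f$ is the support of $|f|dm$; $u_A$ denotes the $m$-average of $u$ over $A$. Doubling function: a homeomorphism $\Psi:[0,\infty)\to[0,\infty)$ with $\Psi(2r)\le C_\Psi\Psi(r)$ and $C_\Psi^{-1}(R/r)^{\beta^{(1)}_\Psi}\le\Psi(R)/\Psi(r)\le C_\Psi(R/r)^{\beta^{(2)}_\Psi}$ for $0<r\le R$, for some $C_\Psi>1$, $0<\beta^{(1)}_\Psi\le\beta^{(2)}_\Psi$. $\mathrm{SUG}(\Upsilon,\Psi)$: there is an increasing $\Theta:[0,1]\to[0,\infty)$ with $\Theta(1)\ge1$ and $\sum_{n\ge0}\Theta(2^{-n})<\infty$ such that $\frac{\Upsilon(R)}{\Upsilon(r)}\le\Theta(\frac rR)\frac{\Psi(R)}{\Psi(r)}$ for all $0<r\le R$. $\mathrm{UG}(\Upsilon,\Psi)$: there is $C\ge1$ with $\frac{\Upsilon(R)}{\Upsilon(r)}\le C\frac{\Psi(R)}{\Psi(r)}$ for all $0<r\le R$. Cutoff function for $U\subseteq V$ ($U,V$ open,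 $\overline U\subseteq V$): measurable $\phi$, $0\le\phi\le1$ a.e., $\phi=1$ a.e. near $\overline U$, $\mathrm{supp}\,\phi\subseteq V$. $p$-form: linear $\mathcal F\subseteq L^p$, $\mathcal E\ge0$ with $\mathcal E^{1/p}$ a seminorm; $\mathcal E_1=\mathcal E+\|\cdot\|_{L^p}^p$. $p$-energy: additionally $\mathcal F$ dense in $L^p$, $(\mathcal F,\mathcal E_1^{1/p})$ Banach, Markovian ($\varphi(f)\in\mathcal F$, $\mathcal E(\varphi(f))\le\mathcal E(f)$ for $1$-Lipschitz $\varphi$ with $\varphi(0)=0$), and $p$-Clarkson inequality. Strongly local: $\mathcal E(f+g)=\mathcal E(f)+\mathcal E(g)$ for compactly supported $f,g\in\mathcal F$ with $g$ constant near $\mathrm{supp} f$. Regular: $\mathcal F\cap C_c(X)$ uniformly dense in $C_c(X)$ and $\mathcal E_1^{1/p}$-dense in $\mathcal F$. Local energy measure: for a strongly local regular $p$-energy, the canonical $p$-energy measure $\Gamma^{(L)}(f)$, a positive Radon measure with total mass $\mathcal E^{(L)}(f)$ (local, satisfying the chain rule $d\Gamma^{(L)}(\varphi(f))=|\varphi'(f)|^pd\Gamma^{(L)}(f)$). $\mathrm{PI}^{(L)}(\Psi)$: there are $C_{PI}>0$, $A_{PI}\ge1$ with $\int_{B(x,r)}|f-f_{B(x,r)}|^pdm\le C_{PI}\Psi(r)\Gamma^{(L)}(f)(B(x,A_{PI}r))$ for all balls and $f\in\mathcal F^{(L)}$. Non-local $p$-form associated with a doubling $\Upsilon$: $K^{(J,\Upsilon)}$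 symmetric on $X\times X\setminus\mathrm{diag}$ with $\frac{C_1}{V(x,d(x,y))\Upsilon(d(x,y))}\le K^{(J,\Upsilon)}(x,y)\le\frac{C_2}{V(x,d(x,y))\Upsilon(d(x,y))}$; $\mathcal E^{(J,\Upsilon)}(u)=\iint|u(x)-u(y)|^pK^{(J,\Upsilon)}\,dm\,dm$, $\mathcal F^{(J,\Upsilon)}=\{u\in L^p:\mathcal E^{(J,\Upsilon)}(u)<\infty\}$; $\Gamma^{(J,\Upsilon)}_X(u)(dx)=(\int_X|u(x)-u(y)|^pK^{(J,\Upsilon)}(x,y)m(dy))m(dx)$. $\mathrm{CE}^{(\bullet)}_{\mathrm{strong}}(\Phi)$ (for $\bullet=L$ with $\Gamma=\Gamma^{(L)}$, or $\bullet=J$ with the non-local form associated with $\Phi$ and $\Gamma=\Gamma^{(J,\Phi)}_X$): there are $\delta\in(0,1)$, $A_E>1$, $C>0$ such that for every ball $B(x_0,r)$ there is a cutoff function $\phi$ in the domain for $B(x_0,r)\subseteq B(x_0,A_Er)$ with (i) $|\phi(x)-\phi(y)|\le C(\frac{d(x,y)}r\wedge1)^\delta$ for all $x,y\in X$ and (ii) $\Gamma(\phi)(B(x,s))\le C(\frac sr\wedge1)^\delta\frac{V(x,s)}{\Phi(s\wedge r)}$ for all $x\in X$, $s>0$. *)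

theory Defs
  imports "HOL-Analysis.Analysis"
begin

definition standing_space :: "'a::metric_space itself \<Rightarrow> bool" where
  "standing_space T \<longleftrightarrow>
     complete (UNIV::'a set) \<and> \<not> bounded (UNIV::'a set) \<and>
     locally compact (UNIV::'a set) \<and> separable_space (euclidean::'a topology) \<and>
     (\<forall>x::'a. \<forall>r. compact (closure (ball x r)))"

text \<open>Positive Radon measure of full support (on a proper separable metric space,
  a Borel measure finite on compact sets is Radon).\<close>
definition radon_full_support :: "'a::metric_space measure \<Rightarrow> bool" where
  "radon_full_support m \<longleftrightarrow>
     sets m = sets borel \<and>
     (\<forall>K. compact K \<longrightarrow> emeasure m K < \<infinity>) \<and>
     (\<forall>x r. r > 0 \<longrightarrow> emeasure m (ball x r) > 0)"

definition Vol :: "'a::metric_space measure \<Rightarrow> 'a \<Rightarrow> real \<Rightarrow> real" where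
  "Vol m x r = measure m (ball x r)"

definition chain_condition :: "'a::metric_space itself \<Rightarrow> bool" where
  "chain_condition T \<longleftrightarrow> (\<exists>Ccc>0. \<forall>(x::'a) y. \<forall>n::nat. n \<ge> 1 \<longrightarrow>
      (\<exists>xs::nat \<Rightarrow> 'a. xs 0 = x \<and> xs n = y \<and>
         (\<forall>k\<in>{1..n}. dist (xs k) (xs (k - 1)) \<le> Ccc * dist x y / real n)))"

definition volume_doubling :: "'a::metric_space measure \<Rightarrow> bool" where
  "volume_doubling m \<longleftrightarrow> (\<exists>C. \<forall>x r. Vol m x (2 * r) \<le> C * Vol m x r)"

definition doubling_function :: "(real \<Rightarrow> real) \<Rightarrow> bool" where
  "doubling_function \<Psi> \<longleftrightarrow>
     (\<exists>g. homeomorphism {0..} {0..} \<Psi> g) \<and>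
     (\<exists>C \<beta>1 \<beta>2. C > 1 \<and> 0 < \<beta>1 \<and> \<beta>1 \<le> \<beta>2 \<and>
        (\<forall>r\<ge>0. \<Psi> (2 * r) \<le> C * \<Psi> r) \<and>
        (\<forall>r R. 0 < r \<and> r \<le> R \<longrightarrow>
            (R / r) powr \<beta>1 / C \<le> \<Psi> R / \<Psi> r \<and> \<Psi> R / \<Psi> r \<le> C * (R / r) powr \<beta>2))"

definition SUG :: "(real \<Rightarrow> real) \<Rightarrow> (real \<Rightarrow> real) \<Rightarrow> bool" where
  "SUG \<Upsilon> \<Psi> \<longleftrightarrow> (\<exists>\<Theta>::real \<Rightarrow> real.
     mono_on {0..1} \<Theta> \<and> (\<forall>t\<in>{0..1}. \<Theta> t \<ge> 0) \<and> \<Theta> 1 \<ge> 1 \<and>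
     summable (\<lambda>n::nat. \<Theta> ((1/2) ^ n)) \<and>
     (\<forall>r R. 0 < r \<and> r \<le> R \<longrightarrow> \<Upsilon> R / \<Upsilon> r \<le> \<Theta> (r / R) * (\<Psi> R / \<Psi> r)))"

definition UG :: "(real \<Rightarrow> real) \<Rightarrow> (real \<Rightarrow> real) \<Rightarrow> bool" where
  "UG \<Upsilon> \<Psi> \<longleftrightarrow> (\<exists>C\<ge>1. \<forall>r R. 0 < r \<and> r \<le> R \<longrightarrow> \<Upsilon> R / \<Upsilon> r \<le> C * (\<Psi> R / \<Psi> r))"

text \<open>Elements of L^p are represented by measurable functions; p-forms are required to
  be invariant under m-a.e. equality (see p_form).\<close>
definition Lp :: "'a measure \<Rightarrow> real \<Rightarrow> ('a \<Rightarrow> real) \<Rightarrow> bool" where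
  "Lp m p f \<longleftrightarrow> f \<in> borel_measurable m \<and> integrable m (\<lambda>x. \<bar>f x\<bar> powr p)"

definition Lp_pow :: "'a measure \<Rightarrow> real \<Rightarrow> ('a \<Rightarrow> real) \<Rightarrow> real" where
  "Lp_pow m p f = (\<integral>x. \<bar>f x\<bar> powr p \<partial>m)"

text \<open>Support of f = support of the measure |f| dm.\<close>
definition esupp :: "'a::topological_space measure \<Rightarrow> ('a \<Rightarrow> real) \<Rightarrow> 'a set" where
  "esupp m f = {x. \<forall>U. open U \<and> x \<in> U \<longrightarrow> \<not> (AE y in m. y \<in> U \<longrightarrow> f y = 0)}"

definition cutoff :: "'a::topological_space measure \<Rightarrow> 'a set \<Rightarrow> 'a set \<Rightarrow> ('a \<Rightarrow> real) \<Rightarrow> bool" where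
  "cutoff m U V \<phi> \<longleftrightarrow> open U \<and> open V \<and> closure U \<subseteq> V \<and>
     \<phi> \<in> borel_measurable m \<and> (AE x in m. 0 \<le> \<phi> x \<and> \<phi> x \<le> 1) \<and>
     (\<exists>W. open W \<and> closure U \<subseteq> W \<and> (AE x in m. x \<in> W \<longrightarrow> \<phi> x = 1)) \<and>
     esupp m \<phi> \<subseteq> V"

definition Cc :: "('a::metric_space \<Rightarrow> real) \<Rightarrow> bool" where
  "Cc f \<longleftrightarrow> continuous_on UNIV f \<and> compact (closure {x. f x \<noteq> 0})"

definition p_form :: "'a measure \<Rightarrow> real \<Rightarrow> ('a \<Rightarrow> real) set \<Rightarrow> (('a \<Rightarrow> real) \<Rightarrow> real) \<Rightarrow> bool" where
  "p_form m p F E \<longleftrightarrow>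
     (\<forall>f\<in>F. Lp m p f) \<and> (\<lambda>x. 0) \<in> F \<and>
     (\<forall>f\<in>F. \<forall>g\<in>F. (\<lambda>x. f x + g x) \<in> F) \<and>
     (\<forall>f\<in>F. \<forall>c. (\<lambda>x. c * f x) \<in> F) \<and>
     (\<forall>f\<in>F. \<forall>g. g \<in> borel_measurable m \<and> (AE x in m. f x = g x) \<longrightarrow> g \<in> F \<and> E g = E f) \<and>
     (\<forall>f\<in>F. E f \<ge> 0) \<and>
     (\<forall>f\<in>F. \<forall>c. E (\<lambda>x. c * f x) = \<bar>c\<bar> powr p * E f) \<and>
     (\<forall>f\<in>F. \<forall>g\<in>F. E (\<lambda>x. f x + g x) powr (1/p) \<le> E f powr (1/p) + E g powr (1/p))"

definition E1 :: "'a measure \<Rightarrow> real \<Rightarrow> (('a \<Rightarrow> real) \<Rightarrow> real) \<Rightarrow> ('a \<Rightarrow> real) \<Rightarrow> real" where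
  "E1 m p E f = E f + Lp_pow m p f"

definition clarkson :: "real \<Rightarrow> ('a \<Rightarrow> real) set \<Rightarrow> (('a \<Rightarrow> real) \<Rightarrow> real) \<Rightarrow> bool" where
  "clarkson p F E \<longleftrightarrow> (\<forall>f\<in>F. \<forall>g\<in>F.
     (p \<le> 2 \<longrightarrow> E (\<lambda>x. f x + g x) + E (\<lambda>x. f x - g x)
                 \<ge> 2 * (E f powr (1/(p-1)) + E g powr (1/(p-1))) powr (p-1)) \<and>
     (p \<ge> 2 \<longrightarrow> E (\<lambda>x. f x + g x) + E (\<lambda>x. f x - g x)
                 \<le> 2 * (E f powr (1/(p-1)) + E g powr (1/(p-1))) powr (p-1)))"

definition p_energy :: "'a measure \<Rightarrow> real \<Rightarrow> ('a \<Rightarrow> real) set \<Rightarrow> (('a \<Rightarrow> real) \<Rightarrow> real) \<Rightarrow> bool" where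
  "p_energy m p F E \<longleftrightarrow> p_form m p F E \<and>
     \<comment> \<open>dense in L^p\<close>
     (\<forall>u. Lp m p u \<longrightarrow> (\<forall>\<epsilon>>0. \<exists>f\<in>F. Lp_pow m p (\<lambda>x. u x - f x) < \<epsilon>)) \<and>
     \<comment> \<open>(F, E_1^{1/p}) is complete\<close>
     (\<forall>f::nat \<Rightarrow> 'a \<Rightarrow> real. (\<forall>n. f n \<in> F) \<and>
        (\<forall>\<epsilon>>0. \<exists>N. \<forall>n\<ge>N. \<forall>k\<ge>N. E1 m p E (\<lambda>x. f n x - f k x) < \<epsilon>) \<longrightarrow>
        (\<exists>g\<in>F. (\<lambda>n. E1 m p E (\<lambda>x. f n x - g x)) \<longlonglongrightarrow> 0)) \<and>
     \<comment> \<open>Markovian\<close>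
     (\<forall>\<phi>::real \<Rightarrow> real. (\<forall>s t. \<bar>\<phi> s - \<phi> t\<bar> \<le> \<bar>s - t\<bar>) \<and> \<phi> 0 = 0 \<longrightarrow>
        (\<forall>f\<in>F. (\<phi> \<circ> f) \<in> F \<and> E (\<phi> \<circ> f) \<le> E f)) \<and>
     clarkson p F E"

definition strongly_local :: "'a::topological_space measure \<Rightarrow> ('a \<Rightarrow> real) set \<Rightarrow> (('a \<Rightarrow> real) \<Rightarrow> real) \<Rightarrow> bool" where
  "strongly_local m F E \<longleftrightarrow> (\<forall>f\<in>F. \<forall>g\<in>F.
     compact (esupp m f) \<and> compact (esupp m g) \<and>
     (\<exists>a U. open U \<and> esupp m f \<subseteq> U \<and> (AE x in m. x \<in> U \<longrightarrow> g x = a)) \<longrightarrow>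
     E (\<lambda>x. f x + g x) = E f + E g)"

definition regular_form :: "'a::metric_space measure \<Rightarrow> real \<Rightarrow> ('a \<Rightarrow> real) set \<Rightarrow> (('a \<Rightarrow> real) \<Rightarrow> real) \<Rightarrow> bool" where
  "regular_form m p F E \<longleftrightarrow>
     (\<forall>u. Cc u \<longrightarrow> (\<forall>\<epsilon>>0. \<exists>f\<in>F. Cc f \<and> (\<forall>x. \<bar>u x - f x\<bar> < \<epsilon>))) \<and>
     (\<forall>f\<in>F. \<forall>\<epsilon>>0. \<exists>g\<in>F. Cc g \<and> E1 m p E (\<lambda>x. f x - g x) < \<epsilon>)"

text \<open>The canonical p-energy measure is modelled by its stated properties:
  Radon (finite Borel) measures of total mass E f, invariant under a.e. equality,
  local, and satisfying the chain rule.\<close>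
definition local_energy_measure ::
  "'a::metric_space measure \<Rightarrow> real \<Rightarrow> ('a \<Rightarrow> real) set \<Rightarrow> (('a \<Rightarrow> real) \<Rightarrow> real)
     \<Rightarrow> (('a \<Rightarrow> real) \<Rightarrow> 'a measure) \<Rightarrow> bool" where
  "local_energy_measure m p F E \<Gamma> \<longleftrightarrow>
     (\<forall>f\<in>F. sets (\<Gamma> f) = sets borel \<and> emeasure (\<Gamma> f) UNIV = ennreal (E f)) \<and>
     (\<forall>f\<in>F. \<forall>g\<in>F. (AE x in m. f x = g x) \<longrightarrow> \<Gamma> f = \<Gamma> g) \<and>
     (\<forall>f\<in>F. \<forall>g\<in>F. \<forall>U. open U \<and> (\<exists>a. AE x in m. x \<in> U \<longrightarrow> f x - g x = a) \<longrightarrow>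
        (\<forall>A\<in>sets borel. A \<subseteq> U \<longrightarrow> emeasure (\<Gamma> f) A = emeasure (\<Gamma> g) A)) \<and>
     (\<forall>f\<in>F. \<forall>\<phi> \<phi>'. continuous_on UNIV f \<and> \<phi> 0 = 0 \<and>
        (\<forall>t. (\<phi> has_real_derivative \<phi>' t) (at t)) \<and> continuous_on UNIV \<phi>' \<and> bounded (range \<phi>') \<longrightarrow>
        (\<phi> \<circ> f) \<in> F \<and> \<Gamma> (\<phi> \<circ> f) = density (\<Gamma> f) (\<lambda>x. ennreal (\<bar>\<phi>' (f x)\<bar> powr p)))"

definition PI_L ::
  "'a::metric_space measure \<Rightarrow> real \<Rightarrow> ('a \<Rightarrow> real) set \<Rightarrow> (('a \<Rightarrow> real) \<Rightarrow> 'a measure)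
     \<Rightarrow> (real \<Rightarrow> real) \<Rightarrow> bool" where
  "PI_L m p F \<Gamma> \<Psi> \<longleftrightarrow> (\<exists>C A. C > 0 \<and> A \<ge> 1 \<and> (\<forall>x r f. r > 0 \<and> f \<in> F \<longrightarrow>
     (\<integral>\<^sup>+y\<in>ball x r. ennreal (\<bar>f y - (\<integral>z\<in>ball x r. f z \<partial>m) / Vol m x r\<bar> powr p) \<partial>m)
       \<le> ennreal (C * \<Psi> r) * emeasure (\<Gamma> f) (ball x (A * r))))"

definition jump_kernel :: "'a::metric_space measure \<Rightarrow> (real \<Rightarrow> real) \<Rightarrow> ('a \<Rightarrow> 'a \<Rightarrow> real) \<Rightarrow> bool" where
  "jump_kernel m \<Upsilon> K \<longleftrightarrow>
     (\<lambda>(x, y). K x y) \<in> borel_measurable (m \<Otimes>\<^sub>M m) \<and>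
     (\<forall>x y. K x y = K y x) \<and>
     (\<exists>C1 C2. C1 > 0 \<and> C2 > 0 \<and> (\<forall>x y. x \<noteq> y \<longrightarrow>
        C1 / (Vol m x (dist x y) * \<Upsilon> (dist x y)) \<le> K x y \<and>
        K x y \<le> C2 / (Vol m x (dist x y) * \<Upsilon> (dist x y))))"

definition JGamma :: "'a measure \<Rightarrow> real \<Rightarrow> ('a \<Rightarrow> 'a \<Rightarrow> real) \<Rightarrow> ('a \<Rightarrow> real) \<Rightarrow> 'a set \<Rightarrow> ennreal" where
  "JGamma m p K u A = (\<integral>\<^sup>+x\<in>A. (\<integral>\<^sup>+y. ennreal (\<bar>u x - u y\<bar> powr p * K x y) \<partial>m) \<partial>m)"

definition JE :: "'a measure \<Rightarrow> real \<Rightarrow> ('a \<Rightarrow> 'a \<Rightarrow> real) \<Rightarrow> ('a \<Rightarrow> real) \<Rightarrow> real" where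
  "JE m p K u = enn2real (JGamma m p K u UNIV)"

definition JF :: "'a measure \<Rightarrow> real \<Rightarrow> ('a \<Rightarrow> 'a \<Rightarrow> real) \<Rightarrow> ('a \<Rightarrow> real) set" where
  "JF m p K = {u. Lp m p u \<and> JGamma m p K u UNIV < \<infinity>}"

definition CE_strong ::
  "'a::metric_space measure \<Rightarrow> ('a \<Rightarrow> real) set \<Rightarrow> (('a \<Rightarrow> real) \<Rightarrow> 'a set \<Rightarrow> ennreal)
     \<Rightarrow> (real \<Rightarrow> real) \<Rightarrow> bool" where
  "CE_strong m F \<Gamma> \<Phi> \<longleftrightarrow> (\<exists>\<delta> Ae C. 0 < \<delta> \<and> \<delta> < 1 \<and> Ae > 1 \<and> C > 0 \<and>
     (\<forall>x0 r. r > 0 \<longrightarrow> (\<exists>\<phi>\<in>F. cutoff m (ball x0 r) (ball x0 (Ae * r)) \<phi> \<and>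
        (\<forall>x y. \<bar>\<phi> x - \<phi> y\<bar> \<le> C * (min (dist x y / r) 1) powr \<delta>) \<and>
        (\<forall>x s. s > 0 \<longrightarrow> \<Gamma> \<phi> (ball x s)
            \<le> ennreal (C * (min (s / r) 1) powr \<delta> * Vol m x s / \<Phi> (min s r))))))"

abbreviation CE_strong_L where
  "CE_strong_L m F \<Gamma> \<Phi> \<equiv> CE_strong m F (\<lambda>f A. emeasure (\<Gamma> f) A) \<Phi>"

abbreviation CE_strong_J where
  "CE_strong_J m p K \<Phi> \<equiv> CE_strong m (JF m p K) (JGamma m p K) \<Phi>"

end

theory Submission
  imports Defs
begin

text \<open>
  The energy of jumps shorter than \<open>S\<close> is controlled by the given form: under \<open>UG\<close> because the
  two jump kernels are comparable there up to the factor \<open>\<Psi> S / \<Upsilon> S\<close>; under \<open>SUG\<close> because the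
  Poincare inequality bounds the jumps of size about \<open>t = S / 2\<^sup>n\<close> by
  \<open>\<Psi> t / \<Upsilon> t \<le> \<Theta> (1 / 2\<^sup>n) \<Psi> S / \<Upsilon> S\<close> times the local energy, which is summable in \<open>n\<close>. Longer jumps
  only see the \<open>L\<^sup>p\<close> norm, or the Hoelder continuity of a cutoff function, against the tail of the
  kernel. Hence the given domain lies in the new one and the given cutoff functions satisfy the new
  cutoff inequality. For the density of \<open>C\<^sub>c\<close> in the energy norm, replace \<open>f\<close> by its averages over
  the balls around an \<open>e\<close>-net, glued by a partition of unity made from the cutoff functions: the
  error is bounded by the energy of the jumps of \<open>f\<close> of size \<open>O(e)\<close>.
\<close>

section \<open>Powers and integrals of powers\<close>

text \<open>The new domain is defined by finiteness of the energy alone and may exceed the given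
  one, so density of \<open>Cc\<close> in the new energy norm is not inherited: the approximation of
  \<open>f\<close> may use only the energy of the short jumps of \<open>f\<close> itself. It
  succeeds because two scale factors cancel: a cutoff function at scale \<open>e\<close> costs a
  volume divided by \<open>\<Upsilon> e\<close>, while differences of averages of \<open>f\<close>
  are bounded by \<open>\<Upsilon> e\<close> times jump energy. The algebraic properties of the new
  form follow by viewing the increments \<open>u x - u y\<close> as elements of the L^p space of the
  measure with density \<open>K\<close> on pairs. What then remains is the Clarkson inequality for
  real numbers. It is read off from the given form on the line spanned by one cutoff function, whose
  energy is positive because the space is unbounded. The Hoelder exponent of the given cutoff
  functions may be too large for the tail of the kernel, so it is lowered below the growth exponent
  of \<open>\<Upsilon>\<close>.\<close>

text \<open>Convexity of the power at \<open>a + b = l * (a / l) + (1 - l) * (b / (1 - l))\<close>.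
  The weight \<open>l\<close> stays free; Minkowski's inequality results from choosing it after
  integration.\<close>

lemma powr_sum_le_split:
  fixes a b l p :: real
  assumes "0 \<le> a" "0 \<le> b" "0 < l" "l < 1" "1 \<le> p"
  shows "(a + b) powr p \<le> l powr (1 - p) * a powr p + (1 - l) powr (1 - p) * b powr p"
proof -
  have aux: "x powr p \<le> s powr (1 - p) * x powr p" if "0 < s" "s < 1" for s x :: real
  proof -
    have "1 powr (1-p) \<le> s powr (1 - p)"
      using that assms by (intro powr_mono2') auto
    then show ?thesis
      by (simp add: mult_le_cancel_right1)
  qed
  show ?thesis
  proof (cases "a = 0 \<or> b = 0")
    case True
    then show ?thesis using aux[of l a] aux[of "1 - l" b] assms by auto
  next
    case False
    then have ab: "0 < a" "0 < b" using assms by auto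
    have "((1 - l) *\<^sub>R (b / (1 - l)) + l *\<^sub>R (a / l)) powr p
        \<le> (1 - l) * (b / (1 - l)) powr p + l * (a / l) powr p"
      using assms ab by (intro convex_onD[OF powr_convex]) auto
    moreover have "(1 - l) *\<^sub>R (b / (1 - l)) + l *\<^sub>R (a / l) = a + b"
      using assms by simp
    moreover have "s * (x / s) powr p = s powr (1 - p) * x powr p" if "0 < s" "0 < x" for s x :: real
      using that by (simp add: powr_divide powr_diff)
    ultimately show ?thesis
      using assms ab by (simp add: add.commute)
  qed
qed

text \<open>The preceding inequality with exponent \<open>1 / t\<close>, applied to the two weighted
  terms: their powers \<open>1 / t\<close>, weighted again, give back \<open>a\<close> and
  \<open>b\<close>.\<close>

lemma powr_sum_ge_split:
  fixes a b l t :: real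
  assumes "0 \<le> a" "0 \<le> b" "0 < l" "l < 1" "0 < t" "t \<le> 1"
  shows "l powr (1 - t) * a powr t + (1 - l) powr (1 - t) * b powr t \<le> (a + b) powr t"
proof -
  let ?x = "l powr (1 - t) * a powr t" and ?y = "(1 - l) powr (1 - t) * b powr t"
  have e: "s powr (1 - 1/t) * (s powr (1 - t) * x powr t) powr (1/t) = x"
    if "0 < s" "0 \<le> x" for s x :: real
  proof -
    have "(s powr (1 - t) * x powr t) powr (1/t) = s powr ((1-t)/t) * x"
      using that assms by (simp add: powr_mult powr_powr)
    moreover have "s powr (1 - 1/t) * s powr ((1-t)/t) = 1"
      using that assms by (simp add: powr_add[symmetric] field_simps)
    ultimately show ?thesis by (simp add: mult.assoc[symmetric])
  qed
  have "(?x + ?y) powr (1/t)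
     \<le> l powr (1 - 1/t) * ?x powr (1/t) + (1 - l) powr (1 - 1/t) * ?y powr (1/t)"
    using assms by (intro powr_sum_le_split) auto
  also have "\<dots> = a + b"
    using assms e[of l a] e[of "1 - l" b] by simp
  finally have "((?x + ?y) powr (1/t)) powr t \<le> (a + b) powr t"
    using assms by (intro powr_mono2) auto
  moreover have "((?x + ?y) powr (1/t)) powr t = ?x + ?y"
    using assms by (simp add: powr_powr)
  ultimately show ?thesis by simp
qed

text \<open>Evaluates the weighted terms at the optimal weight \<open>l = A / (A + B)\<close>: they
  become \<open>(A + B) powr (p - 1)\<close> times \<open>A\<close> and \<open>B\<close>, and so add
  up to \<open>(A + B) powr p\<close>.\<close>

lemma powr_weight:
  fixes x s p :: real
  assumes "0 < x"
  shows "(x / s) powr (1 - p) * x powr p = s powr (p - 1) * x"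
proof -
  have "(x / s) powr (1 - p) * x powr p = (x powr (1 - p) * x powr p) / s powr (1 - p)"
    by (simp add: powr_divide)
  also have "x powr (1 - p) * x powr p = x"
    using assms by (simp add: powr_add[symmetric])
  also have "x / s powr (1 - p) = s powr (p - 1) * x"
    by (simp add: divide_powr_uminus)
  finally show ?thesis .
qed

lemma powr_add_le:
  fixes a b p :: real
  assumes "0 \<le> a" "0 \<le> b" "0 \<le> p"
  shows "(a + b) powr p \<le> 2 powr p * (a powr p + b powr p)"
proof -
  have "(a + b) powr p \<le> (2 * max a b) powr p"
    using assms by (intro powr_mono2) auto
  also have "\<dots> = 2 powr p * (max a b) powr p"
    by (simp add: powr_mult)
  also have "\<dots> \<le> 2 powr p * (a powr p + b powr p)"
    by (auto simp: max_def)
  finally show ?thesis .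
qed

lemma abs_diff_powr_le:
  fixes a b p :: real
  assumes "0 \<le> p"
  shows "\<bar>a - b\<bar> powr p \<le> 2 powr p * (\<bar>a\<bar> powr p + \<bar>b\<bar> powr p)"
proof -
  have "\<bar>a - b\<bar> powr p \<le> (\<bar>a\<bar> + \<bar>b\<bar>) powr p"
    using assms by (intro powr_mono2) auto
  also note powr_add_le[OF _ _ assms]
  finally show ?thesis by simp
qed

lemma abs_add_powr_le:
  fixes a b p :: real
  assumes "0 \<le> p"
  shows "\<bar>a + b\<bar> powr p \<le> 2 powr p * (\<bar>a\<bar> powr p + \<bar>b\<bar> powr p)"
  using abs_diff_powr_le[OF assms, of a "- b"] by simp

text \<open>Every term is at most the largest one. The constant depends only on a bound for the
  number of terms, which in sums over a net is the overlap and not the size of the index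
  set.\<close>

lemma abs_sum_powr_le:
  fixes f :: "'i \<Rightarrow> real" and p M :: real
  assumes "finite I" "real (card I) \<le> M" "0 \<le> p"
  shows "\<bar>\<Sum>i\<in>I. f i\<bar> powr p \<le> M powr p * (\<Sum>i\<in>I. \<bar>f i\<bar> powr p)"
proof (cases "I = {}")
  case False
  have "\<exists>j. j \<in> I \<and> (\<forall>i\<in>I. \<bar>f i\<bar> \<le> \<bar>f j\<bar>)"
  proof -
    have "Max ((\<lambda>i. \<bar>f i\<bar>) ` I) \<in> (\<lambda>i. \<bar>f i\<bar>) ` I"
      using assms False by (intro Max_in) auto
    then obtain j where "j \<in> I" "Max ((\<lambda>i. \<bar>f i\<bar>) ` I) = \<bar>f j\<bar>" by auto
    then show ?thesis using assms by (metis Max_ge finite_imageI imageI)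
  qed
  then obtain j where j: "j \<in> I" "\<And>i. i \<in> I \<Longrightarrow> \<bar>f i\<bar> \<le> \<bar>f j\<bar>"
    by blast
  have "\<bar>\<Sum>i\<in>I. f i\<bar> \<le> (\<Sum>i\<in>I. \<bar>f i\<bar>)" by (rule sum_abs)
  also have "\<dots> \<le> (\<Sum>i\<in>I. \<bar>f j\<bar>)" by (rule sum_mono) (use j in auto)
  also have "\<dots> \<le> M * \<bar>f j\<bar>" using assms by (simp add: mult_right_mono)
  finally have "\<bar>\<Sum>i\<in>I. f i\<bar> powr p \<le> (M * \<bar>f j\<bar>) powr p"
    using assms by (intro powr_mono2) auto
  also have "\<dots> = M powr p * \<bar>f j\<bar> powr p"
    by (simp add: powr_mult)
  also have "\<dots> \<le> M powr p * (\<Sum>i\<in>I. \<bar>f i\<bar> powr p)"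
    using assms j by (intro mult_left_mono member_le_sum) auto
  finally show ?thesis .
qed (use assms in auto)

text \<open>Split the integrand with a constant weight \<open>l\<close>, integrate, and take for
  \<open>l\<close> the share of the first norm in the sum of the two norms.\<close>

lemma Minkowski_powr:
  fixes u v :: "'a \<Rightarrow> real"
  assumes p: "1 \<le> p" and nn: "\<And>x. 0 \<le> u x" "\<And>x. 0 \<le> v x"
    and int: "integrable M (\<lambda>x. u x powr p)" "integrable M (\<lambda>x. v x powr p)"
    and [measurable]: "u \<in> borel_measurable M" "v \<in> borel_measurable M"
  shows "integrable M (\<lambda>x. (u x + v x) powr p)"
    and "(\<integral>x. (u x + v x) powr p \<partial>M) powr (1/p)
       \<le> (\<integral>x. u x powr p \<partial>M) powr (1/p) + (\<integral>x. v x powr p \<partial>M) powr (1/p)"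
proof -
  show int': "integrable M (\<lambda>x. (u x + v x) powr p)"
  proof (rule Bochner_Integration.integrable_bound)
    show "integrable M (\<lambda>x. 2 powr p * (u x powr p + v x powr p))"
      using int by simp
  qed (use powr_add_le[of "u _" "v _" p] nn p in auto)
  define A where "A = (\<integral>x. u x powr p \<partial>M) powr (1/p)"
  define B where "B = (\<integral>x. v x powr p \<partial>M) powr (1/p)"
  have Ap: "(\<integral>x. u x powr p \<partial>M) = A powr p" and Bp: "(\<integral>x. v x powr p \<partial>M) = B powr p"
    using p by (auto simp: A_def B_def powr_powr integral_nonneg)
  have "0 \<le> A" "0 \<le> B" by (auto simp: A_def B_def)
  have AE0: "AE x in M. w x = 0"
    if "integrable M (\<lambda>x. w x powr p)" "(\<integral>x. w x powr p \<partial>M) = 0" for w :: "'a \<Rightarrow> real"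
  proof -
    have "AE x in M. w x powr p = 0"
      using integral_nonneg_eq_0_iff_AE[OF that(1)] that(2) by auto
    then show ?thesis by simp
  qed
  \<comment> \<open>The weight must lie strictly between 0 and 1, so functions of norm zero are
    treated apart.\<close>
  consider "A = 0" | "B = 0" | "0 < A" "0 < B" using \<open>0 \<le> A\<close> \<open>0 \<le> B\<close> by linarith
  then have "(\<integral>x. (u x + v x) powr p \<partial>M) powr (1/p) \<le> A + B"
  proof cases
    case 1
    then have "AE x in M. u x = 0" using AE0[OF int(1)] Ap by simp
    then have "(\<integral>x. (u x + v x) powr p \<partial>M) = (\<integral>x. v x powr p \<partial>M)"
      by (intro integral_cong_AE) auto
    then show ?thesis using 1 by (simp add: B_def)
  next
    case 2
    then have "AE x in M. v x = 0" using AE0[OF int(2)] Bp by simp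
    then have "(\<integral>x. (u x + v x) powr p \<partial>M) = (\<integral>x. u x powr p \<partial>M)"
      by (intro integral_cong_AE) auto
    then show ?thesis using 2 by (simp add: A_def)
  next
    case 3
    define l where "l = A / (A + B)"
    have l: "0 < l" "l < 1" "1 - l = B / (A + B)" using 3 by (auto simp: l_def field_simps)
    have e: "(x / (A + B)) powr (1 - p) * x powr p = (A + B) powr (p - 1) * x" if "0 < x" for x
      using that by (rule powr_weight)
    have "(\<integral>x. (u x + v x) powr p \<partial>M)
        \<le> (\<integral>x. l powr (1 - p) * u x powr p + (1 - l) powr (1 - p) * v x powr p \<partial>M)"
      using int int' nn l p by (intro integral_mono powr_sum_le_split) auto
    also have "\<dots> = l powr (1 - p) * A powr p + (1 - l) powr (1 - p) * B powr p"
      using int by (simp add: Ap Bp)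
    also have "\<dots> = (A + B) powr (p - 1) * A + (A + B) powr (p - 1) * B"
      using e 3 by (simp add: l(3)) (simp add: l_def)
    also have "\<dots> = (A + B) powr p"
      using 3 powr_mult_base[of "A+B" "p - 1"] by (simp add: algebra_simps)
    finally have "(\<integral>x. (u x + v x) powr p \<partial>M) powr (1/p) \<le> ((A + B) powr p) powr (1/p)"
      using p by (intro powr_mono2) auto
    also have "\<dots> = A + B" using p 3 by (simp add: powr_powr)
    finally show ?thesis .
  qed
  then show "(\<integral>x. (u x + v x) powr p \<partial>M) powr (1/p)
       \<le> (\<integral>x. u x powr p \<partial>M) powr (1/p) + (\<integral>x. v x powr p \<partial>M) powr (1/p)"
    by (simp add: A_def B_def)
qed

text \<open>For exponents at most 1 the concave split reverses the argument, with the same optimal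
  weight. It is used with \<open>t = p - 1\<close> when \<open>p \<le> 2\<close>.\<close>

lemma reverse_Minkowski_powr:
  fixes u v :: "'a \<Rightarrow> real"
  assumes t: "0 < t" "t \<le> 1" and nn: "\<And>x. 0 \<le> u x" "\<And>x. 0 \<le> v x"
    and int: "integrable M (\<lambda>x. u x powr t)" "integrable M (\<lambda>x. v x powr t)"
    and [measurable]: "u \<in> borel_measurable M" "v \<in> borel_measurable M"
  shows "integrable M (\<lambda>x. (u x + v x) powr t)"
    and "((\<integral>x. u x powr t \<partial>M) powr (1/t) + (\<integral>x. v x powr t \<partial>M) powr (1/t)) powr t
       \<le> (\<integral>x. (u x + v x) powr t \<partial>M)"
proof -
  show int': "integrable M (\<lambda>x. (u x + v x) powr t)"
  proof (rule Bochner_Integration.integrable_bound)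
    show "integrable M (\<lambda>x. 2 powr t * (u x powr t + v x powr t))"
      using int by simp
  qed (use powr_add_le[of "u _" "v _" t] nn t in auto)
  define A where "A = (\<integral>x. u x powr t \<partial>M) powr (1/t)"
  define B where "B = (\<integral>x. v x powr t \<partial>M) powr (1/t)"
  have Ap: "(\<integral>x. u x powr t \<partial>M) = A powr t" and Bp: "(\<integral>x. v x powr t \<partial>M) = B powr t"
    using t by (auto simp: A_def B_def powr_powr integral_nonneg)
  have "0 \<le> A" "0 \<le> B" by (auto simp: A_def B_def)
  consider "A = 0" | "B = 0" | "0 < A" "0 < B" using \<open>0 \<le> A\<close> \<open>0 \<le> B\<close> by linarith
  then have "(A + B) powr t \<le> (\<integral>x. (u x + v x) powr t \<partial>M)"
  proof cases
    case 1
    have "(\<integral>x. v x powr t \<partial>M) \<le> (\<integral>x. (u x + v x) powr t \<partial>M)"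
      using int int' nn t by (intro integral_mono powr_mono2) auto
    then show ?thesis using 1 Bp by simp
  next
    case 2
    have "(\<integral>x. u x powr t \<partial>M) \<le> (\<integral>x. (u x + v x) powr t \<partial>M)"
      using int int' nn t by (intro integral_mono powr_mono2) auto
    then show ?thesis using 2 Ap by simp
  next
    case 3
    define l where "l = A / (A + B)"
    have l: "0 < l" "l < 1" "1 - l = B / (A + B)" using 3 by (auto simp: l_def field_simps)
    have e: "(x / (A + B)) powr (1 - t) * x powr t = (A + B) powr (t - 1) * x" if "0 < x" for x
      using that by (rule powr_weight)
    have "(A + B) powr t = (A + B) powr (t - 1) * A + (A + B) powr (t - 1) * B"
      using 3 powr_mult_base[of "A+B" "t - 1"] by (simp add: algebra_simps)
    also have "\<dots> = l powr (1 - t) * A powr t + (1 - l) powr (1 - t) * B powr t"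
      using e 3 by (simp add: l(3)) (simp add: l_def)
    also have "\<dots> = (\<integral>x. l powr (1 - t) * u x powr t + (1 - l) powr (1 - t) * v x powr t \<partial>M)"
      using int by (simp add: Ap Bp)
    also have "\<dots> \<le> (\<integral>x. (u x + v x) powr t \<partial>M)"
      using int int' nn l t by (intro integral_mono powr_sum_ge_split) auto
    finally show ?thesis .
  qed
  then show "((\<integral>x. u x powr t \<partial>M) powr (1/t) + (\<integral>x. v x powr t \<partial>M) powr (1/t)) powr t
       \<le> (\<integral>x. (u x + v x) powr t \<partial>M)"
    by (simp add: A_def B_def)
qed

section \<open>L^p spaces of measurable representatives\<close>

lemma Lp_iff_nn:
  assumes [measurable]: "f \<in> borel_measurable M"
  shows "Lp M p f \<longleftrightarrow> (\<integral>\<^sup>+x. ennreal (\<bar>f x\<bar> powr p) \<partial>M) < \<infinity>"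
  unfolding Lp_def by (subst integrable_iff_bounded) auto

lemma LpD:
  assumes "Lp M p f"
  shows "f \<in> borel_measurable M" "integrable M (\<lambda>x. \<bar>f x\<bar> powr p)"
    "ennreal (Lp_pow M p f) = (\<integral>\<^sup>+x. ennreal (\<bar>f x\<bar> powr p) \<partial>M)"
  using assms by (auto simp: Lp_def Lp_pow_def nn_integral_eq_integral)

lemma Lp_pow_nonneg: "0 \<le> Lp_pow M p f"
  by (simp add: Lp_pow_def)

lemma Lp_pow_eq_enn2real:
  assumes "f \<in> borel_measurable M"
  shows "Lp_pow M p f = enn2real (\<integral>\<^sup>+x. ennreal (\<bar>f x\<bar> powr p) \<partial>M)"
  unfolding Lp_pow_def using assms by (intro integral_eq_nn_integral) auto

lemma Lp_zero: "Lp M p (\<lambda>x. 0)"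
  by (simp add: Lp_def)

lemma Lp_add:
  assumes "0 \<le> p" "Lp M p f" "Lp M p g"
  shows "Lp M p (\<lambda>x. f x + g x)"
proof -
  have [measurable]: "f \<in> borel_measurable M" "g \<in> borel_measurable M"
    using assms by (auto simp: Lp_def)
  have "integrable M (\<lambda>x. \<bar>f x + g x\<bar> powr p)"
  proof (rule Bochner_Integration.integrable_bound)
    show "integrable M (\<lambda>x. 2 powr p * (\<bar>f x\<bar> powr p + \<bar>g x\<bar> powr p))"
      using assms by (simp add: Lp_def)
  qed (use abs_add_powr_le[OF assms(1), of "f _" "g _"] in auto)
  then show ?thesis by (simp add: Lp_def)
qed

lemma Lp_cmult:
  assumes "Lp M p f"
  shows "Lp M p (\<lambda>x. c * f x)" "Lp_pow M p (\<lambda>x. c * f x) = \<bar>c\<bar> powr p * Lp_pow M p f"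
  using assms by (auto simp: Lp_def Lp_pow_def abs_mult powr_mult)

lemma Lp_diff:
  assumes "0 \<le> p" "Lp M p f" "Lp M p g"
  shows "Lp M p (\<lambda>x. f x - g x)"
  using Lp_add[OF assms(1,2) Lp_cmult(1)[OF assms(3), of "-1"]] by simp

lemma Lp_mono:
  assumes "0 \<le> p" "Lp M p f" "g \<in> borel_measurable M" "\<And>x. \<bar>g x\<bar> \<le> \<bar>f x\<bar>"
  shows "Lp M p g" "Lp_pow M p g \<le> Lp_pow M p f"
proof -
  have [measurable]: "f \<in> borel_measurable M" "g \<in> borel_measurable M"
    using assms by (auto simp: Lp_def)
  have le: "\<bar>g x\<bar> powr p \<le> \<bar>f x\<bar> powr p" for x
    using assms by (intro powr_mono2) auto
  have "integrable M (\<lambda>x. \<bar>g x\<bar> powr p)"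
    using LpD(2)[OF assms(2)] by (rule Bochner_Integration.integrable_bound) (use le in auto)
  then show "Lp M p g" by (simp add: Lp_def)
  then show "Lp_pow M p g \<le> Lp_pow M p f"
    unfolding Lp_pow_def using assms(2) le by (intro integral_mono) (auto simp: Lp_def)
qed

lemma Lp_AE_cong:
  assumes "Lp M p f" "g \<in> borel_measurable M" "AE x in M. f x = g x"
  shows "Lp M p g" "Lp_pow M p g = Lp_pow M p f"
proof -
  have [measurable]: "f \<in> borel_measurable M" "g \<in> borel_measurable M"
    using assms by (auto simp: Lp_def)
  have ae: "AE x in M. \<bar>f x\<bar> powr p = \<bar>g x\<bar> powr p"
    using assms(3) by eventually_elim simp
  show "Lp M p g"
    using integrable_cong_AE[OF _ _ ae] assms(1) by (auto simp: Lp_def)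
  show "Lp_pow M p g = Lp_pow M p f"
    unfolding Lp_pow_def using ae by (intro integral_cong_AE) auto
qed

lemma Lp_triangle:
  assumes p: "1 \<le> p" and f: "Lp M p f" and g: "Lp M p g"
  shows "Lp_pow M p (\<lambda>x. f x + g x) powr (1/p) \<le> Lp_pow M p f powr (1/p) + Lp_pow M p g powr (1/p)"
proof -
  have [measurable]: "f \<in> borel_measurable M" "g \<in> borel_measurable M"
    using f g by (auto simp: Lp_def)
  note M = Minkowski_powr[OF p, of "\<lambda>x. \<bar>f x\<bar>" "\<lambda>x. \<bar>g x\<bar>" M]
  have "Lp_pow M p (\<lambda>x. f x + g x) \<le> (\<integral>x. (\<bar>f x\<bar> + \<bar>g x\<bar>) powr p \<partial>M)"
    unfolding Lp_pow_def using f g p Lp_add[OF _ f g]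
    by (intro integral_mono M powr_mono2) (auto simp: Lp_def)
  then have "Lp_pow M p (\<lambda>x. f x + g x) powr (1/p) \<le> (\<integral>x. (\<bar>f x\<bar> + \<bar>g x\<bar>) powr p \<partial>M) powr (1/p)"
    using p by (intro powr_mono2) (auto simp: Lp_pow_nonneg)
  also have "\<dots> \<le> Lp_pow M p f powr (1/p) + Lp_pow M p g powr (1/p)"
    unfolding Lp_pow_def using f g by (intro M) (auto simp: Lp_def)
  finally show ?thesis .
qed

section \<open>Clarkson's inequality and convergent subsequences\<close>

text \<open>The Clarkson inequality of the form \<open>\<bar>a\<bar> powr p\<close> on the real
  line. The nested powers are kept as they stand so that they match
  \<open>E f powr (1/(p-1))\<close> in \<open>clarkson\<close>.\<close>

definition scalar_clarkson :: "real \<Rightarrow> bool" where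
  "scalar_clarkson p \<longleftrightarrow> (\<forall>a b::real.
     (p \<le> 2 \<longrightarrow> \<bar>a + b\<bar> powr p + \<bar>a - b\<bar> powr p
        \<ge> 2 * ((\<bar>a\<bar> powr p) powr (1/(p-1)) + (\<bar>b\<bar> powr p) powr (1/(p-1))) powr (p-1)) \<and>
     (p \<ge> 2 \<longrightarrow> \<bar>a + b\<bar> powr p + \<bar>a - b\<bar> powr p
        \<le> 2 * ((\<bar>a\<bar> powr p) powr (1/(p-1)) + (\<bar>b\<bar> powr p) powr (1/(p-1))) powr (p-1)))"

text \<open>The scalar inequality is the Clarkson inequality on a line
  \<open>\<real> u\<close> with \<open>E u > 0\<close>, by homogeneity.\<close>
lemma scalar_clarksonI:
  assumes p: "1 < p" and pf: "p_form m p F E" and cl: "clarkson p F E" and u: "u \<in> F" "0 < E u"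
  shows "scalar_clarkson p"
  unfolding scalar_clarkson_def
proof (intro allI)
  fix a b :: real
  have hom: "E (\<lambda>x. c * u x) = \<bar>c\<bar> powr p * E u" and memb: "(\<lambda>x. c * u x) \<in> F" for c
    using pf u(1) unfolding p_form_def by blast+
  let ?S = "(\<bar>a\<bar> powr p) powr (1/(p-1)) + (\<bar>b\<bar> powr p) powr (1/(p-1))"
  have e1: "E (\<lambda>x. a * u x + b * u x) = \<bar>a + b\<bar> powr p * E u"
    and e2: "E (\<lambda>x. a * u x - b * u x) = \<bar>a - b\<bar> powr p * E u"
    using hom[of "a + b"] hom[of "a - b"] by (simp_all add: algebra_simps)
  have e3: "(E (\<lambda>x. a * u x) powr (1/(p-1)) + E (\<lambda>x. b * u x) powr (1/(p-1))) powr (p-1)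
      = ?S powr (p-1) * E u"
  proof -
    have "E (\<lambda>x. a * u x) powr (1/(p-1)) + E (\<lambda>x. b * u x) powr (1/(p-1)) = ?S * E u powr (1/(p-1))"
      by (simp add: hom powr_mult algebra_simps)
    then show ?thesis using p u by (simp add: powr_mult powr_powr)
  qed
  note C = cl[unfolded clarkson_def, rule_format, OF memb[of a] memb[of b]]
  show "(p \<le> 2 \<longrightarrow> \<bar>a + b\<bar> powr p + \<bar>a - b\<bar> powr p \<ge> 2 * ?S powr (p-1)) \<and>
        (p \<ge> 2 \<longrightarrow> \<bar>a + b\<bar> powr p + \<bar>a - b\<bar> powr p \<le> 2 * ?S powr (p-1))"
  proof (intro conjI impI)
    assume "p \<le> 2"
    then have "(2 * ?S powr (p-1)) * E u \<le> (\<bar>a + b\<bar> powr p + \<bar>a - b\<bar> powr p) * E u"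
      using C unfolding e1 e2 e3 by (simp add: algebra_simps)
    then show "2 * ?S powr (p-1) \<le> \<bar>a + b\<bar> powr p + \<bar>a - b\<bar> powr p"
      using u(2) by (rule mult_right_le_imp_le)
  next
    assume "p \<ge> 2"
    then have "(\<bar>a + b\<bar> powr p + \<bar>a - b\<bar> powr p) * E u \<le> (2 * ?S powr (p-1)) * E u"
      using C unfolding e1 e2 e3 by (simp add: algebra_simps)
    then show "\<bar>a + b\<bar> powr p + \<bar>a - b\<bar> powr p \<le> 2 * ?S powr (p-1)"
      using u(2) by (rule mult_right_le_imp_le)
  qed
qed

text \<open>Integrating the scalar inequality gives the norm inequality by Minkowski's
  inequality with exponent \<open>p - 1\<close>, which is reversed for \<open>p \<le> 2\<close>.\<close>
lemma Lp_clarkson: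
  assumes p: "1 < p" and sc: "scalar_clarkson p"
  shows "clarkson p (Collect (Lp M p)) (Lp_pow M p)"
  unfolding clarkson_def
proof (intro ballI)
  fix f g assume "f \<in> Collect (Lp M p)" "g \<in> Collect (Lp M p)"
  then have f: "Lp M p f" and g: "Lp M p g" by auto
  have p0: "0 \<le> p" using p by simp
  have [measurable]: "f \<in> borel_measurable M" "g \<in> borel_measurable M"
    using f g by (auto simp: Lp_def)
  \<comment> \<open>The pointwise right side of the scalar inequality is then
    \<open>2 * (u x + v x) powr (p-1)\<close>.\<close>
  define u where "u = (\<lambda>x. (\<bar>f x\<bar> powr p) powr (1/(p-1)))"
  define v where "v = (\<lambda>x. (\<bar>g x\<bar> powr p) powr (1/(p-1)))"
  have [measurable]: "u \<in> borel_measurable M" "v \<in> borel_measurable M"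
    by (auto simp: u_def v_def)
  have u: "u x powr (p-1) = \<bar>f x\<bar> powr p" and v: "v x powr (p-1) = \<bar>g x\<bar> powr p" for x
    using p by (simp_all add: u_def v_def powr_powr)
  have nn: "0 \<le> u x" "0 \<le> v x" for x by (simp_all add: u_def v_def)
  have int: "integrable M (\<lambda>x. u x powr (p-1))" "integrable M (\<lambda>x. v x powr (p-1))"
    using f g by (auto simp: u v Lp_def)
  have int2: "integrable M (\<lambda>x. \<bar>f x + g x\<bar> powr p)" "integrable M (\<lambda>x. \<bar>f x - g x\<bar> powr p)"
    using Lp_add[OF p0 f g] Lp_diff[OF p0 f g] by (auto simp: Lp_def)
  have S: "Lp_pow M p (\<lambda>x. f x + g x) + Lp_pow M p (\<lambda>x. f x - g x)
      = (\<integral>x. \<bar>f x + g x\<bar> powr p + \<bar>f x - g x\<bar> powr p \<partial>M)"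
    using int2 by (simp add: Lp_pow_def)
  let ?R = "(Lp_pow M p f powr (1/(p-1)) + Lp_pow M p g powr (1/(p-1))) powr (p-1)"
  show "(p \<le> 2 \<longrightarrow> 2 * ?R \<le> Lp_pow M p (\<lambda>x. f x + g x) + Lp_pow M p (\<lambda>x. f x - g x)) \<and>
        (p \<ge> 2 \<longrightarrow> Lp_pow M p (\<lambda>x. f x + g x) + Lp_pow M p (\<lambda>x. f x - g x) \<le> 2 * ?R)"
  proof (intro conjI impI)
    assume "p \<le> 2"
    then have t: "0 < p - 1" "p - 1 \<le> 1" using p by auto
    note RM = reverse_Minkowski_powr[OF t, of u v M]
    have "2 * ?R \<le> 2 * (\<integral>x. (u x + v x) powr (p-1) \<partial>M)"
      using RM(2) nn int by (simp add: u v Lp_pow_def)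
    also have "\<dots> = (\<integral>x. 2 * (u x + v x) powr (p-1) \<partial>M)" by simp
    also have "\<dots> \<le> (\<integral>x. \<bar>f x + g x\<bar> powr p + \<bar>f x - g x\<bar> powr p \<partial>M)"
      using RM(1) nn int int2 sc \<open>p \<le> 2\<close>
      by (intro integral_mono) (auto simp: u_def v_def scalar_clarkson_def)
    finally show "2 * ?R \<le> Lp_pow M p (\<lambda>x. f x + g x) + Lp_pow M p (\<lambda>x. f x - g x)"
      by (simp add: S)
  next
    assume "p \<ge> 2"
    then have t: "1 \<le> p - 1" by auto
    note RM = Minkowski_powr[OF t, of u v M]
    have "(\<integral>x. \<bar>f x + g x\<bar> powr p + \<bar>f x - g x\<bar> powr p \<partial>M) \<le> (\<integral>x. 2 * (u x + v x) powr (p-1) \<partial>M)"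
      using RM(1) nn int int2 sc \<open>p \<ge> 2\<close>
      by (intro integral_mono) (auto simp: u_def v_def scalar_clarkson_def)
    also have "\<dots> = 2 * ((\<integral>x. (u x + v x) powr (p-1) \<partial>M) powr (1/(p-1))) powr (p-1)"
      using t by (simp add: powr_powr integral_nonneg)
    also have "\<dots> \<le> 2 * ?R"
      using RM(2) nn int t by (intro mult_left_mono powr_mono2) (auto simp: u v Lp_pow_def)
    finally show "Lp_pow M p (\<lambda>x. f x + g x) + Lp_pow M p (\<lambda>x. f x - g x) \<le> 2 * ?R"
      by (simp add: S)
  qed
qed

text \<open>Along a subsequence the increments are so small in \<open>L\<^sup>p\<close> that
  \<open>\<Sum>k. 2\<^bsup>k\<^esup> \<bar>f (r (k+1)) - f (r k)\<bar>\<^bsup>p\<^esup>\<close> is finite almost everywhere.\<close>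
lemma Lp_Cauchy_subseq:
  fixes f :: "nat \<Rightarrow> 'a \<Rightarrow> real"
  assumes p: "1 < p" and f: "\<And>n. Lp M p (f n)"
    and Cau: "\<And>e. 0 < e \<Longrightarrow> \<exists>N. \<forall>n\<ge>N. \<forall>k\<ge>N. Lp_pow M p (\<lambda>x. f n x - f k x) < e"
  obtains r g where "strict_mono r" "g \<in> borel_measurable M"
    "AE x in M. (\<lambda>k. f (r k) x) \<longlonglongrightarrow> g x"
proof -
  have [measurable]: "f n \<in> borel_measurable M" for n using f by (auto simp: Lp_def)
  have p0: "0 \<le> p" using p by simp
  \<comment> \<open>The rate \<open>(1/4)^k\<close> leaves the summable \<open>(1/2)^k\<close> after
    multiplication by the weight \<open>2^k\<close>.\<close>
  have "\<exists>N. \<forall>k. \<forall>n\<ge>N k. \<forall>j\<ge>N k. Lp_pow M p (\<lambda>x. f n x - f j x) < (1/4)^k"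
    by (rule choice) (use Cau in auto)
  then obtain N where N: "\<And>k n j. n \<ge> N k \<Longrightarrow> j \<ge> N k \<Longrightarrow> Lp_pow M p (\<lambda>x. f n x - f j x) < (1/4)^k"
    by blast
  define r where "r = rec_nat (N 0) (\<lambda>k y. max (Suc y) (N (Suc k)))"
  have rS: "r (Suc k) = max (Suc (r k)) (N (Suc k))" for k by (simp add: r_def)
  have sm: "strict_mono r" by (rule strict_monoI_Suc) (simp add: rS)
  have rN: "N k \<le> r k" for k by (cases k) (auto simp: rS, simp add: r_def)
  have rr: "N k \<le> r (Suc k)" for k using rN[of k] rS[of k] by simp
  define d where "d = (\<lambda>k x. \<bar>f (r (Suc k)) x - f (r k) x\<bar>)"
  have [measurable]: "d k \<in> borel_measurable M" for k by (simp add: d_def)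
  have dk: "(\<integral>\<^sup>+x. ennreal (2^k * d k x powr p) \<partial>M) \<le> ennreal ((1/2)^k)" for k
  proof -
    have L: "Lp M p (\<lambda>x. f (r (Suc k)) x - f (r k) x)" by (intro Lp_diff p0 f)
    have "(\<integral>\<^sup>+x. ennreal (2^k * d k x powr p) \<partial>M)
        = ennreal (2^k) * (\<integral>\<^sup>+x. ennreal (d k x powr p) \<partial>M)"
      by (simp add: ennreal_mult nn_integral_cmult)
    also have "(\<integral>\<^sup>+x. ennreal (d k x powr p) \<partial>M) = ennreal (Lp_pow M p (\<lambda>x. f (r (Suc k)) x - f (r k) x))"
      using LpD(3)[OF L] by (simp add: d_def)
    also have "ennreal (2^k) * \<dots> \<le> ennreal (2^k) * ennreal ((1/4)^k)"
      by (intro mult_left_mono ennreal_leI less_imp_le N rN rr) auto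
    also have "\<dots> = ennreal ((1/2)^k)"
      by (simp add: ennreal_mult[symmetric] power_mult_distrib[symmetric])
    finally show ?thesis .
  qed
  have "(\<integral>\<^sup>+x. (\<Sum>k. ennreal (2^k * d k x powr p)) \<partial>M) = (\<Sum>k. \<integral>\<^sup>+x. ennreal (2^k * d k x powr p) \<partial>M)"
    by (rule nn_integral_suminf) simp
  also have "\<dots> \<le> (\<Sum>k. ennreal ((1/2)^k))"
    by (intro suminf_le dk) auto
  also have "\<dots> = ennreal (\<Sum>k. (1/2)^k)"
    by (rule suminf_ennreal2) auto
  also have "\<dots> < \<infinity>" by simp
  finally have "AE x in M. (\<Sum>k. ennreal (2^k * d k x powr p)) \<noteq> \<infinity>"
    by (intro nn_integral_noteq_infinite) auto
  then have conv: "AE x in M. convergent (\<lambda>k. f (r k) x)"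
  proof eventually_elim
    fix x assume fin: "(\<Sum>k. ennreal (2^k * d k x powr p)) \<noteq> \<infinity>"
    have "summable (\<lambda>k. 2^k * d k x powr p)"
      using fin by (intro summable_suminf_not_top) (auto simp: top_unique)
    then have "(\<lambda>k. 2^k * d k x powr p) \<longlonglongrightarrow> 0" by (rule summable_LIMSEQ_zero)
    then have ev: "\<forall>\<^sub>F k in sequentially. 2^k * d k x powr p < 1"
      by (rule order_tendstoD) simp
    \<comment> \<open>From \<open>2^k * d k x powr p < 1\<close> follows
      \<open>d k x \<le> q ^ k\<close>, so the increments are eventually dominated by a geometric
      series.\<close>
    define q where "q = (1/2::real) powr (1/p)"
    have q: "0 < q" "q < 1"
    proof -
      show "0 < q" by (simp add: q_def)
      have "(1/2::real) powr (1/p) < 1 powr (1/p)" using p by (intro powr_less_mono2) auto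
      then show "q < 1" by (simp add: q_def)
    qed
    have "\<forall>\<^sub>F k in sequentially. norm (f (r (Suc k)) x - f (r k) x) \<le> q ^ k"
      using ev
    proof eventually_elim
      fix k assume "2^k * d k x powr p < 1"
      then have "d k x powr p \<le> (1/2)^k"
        by (simp add: field_simps)
      then have "(d k x powr p) powr (1/p) \<le> ((1/2)^k) powr (1/p)"
        using p by (intro powr_mono2) auto
      moreover have "(d k x powr p) powr (1/p) = d k x" using p by (simp add: powr_powr d_def)
      moreover have "((1/2)^k) powr (1/p) = q ^ k"
        by (simp add: q_def powr_power powr_realpow[symmetric] powr_powr mult.commute)
      ultimately show "norm (f (r (Suc k)) x - f (r k) x) \<le> q ^ k" by (simp add: d_def)
    qed
    then have "summable (\<lambda>k. f (r (Suc k)) x - f (r k) x)"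
      by (rule summable_comparison_test_ev) (use q in \<open>auto intro: summable_geometric\<close>)
    then have "convergent (\<lambda>n. f (r n) x - f (r 0) x)"
      by (simp add: summable_iff_convergent sum_lessThan_telescope[of "\<lambda>n. f (r n) x"])
    then show "convergent (\<lambda>k. f (r k) x)"
      by (simp add: convergent_diff_const_right_iff)
  qed
  show ?thesis
  proof (rule that[OF sm])
    \<comment> \<open>Where the sequence diverges, \<open>lim\<close> is some default value; the
      function is measurable all the same, and divergence occurs only on a null set.\<close>
    show "(\<lambda>x. lim (\<lambda>k. f (r k) x)) \<in> borel_measurable M" by measurable
    show "AE x in M. (\<lambda>k. f (r k) x) \<longlonglongrightarrow> lim (\<lambda>k. f (r k) x)"
      using conv by eventually_elim (simp add: convergent_LIMSEQ_iff)
  qed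
qed

lemma Fatou_powr:
  fixes h :: "nat \<Rightarrow> 'a \<Rightarrow> real"
  assumes [measurable]: "\<And>k. h k \<in> borel_measurable M" and "0 < p"
    and lim: "AE x in M. (\<lambda>k. h k x) \<longlonglongrightarrow> g x"
    and bd: "\<And>k. k \<ge> N \<Longrightarrow> (\<integral>\<^sup>+x. ennreal (\<bar>h k x\<bar> powr p) \<partial>M) \<le> e"
  shows "(\<integral>\<^sup>+x. ennreal (\<bar>g x\<bar> powr p) \<partial>M) \<le> e"
proof -
  have "(\<integral>\<^sup>+x. ennreal (\<bar>g x\<bar> powr p) \<partial>M) = (\<integral>\<^sup>+x. liminf (\<lambda>k. ennreal (\<bar>h k x\<bar> powr p)) \<partial>M)"
  proof (rule nn_integral_cong_AE)
    show "AE x in M. ennreal (\<bar>g x\<bar> powr p) = liminf (\<lambda>k. ennreal (\<bar>h k x\<bar> powr p))"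
      using lim
    proof eventually_elim
      fix x assume "(\<lambda>k. h k x) \<longlonglongrightarrow> g x"
      then have "(\<lambda>k. ennreal (\<bar>h k x\<bar> powr p)) \<longlonglongrightarrow> ennreal (\<bar>g x\<bar> powr p)"
        using \<open>0 < p\<close> by (intro tendsto_ennrealI tendsto_powr2 tendsto_rabs) auto
      then show "ennreal (\<bar>g x\<bar> powr p) = liminf (\<lambda>k. ennreal (\<bar>h k x\<bar> powr p))"
        by (intro lim_imp_Liminf[symmetric]) auto
    qed
  qed
  also have "\<dots> \<le> liminf (\<lambda>k. \<integral>\<^sup>+x. ennreal (\<bar>h k x\<bar> powr p) \<partial>M)"
    by (rule nn_integral_liminf) simp
  also have "\<dots> \<le> e"
    by (rule Liminf_le) (use bd in \<open>auto simp: eventually_sequentially\<close>)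
  finally show ?thesis .
qed

section \<open>Volume doubling and nets\<close>

lemma countable_dense_setE:
  assumes "separable_space (euclidean :: ('a::metric_space) topology)"
  obtains D :: "'a::metric_space set" where "countable D" "\<And>x e. 0 < e \<Longrightarrow> \<exists>q\<in>D. dist x q < e"
proof -
  obtain D :: "'a set" where D: "countable D" "closure D = UNIV"
    using assms unfolding separable_space_def by auto
  have "\<exists>q\<in>D. dist x q < e" if "0 < e" for x e
    using that D(2) by (metis UNIV_I closure_approachable dist_commute)
  with D(1) show ?thesis by (rule that)
qed

text \<open>The product of two Borel sigma-algebras need not contain all open sets of the product
  space. Separability makes each sublevel set of the distance a countable union of products of
  balls.\<close>

lemma measurable_dist_separable:
  fixes M N :: "'a::metric_space measure"
  assumes sep: "separable_space (euclidean :: 'a topology)"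
    and M: "sets M = sets borel" and N: "sets N = sets borel"
  shows "(\<lambda>(x, y). dist x y) \<in> borel_measurable (M \<Otimes>\<^sub>M N)"
proof (rule borel_measurableI_less)
  fix t :: real
  obtain D :: "'a set" where D: "countable D" "\<And>x e. 0 < e \<Longrightarrow> \<exists>q\<in>D. dist x q < e"
    using countable_dense_setE[OF sep] by metis
  have sp: "space (M \<Otimes>\<^sub>M N) = UNIV"
    using sets_eq_imp_space_eq[OF M] sets_eq_imp_space_eq[OF N] by (simp add: space_pair_measure)
  have "{z. (case z of (x, y) \<Rightarrow> dist x y) < t}
      = (\<Union>q\<in>D. \<Union>r\<in>\<rat>. ball q r \<times> ball q (t - r))" (is "?L = ?R")
  proof safe
    fix x y :: 'a assume "dist x y < t"
    \<comment> \<open>A quarter of the gap suffices: \<open>q\<close> is within \<open>?h\<close> of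
      \<open>x\<close>, hence within \<open>t - 3 * ?h\<close> of \<open>y\<close>, and the radius
      \<open>r\<close> lies between \<open>?h\<close> and \<open>2 * ?h\<close>.\<close>
    then have h: "0 < (t - dist x y) / 4" (is "0 < ?h") by simp
    obtain q where q: "q \<in> D" "dist x q < ?h" using D(2)[OF h] by blast
    obtain r where r: "r \<in> \<rat>" "?h < r" "r < 2 * ?h"
      using Rats_dense_in_real[of ?h "2 * ?h"] h by auto
    have "dist q y \<le> dist x q + dist x y" by (metis dist_commute dist_triangle3)
    then have "dist q y < t - r" using q r by (simp add: field_simps)
    moreover have "dist q x < r" using q r by (simp add: dist_commute)
    ultimately show "(x, y) \<in> ?R" using q(1) r(1) by auto
  next
    fix x y q r assume "x \<in> ball q r" "y \<in> ball q (t - r)"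
    then show "dist x y < t" using dist_triangle[of x y q] by (simp add: dist_commute)
  qed
  moreover have "?R \<in> sets (M \<Otimes>\<^sub>M N)"
    using D(1) countable_rat by (intro sets.countable_UN' pair_measureI) (auto simp: M N)
  ultimately show "{z \<in> space (M \<Otimes>\<^sub>M N). (case z of (x, y) \<Rightarrow> dist x y) < t} \<in> sets (M \<Otimes>\<^sub>M N)"
    by (simp add: sp)
qed

definition separated :: "real \<Rightarrow> 'a::metric_space set \<Rightarrow> bool" where
  "separated e N \<longleftrightarrow> (\<forall>x\<in>N. \<forall>y\<in>N. x \<noteq> y \<longrightarrow> e \<le> dist x y)"

definition is_net :: "real \<Rightarrow> 'a::metric_space set \<Rightarrow> bool" where
  "is_net e N \<longleftrightarrow> separated e N \<and> (\<forall>x. \<exists>z\<in>N. dist z x < e)"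

text \<open>A maximal separated set, by Zorn's lemma: a point at distance at least \<open>e\<close>
  from all of it could still be added.\<close>

lemma is_net_exists:
  assumes "0 < e"
  obtains N :: "'a::metric_space set" where "is_net e N"
proof -
  obtain N :: "'a set" where N: "separated e N" "\<And>S. separated e S \<Longrightarrow> N \<subseteq> S \<Longrightarrow> S = N"
  proof -
    have "\<exists>N\<in>{S :: 'a set. separated e S}. \<forall>S\<in>{S. separated e S}. N \<subseteq> S \<longrightarrow> S = N"
    proof (rule subset_Zorn')
      fix C assume C: "subset.chain {S :: 'a set. separated e S} C"
      show "\<Union>C \<in> {S. separated e S}"
        unfolding mem_Collect_eq separated_def
      proof (intro ballI impI)
        fix x y assume "x \<in> \<Union>C" "y \<in> \<Union>C" "x \<noteq> y"
        then obtain S T where "S \<in> C" "T \<in> C" "x \<in> S" "y \<in> T" by auto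
        with C obtain U where "U \<in> C" "x \<in> U" "y \<in> U"
          unfolding subset.chain_def by blast
        moreover from \<open>U \<in> C\<close> C have "separated e U" unfolding subset.chain_def by auto
        ultimately show "e \<le> dist x y" using \<open>x \<noteq> y\<close> by (auto simp: separated_def)
      qed
    qed
    then show ?thesis using that by blast
  qed
  have "\<exists>z\<in>N. dist z x < e" for x
  proof (rule ccontr)
    assume far: "\<not> (\<exists>z\<in>N. dist z x < e)"
    then have "separated e (insert x N)"
      using N(1) by (auto simp: separated_def not_less dist_commute)
    then have "x \<in> N" using N(2)[of "insert x N"] by auto
    then show False using far assms by auto
  qed
  then show ?thesis using that[of N] N(1) by (auto simp: is_net_def)
qed

locale doubling_space =
  fixes m :: "'a::metric_space measure"
  assumes standing: "standing_space TYPE('a)"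
    and radon: "radon_full_support m"
    and doubling: "volume_doubling m"
begin

lemma sep: "separable_space (euclidean :: 'a topology)"
  using standing by (simp add: standing_space_def)

lemma sets_m[measurable_cong, simp]: "sets m = sets borel"
  using radon by (simp add: radon_full_support_def)

lemma space_m[simp]: "space m = UNIV"
  using sets_eq_imp_space_eq[OF sets_m] by simp

lemma ball_in_sets[measurable]: "ball (x::'a) r \<in> sets borel"
  by simp

lemma measurable_dist[measurable]: "(\<lambda>(x, y). dist x y) \<in> borel_measurable (m \<Otimes>\<^sub>M m)"
  by (rule measurable_dist_separable[OF sep sets_m sets_m])

lemma ball_subset_ball: "dist y x + s \<le> t \<Longrightarrow> ball x s \<subseteq> ball (y::'a) t"
proof
  fix z assume "dist y x + s \<le> t" "z \<in> ball x s"
  then show "z \<in> ball y t" using dist_triangle[of y z x] by simp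
qed

lemma emeasure_ball_finite: "emeasure m (ball x r) < \<infinity>"
proof -
  have "emeasure m (closure (ball x r)) < \<infinity>"
    using standing radon by (auto simp: standing_space_def radon_full_support_def)
  moreover have "emeasure m (ball x r) \<le> emeasure m (closure (ball x r))"
    by (intro emeasure_mono closure_subset) simp
  ultimately show ?thesis by order
qed

lemma emeasure_ball: "emeasure m (ball x r) = ennreal (Vol m x r)"
  unfolding Vol_def using emeasure_ball_finite[of x r]
  by (intro emeasure_eq_ennreal_measure) (auto simp: less_top)

lemma Vol_pos: "0 < r \<Longrightarrow> 0 < Vol m x r"
  using radon emeasure_ball[of x r] by (auto simp: radon_full_support_def dest!: spec[of _ x] spec[of _ r])

lemma Vol_nonneg[simp]: "0 \<le> Vol m x r"
  by (simp add: Vol_def)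

lemma Vol_mono_ball: "ball x r \<subseteq> ball y s \<Longrightarrow> Vol m x r \<le> Vol m y s"
  unfolding Vol_def by (rule measure_mono_fmeasurable)
    (use emeasure_ball_finite in \<open>auto simp: fmeasurable_def\<close>)

text \<open>With \<open>L < 2 ^ n\<close>, the first ball lies in the second one enlarged by
  \<open>n\<close> doublings. The single condition covers a change of centre and of radius at once,
  and the constant depends on \<open>L\<close> alone.\<close>

lemma Vol_comparable:
  obtains C where "1 \<le> C"
    "\<And>x y r s. 0 < r \<Longrightarrow> dist x y + s \<le> L * r \<Longrightarrow> Vol m x s \<le> C * Vol m y r"
proof -
  obtain D where D: "\<And>x r. Vol m x (2 * r) \<le> D * Vol m x r"
    using doubling by (auto simp: volume_doubling_def)
  define C where "C = max 1 D"
  have C: "1 \<le> C" "Vol m x (2 * r) \<le> C * Vol m x r" for x r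
    using order_trans[OF D mult_right_mono[of D C "Vol m x r"]] by (auto simp: C_def)
  obtain n :: nat where n: "L < 2 ^ n" using real_arch_pow[of 2 L] by auto
  have it: "Vol m y (2 ^ k * r) \<le> C ^ k * Vol m y r" for y r k
  proof (induction k)
    case (Suc k)
    have "Vol m y (2 ^ Suc k * r) \<le> C * Vol m y (2 ^ k * r)"
      using C(2)[of y "2 ^ k * r"] by (simp add: mult.assoc)
    also have "\<dots> \<le> C * (C ^ k * Vol m y r)"
      using Suc C(1) by (intro mult_left_mono) auto
    finally show ?case by (simp add: mult.assoc)
  qed simp
  show ?thesis
  proof (rule that[of "C ^ n"])
    show "1 \<le> C ^ n" using C(1) by simp
    fix x y :: 'a and r s :: real assume r: "0 < r" "dist x y + s \<le> L * r"
    have "L * r \<le> 2 ^ n * r" using n r by (intro mult_right_mono) auto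
    then have "dist y x + s \<le> 2 ^ n * r" using r(2) dist_commute[of x y] by linarith
    then have "ball x s \<subseteq> ball y (2 ^ n * r)" by (rule ball_subset_ball)
    then show "Vol m x s \<le> C ^ n * Vol m y r"
      using Vol_mono_ball it order_trans by blast
  qed
qed

lemma sigma_finite_m: "sigma_finite_measure m"
proof
  let ?A = "range (\<lambda>n::nat. ball (undefined::'a) (real n))"
  have "x \<in> \<Union>?A" for x
    using reals_Archimedean2[of "dist undefined x"] by auto
  then have "\<Union>?A = space m" by auto
  moreover have "\<forall>a\<in>?A. emeasure m a \<noteq> \<infinity>"
    using emeasure_ball_finite by (auto simp: less_top[symmetric])
  ultimately show "\<exists>A. countable A \<and> A \<subseteq> sets m \<and> \<Union>A = space m \<and> (\<forall>a\<in>A. emeasure m a \<noteq> \<infinity>)"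
    by (intro exI[of _ ?A]) auto
qed

sublocale sigma_finite_measure m by (rule sigma_finite_m)
sublocale pair: pair_sigma_finite m m ..

section \<open>Packing and overlap of nets\<close>

text \<open>Packing: the balls of radius \<open>e / 2\<close> around separated points are disjoint,
  lie in one ball of radius of order \<open>e\<close>, and each has volume comparable to it.\<close>

lemma separated_card:
  obtains M :: real where "1 \<le> M"
    "\<And>e N (x::'a). 0 < e \<Longrightarrow> separated e N \<Longrightarrow>
       finite {z\<in>N. dist z x < L * e} \<and> real (card {z\<in>N. dist z x < L * e}) \<le> M"
proof -
  \<comment> \<open>Centres are at most \<open>\<bar>L\<bar> * e\<close> apart and the large radius
    is \<open>(\<bar>L\<bar> + 1/2) * e\<close>; the sum is \<open>4 * \<bar>L\<bar> + 1\<close>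
    times the small radius \<open>e / 2\<close>.\<close>
  obtain C where C: "1 \<le> C"
    "\<And>x y r s. 0 < r \<Longrightarrow> dist x y + s \<le> (4 * \<bar>L\<bar> + 1) * r \<Longrightarrow> Vol m x s \<le> C * Vol m y r"
    using Vol_comparable[of "4 * \<bar>L\<bar> + 1"] by metis
  show ?thesis
  proof (rule that[of C])
    fix e :: real and N :: "'a set" and x :: 'a assume e: "0 < e" and N: "separated e N"
    let ?S = "{z\<in>N. dist z x < L * e}" and ?V = "Vol m x ((\<bar>L\<bar> + 1/2) * e)"
    have Vp: "0 < ?V" using e by (intro Vol_pos) (auto intro!: mult_pos_pos add_nonneg_pos)
    \<comment> \<open>A uniform bound for all finite subsets yields the finiteness of
      \<open>?S\<close> together with the count.\<close>
    have "card T \<le> nat \<lfloor>C\<rfloor>" if T: "T \<subseteq> ?S" "finite T" for T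
    proof -
      have Le: "L * e \<le> \<bar>L\<bar> * e" using e by (intro mult_right_mono) auto
      have "?V / C \<le> Vol m z (e / 2)" if "z \<in> T" for z
      proof -
        have "dist x z + (\<bar>L\<bar> + 1/2) * e \<le> (4 * \<bar>L\<bar> + 1) * (e / 2)"
          using that T Le by (auto simp: algebra_simps dist_commute)
        then show ?thesis using C(2)[of "e/2" x z] e C(1) by (simp add: field_simps)
      qed
      then have "(\<Sum>z\<in>T. ?V / C) \<le> (\<Sum>z\<in>T. Vol m z (e / 2))" by (rule sum_mono)
      also have "\<dots> = measure m (\<Union>z\<in>T. ball z (e / 2))"
      proof -
        have "disjoint_family_on (\<lambda>z. ball z (e / 2)) T"
          unfolding disjoint_family_on_def
        proof (intro ballI impI)
          fix y z assume "y \<in> T" "z \<in> T" "y \<noteq> z"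
          then have "e \<le> dist y z" using N T by (auto simp: separated_def)
          then show "ball y (e / 2) \<inter> ball z (e / 2) = {}"
            by (intro disjoint_ballI) simp
        qed
        then show ?thesis unfolding Vol_def using T(2) emeasure_ball_finite
          by (intro measure_finite_Union[symmetric]) (auto simp: less_top[symmetric])
      qed
      also have "\<dots> \<le> ?V"
        unfolding Vol_def
      proof (rule measure_mono_fmeasurable)
        show "(\<Union>z\<in>T. ball z (e / 2)) \<subseteq> ball x ((\<bar>L\<bar> + 1/2) * e)"
        proof clarify
          fix z y assume "z \<in> T" "y \<in> ball z (e / 2)"
          then have "dist z x < \<bar>L\<bar> * e" "dist z y < e / 2" using T Le by auto
          then show "y \<in> ball x ((\<bar>L\<bar> + 1/2) * e)"
            using dist_triangle[of x y z] by (simp add: algebra_simps dist_commute)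
        qed
        show "(\<Union>z\<in>T. ball z (e / 2)) \<in> sets m"
          using T(2) by (intro sets.finite_UN) auto
      qed (use emeasure_ball_finite in \<open>auto simp: fmeasurable_def\<close>)
      finally have "real (card T) * (?V / C) \<le> ?V" by simp
      then have "real (card T) \<le> C" using Vp C(1) by (simp add: field_simps)
      then show ?thesis by linarith
    qed
    then have "finite ?S" "card ?S \<le> nat \<lfloor>C\<rfloor>"
      using finite_if_finite_subsets_card_bdd[of ?S "nat \<lfloor>C\<rfloor>"] by auto
    then show "finite ?S \<and> real (card ?S) \<le> C" using C(1) by linarith
  qed (rule C(1))
qed

lemma separated_finite:
  fixes N :: "'a set"
  assumes "0 < e" "separated e N"
  shows "finite {z\<in>N. dist z x < R}"
proof -
  have "finite {z\<in>N. dist z x < (R / e) * e}"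
    using assms separated_card[of "R / e"] by metis
  then show ?thesis using assms by simp
qed

lemma nn_integral_le_if_balls:
  assumes [measurable]: "g \<in> borel_measurable m"
    and "\<And>n::nat. (\<integral>\<^sup>+y\<in>ball x (real n). g y \<partial>m) \<le> c"
  shows "(\<integral>\<^sup>+y. g y \<partial>m) \<le> c"
proof -
  have "(\<integral>\<^sup>+y. g y \<partial>m) = (\<integral>\<^sup>+y. (SUP n::nat. g y * indicator (ball x (real n)) y) \<partial>m)"
  proof (rule nn_integral_cong)
    fix y
    obtain n :: nat where "dist x y < n" using reals_Archimedean2 by auto
    then have "g y * indicator (ball x (real n)) y = g y" by simp
    then have "g y \<le> (SUP n::nat. g y * indicator (ball x (real n)) y)"
      by (metis SUP_upper UNIV_I)
    moreover have "(SUP n::nat. g y * indicator (ball x (real n)) y) \<le> g y"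
      by (rule SUP_least) (auto simp: indicator_def)
    ultimately show "g y = (SUP n::nat. g y * indicator (ball x (real n)) y)" by (rule antisym)
  qed
  also have "\<dots> = (SUP n::nat. \<integral>\<^sup>+y\<in>ball x (real n). g y \<partial>m)"
  proof (rule nn_integral_monotone_convergence_SUP)
    show "incseq (\<lambda>n. \<lambda>y. g y * indicator (ball x (real n)) y)"
      by (auto simp: incseq_def le_fun_def indicator_def)
  qed measurable
  also have "\<dots> \<le> c" by (rule SUP_least) (rule assms(2))
  finally show ?thesis .
qed

text \<open>Passage from local to global: the balls of radius \<open>e\<close> around the net cover
  the space, while each point lies in at most \<open>M\<close> of the balls enlarged by
  \<open>L\<close>, so the sum of the right sides counts the measure at most \<open>M\<close> times.
  The measure will be a local energy measure or a density of jump energy.\<close>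

lemma net_integral_bound:
  assumes "1 \<le> L"
  obtains M :: real where "1 \<le> M"
    "\<And>e N g \<nu> c x s. \<lbrakk>0 < e; is_net e N; g \<in> borel_measurable m; sets \<nu> = sets borel;
       \<And>z. z \<in> N \<Longrightarrow> (\<integral>\<^sup>+y\<in>ball z e. g y \<partial>m) \<le> c * emeasure \<nu> (ball z (L * e))\<rbrakk> \<Longrightarrow>
       (\<integral>\<^sup>+y\<in>ball x s. g y \<partial>m) \<le> c * ennreal M * emeasure \<nu> (ball x (s + (L + 1) * e))"
    "\<And>e N g \<nu> c. \<lbrakk>0 < e; is_net e N; g \<in> borel_measurable m; sets \<nu> = sets borel;
       \<And>z. z \<in> N \<Longrightarrow> (\<integral>\<^sup>+y\<in>ball z e. g y \<partial>m) \<le> c * emeasure \<nu> (ball z (L * e))\<rbrakk> \<Longrightarrow>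
       (\<integral>\<^sup>+y. g y \<partial>m) \<le> c * ennreal M * emeasure \<nu> UNIV"
proof -
  obtain M where M: "1 \<le> M" "\<And>e N (x::'a). 0 < e \<Longrightarrow> separated e N \<Longrightarrow>
       finite {z\<in>N. dist z x < L * e} \<and> real (card {z\<in>N. dist z x < L * e}) \<le> M"
    by (rule separated_card[of L], blast)
  have *: "(\<integral>\<^sup>+y\<in>ball x s. g y \<partial>m) \<le> c * ennreal M * emeasure \<nu> (ball x (s + (L + 1) * e))"
    if e: "0 < e" and N: "is_net e N" and [measurable]: "g \<in> borel_measurable m"
      and \<nu>: "sets \<nu> = sets borel"
      and loc: "\<And>z. z \<in> N \<Longrightarrow> (\<integral>\<^sup>+y\<in>ball z e. g y \<partial>m) \<le> c * emeasure \<nu> (ball z (L * e))"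
    for e N g \<nu> c x s
  proof -
    note [measurable_cong] = \<nu>
    have sN: "separated e N" using N by (simp add: is_net_def)
    \<comment> \<open>The centres of all net balls that are needed to cover
      \<open>ball x s\<close>.\<close>
    define I where "I = {z\<in>N. dist z x < s + e}"
    have "finite I"
      unfolding I_def by (rule separated_finite[OF e sN])
    have "(\<integral>\<^sup>+y\<in>ball x s. g y \<partial>m) \<le> (\<integral>\<^sup>+y. (\<Sum>z\<in>I. g y * indicator (ball z e) y) \<partial>m)"
    proof (rule nn_integral_mono)
      fix y
      show "g y * indicator (ball x s) y \<le> (\<Sum>z\<in>I. g y * indicator (ball z e) y)"
      proof (cases "y \<in> ball x s")
        case True
        obtain z where z: "z \<in> N" "dist z y < e" using N by (auto simp: is_net_def)
        then have "z \<in> I" using True dist_triangle[of z x y] by (auto simp: I_def dist_commute)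
        then have "g y * indicator (ball z e) y \<le> (\<Sum>z\<in>I. g y * indicator (ball z e) y)"
          using \<open>finite I\<close> by (intro member_le_sum) auto
        then show ?thesis using True z by simp
      qed simp
    qed
    also have "\<dots> = (\<Sum>z\<in>I. \<integral>\<^sup>+y\<in>ball z e. g y \<partial>m)"
      by (rule nn_integral_sum) simp
    also have "\<dots> \<le> (\<Sum>z\<in>I. c * emeasure \<nu> (ball z (L * e)))"
      by (intro sum_mono loc) (simp add: I_def)
    also have "\<dots> = c * (\<Sum>z\<in>I. emeasure \<nu> (ball z (L * e)))"
      by (simp add: sum_distrib_left)
    also have "(\<Sum>z\<in>I. emeasure \<nu> (ball z (L * e))) = (\<Sum>z\<in>I. \<integral>\<^sup>+y. indicator (ball z (L * e)) y \<partial>\<nu>)"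
      by (simp add: \<nu>)
    also have "\<dots> = (\<integral>\<^sup>+y. (\<Sum>z\<in>I. indicator (ball z (L * e)) y) \<partial>\<nu>)"
      by (rule nn_integral_sum[symmetric]) simp
    \<comment> \<open>A point of an enlarged ball is within \<open>L * e\<close> of a centre in
      \<open>I\<close>, hence within \<open>s + e + L * e\<close> of \<open>x\<close>.\<close>
    also have "\<dots> \<le> (\<integral>\<^sup>+y. ennreal M * indicator (ball x (s + (L + 1) * e)) y \<partial>\<nu>)"
    proof (rule nn_integral_mono)
      fix y
      show "(\<Sum>z\<in>I. indicator (ball z (L * e)) y)
          \<le> ennreal M * indicator (ball x (s + (L + 1) * e)) y"
      proof (cases "y \<in> ball x (s + (L + 1) * e)")
        case False
        have "indicator (ball z (L * e)) y = (0::ennreal)" if "z \<in> I" for z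
        proof -
          have "y \<notin> ball z (L * e)"
            using False that dist_triangle[of x y z] by (auto simp: I_def algebra_simps dist_commute)
          then show ?thesis by simp
        qed
        then show ?thesis by simp
      next
        case True
        have "(\<Sum>z\<in>I. indicator (ball z (L * e)) y) = (\<Sum>z\<in>I \<inter> {z. dist z y < L * e}. 1::ennreal)"
          using \<open>finite I\<close> by (intro sum.mono_neutral_cong_right) auto
        also have "\<dots> \<le> (\<Sum>z\<in>{z\<in>N. dist z y < L * e}. 1)"
          using M(2)[OF e sN, of y] by (intro sum_mono2) (auto simp: I_def)
        also have "\<dots> \<le> ennreal M"
          using M(2)[OF e sN, of y] by (simp add: ennreal_of_nat_eq_real_of_nat ennreal_leI)
        finally show ?thesis using True by simp
      qed
    qed
    also have "\<dots> = ennreal M * emeasure \<nu> (ball x (s + (L + 1) * e))"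
      by (simp add: \<nu> nn_integral_cmult_indicator)
    finally show ?thesis by (simp add: mult.assoc mult_left_mono)
  qed
  moreover have "(\<integral>\<^sup>+y. g y \<partial>m) \<le> c * ennreal M * emeasure \<nu> UNIV"
    if e: "0 < e" and N: "is_net e N" and g: "g \<in> borel_measurable m"
      and \<nu>: "sets \<nu> = sets borel"
      and loc: "\<And>z. z \<in> N \<Longrightarrow> (\<integral>\<^sup>+y\<in>ball z e. g y \<partial>m) \<le> c * emeasure \<nu> (ball z (L * e))"
    for e N g \<nu> c
  proof (rule nn_integral_le_if_balls[OF g])
    fix n :: nat
    have "(\<integral>\<^sup>+y\<in>ball undefined (real n). g y \<partial>m)
        \<le> c * ennreal M * emeasure \<nu> (ball undefined (real n + (L + 1) * e))"
      by (rule *[OF e N g \<nu> loc])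
    also have "\<dots> \<le> c * ennreal M * emeasure \<nu> UNIV"
      using \<nu> by (intro mult_left_mono emeasure_mono) auto
    finally show "(\<integral>\<^sup>+y\<in>ball undefined (real n). g y \<partial>m) \<le> c * ennreal M * emeasure \<nu> UNIV" .
  qed
  ultimately show ?thesis using M(1) by (intro that) auto
qed

end

section \<open>Jump energies\<close>

lemma doubling_functionE:
  assumes "doubling_function \<Psi>"
  obtains C a b where "1 \<le> C" "0 < a" "0 \<le> b" "\<And>r. 0 < r \<Longrightarrow> 0 < \<Psi> r"
    "\<And>r R. 0 < r \<Longrightarrow> r \<le> R \<Longrightarrow> (R / r) powr a * \<Psi> r \<le> C * \<Psi> R"
    "\<And>r R. 0 < r \<Longrightarrow> r \<le> R \<Longrightarrow> \<Psi> R \<le> C * (R / r) powr b * \<Psi> r"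
proof -
  from assms obtain g C a b where g: "homeomorphism {0..} {0..} \<Psi> g"
    and C: "C > 1" "0 < a" "a \<le> b"
    and ratio: "\<And>r R. 0 < r \<Longrightarrow> r \<le> R \<Longrightarrow>
        (R / r) powr a / C \<le> \<Psi> R / \<Psi> r \<and> \<Psi> R / \<Psi> r \<le> C * (R / r) powr b"
    unfolding doubling_function_def by blast
  have pos: "0 < \<Psi> r" if "0 < r" for r
  proof -
    have "\<Psi> ` {0..} = {0..}" using g by (rule homeomorphism_image1)
    then have "0 \<le> \<Psi> r" using that by auto
    \<comment> \<open>If \<open>\<Psi> r\<close> were 0, the quotient
      \<open>\<Psi> r / \<Psi> r\<close> would be 0 by the convention for division, against its
      positive lower bound.\<close>
    moreover have "\<Psi> r \<noteq> 0" using ratio[of r r] that C by auto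
    ultimately show ?thesis by simp
  qed
  show ?thesis
  proof (rule that[of C a b])
    fix r R :: real assume r: "0 < r" "r \<le> R"
    show "(R / r) powr a * \<Psi> r \<le> C * \<Psi> R" and "\<Psi> R \<le> C * (R / r) powr b * \<Psi> r"
      using ratio[OF r] pos[OF r(1)] C by (simp_all add: field_simps)
  qed (use C pos in auto)
qed

lemma doubling_function_pos: "doubling_function \<Psi> \<Longrightarrow> 0 < r \<Longrightarrow> 0 < \<Psi> r"
  by (erule doubling_functionE)

text \<open>For \<open>s \<le> r\<close> the lower growth bound makes \<open>\<Psi>\<close> almost
  increasing; for larger \<open>s\<close> the upper growth bound costs a power of \<open>L\<close>.
  Taking \<open>max 1 L\<close> lets one constant serve both cases.\<close>

lemma doubling_function_comparable:
  assumes "doubling_function \<Psi>"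
  obtains C where "1 \<le> C" "\<And>s r. 0 < s \<Longrightarrow> 0 < r \<Longrightarrow> s \<le> L * r \<Longrightarrow> \<Psi> s \<le> C * \<Psi> r"
proof -
  obtain C a b where C: "1 \<le> C" "0 < a" "0 \<le> b" "\<And>r. 0 < r \<Longrightarrow> 0 < \<Psi> r"
    "\<And>r R. 0 < r \<Longrightarrow> r \<le> R \<Longrightarrow> (R / r) powr a * \<Psi> r \<le> C * \<Psi> R"
    "\<And>r R. 0 < r \<Longrightarrow> r \<le> R \<Longrightarrow> \<Psi> R \<le> C * (R / r) powr b * \<Psi> r"
    using doubling_functionE[OF assms] by metis
  define L' where "L' = max 1 L"
  show ?thesis
  proof (rule that[of "C * L' powr b"])
    have "1 \<le> L' powr b" using C by (intro ge_one_powr_ge_zero) (auto simp: L'_def)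
    then have "1 * 1 \<le> C * L' powr b" using C(1) by (intro mult_mono) auto
    then show "1 \<le> C * L' powr b" by simp
    fix s r assume sr: "0 < s" "0 < r" "s \<le> L * r"
    show "\<Psi> s \<le> C * L' powr b * \<Psi> r"
    proof (cases "s \<le> r")
      case True
      have "\<Psi> s \<le> (r / s) powr a * \<Psi> s"
        using True sr C(2) C(4)[OF sr(1)] ge_one_powr_ge_zero[of "r / s" a] by simp
      also have "\<dots> \<le> C * \<Psi> r" using C(5) sr True by simp
      also have "\<dots> \<le> C * L' powr b * \<Psi> r"
        using \<open>1 \<le> L' powr b\<close> C(1) C(4)[OF sr(2)] by simp
      finally show ?thesis .
    next
      case False
      then have "\<Psi> s \<le> C * (s / r) powr b * \<Psi> r" using C(6) sr by simp
      also have "\<dots> \<le> C * L' powr b * \<Psi> r"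
        using sr C(1,3) C(4)[OF sr(2)]
        by (intro mult_right_mono mult_left_mono powr_mono2) (auto simp: L'_def pos_divide_le_eq intro: order_trans[OF _ mult_right_mono])
      finally show ?thesis .
    qed
  qed
qed

section \<open>Energies with cut kernels\<close>

text \<open>The kernel is cut rather than the domain of integration, so that short, long and annular
  jumps are all treated by the same functional \<open>JGamma\<close>; an annulus is
  \<open>trunc t (far (t / 2) K)\<close>.\<close>

definition trunc :: "real \<Rightarrow> ('a::metric_space \<Rightarrow> 'a \<Rightarrow> real) \<Rightarrow> 'a \<Rightarrow> 'a \<Rightarrow> real" where
  "trunc R K x y = (if dist x y < R then K x y else 0)"

definition far :: "real \<Rightarrow> ('a::metric_space \<Rightarrow> 'a \<Rightarrow> real) \<Rightarrow> 'a \<Rightarrow> 'a \<Rightarrow> real" where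
  "far R K x y = (if dist x y < R then 0 else K x y)"

context doubling_space
begin

abbreviation kernel_measurable :: "('a \<Rightarrow> 'a \<Rightarrow> real) \<Rightarrow> bool" where
  "kernel_measurable K \<equiv> (\<lambda>(x, y). K x y) \<in> borel_measurable (m \<Otimes>\<^sub>M m)"

lemma kernel_measurable_trunc:
  assumes [measurable]: "kernel_measurable K"
  shows "kernel_measurable (trunc R K)" "kernel_measurable (far R K)"
proof -
  have "(\<lambda>z. if (case z of (x, y) \<Rightarrow> dist x y) < R then (case z of (x, y) \<Rightarrow> K x y) else 0)
      \<in> borel_measurable (m \<Otimes>\<^sub>M m)" by measurable
  then show "kernel_measurable (trunc R K)"
    by (simp add: trunc_def split_beta')
  have "(\<lambda>z. if (case z of (x, y) \<Rightarrow> dist x y) < R then 0 else (case z of (x, y) \<Rightarrow> K x y))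
      \<in> borel_measurable (m \<Otimes>\<^sub>M m)" by measurable
  then show "kernel_measurable (far R K)"
    by (simp add: far_def split_beta')
qed

lemma jump_integrand_measurable:
  assumes K: "kernel_measurable K" and [measurable]: "u \<in> borel_measurable m"
  shows "(\<lambda>z. ennreal (\<bar>u (fst z) - u (snd z)\<bar> powr p * K (fst z) (snd z))) \<in> borel_measurable (m \<Otimes>\<^sub>M m)"
    and "(\<lambda>(x, y). ennreal (\<bar>u x - u y\<bar> powr p * K x y)) \<in> borel_measurable (m \<Otimes>\<^sub>M m)"
    and "(\<lambda>y. ennreal (\<bar>u x - u y\<bar> powr p * K x y)) \<in> borel_measurable m"
    and "(\<lambda>x. \<integral>\<^sup>+y. ennreal (\<bar>u x - u y\<bar> powr p * K x y) \<partial>m) \<in> borel_measurable m"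
proof -
  have [measurable]: "(\<lambda>z. K (fst z) (snd z)) \<in> borel_measurable (m \<Otimes>\<^sub>M m)"
    using K by (simp add: split_beta')
  show *: "(\<lambda>z. ennreal (\<bar>u (fst z) - u (snd z)\<bar> powr p * K (fst z) (snd z))) \<in> borel_measurable (m \<Otimes>\<^sub>M m)"
    by measurable
  then show **: "(\<lambda>(x, y). ennreal (\<bar>u x - u y\<bar> powr p * K x y)) \<in> borel_measurable (m \<Otimes>\<^sub>M m)"
    by (simp add: split_beta')
  show "(\<lambda>y. ennreal (\<bar>u x - u y\<bar> powr p * K x y)) \<in> borel_measurable m"
    using measurable_compose[OF measurable_Pair1' *, of x] by simp
  show "(\<lambda>x. \<integral>\<^sup>+y. ennreal (\<bar>u x - u y\<bar> powr p * K x y) \<partial>m) \<in> borel_measurable m"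
    using borel_measurable_nn_integral[OF **] by simp
qed

lemma JGamma_UNIV_pair:
  assumes "kernel_measurable K" "u \<in> borel_measurable m"
  shows "JGamma m p K u UNIV
    = (\<integral>\<^sup>+z. ennreal (\<bar>u (fst z) - u (snd z)\<bar> powr p * K (fst z) (snd z)) \<partial>(m \<Otimes>\<^sub>M m))"
  unfolding JGamma_def
  using nn_integral_fst[OF jump_integrand_measurable(2)[OF assms, of p]] by (simp add: split_beta')

lemma JGamma_mono_set: "A \<subseteq> B \<Longrightarrow> JGamma m p K u A \<le> JGamma m p K u B"
  unfolding JGamma_def by (intro nn_integral_mono) (auto simp: indicator_def)

text \<open>The general comparison principle: as functions and kernels on the right may vary with
  the index, it yields monotonicity, the quasi-triangle inequality and the bounds for sums over a
  partition of unity. Only the first variable is restricted to \<open>A\<close>, as in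
  \<open>JGamma\<close>.\<close>

lemma JGamma_sum:
  assumes K': "\<And>i. i \<in> I \<Longrightarrow> kernel_measurable (K' i)" and v: "\<And>i. i \<in> I \<Longrightarrow> v i \<in> borel_measurable m"
    and le: "\<And>x y. x \<in> A \<Longrightarrow> ennreal (\<bar>u x - u y\<bar> powr p * K x y)
        \<le> (\<Sum>i\<in>I. c i * ennreal (\<bar>v i x - v i y\<bar> powr p * K' i x y))"
    and A: "A \<in> sets borel"
  shows "JGamma m p K u A \<le> (\<Sum>i\<in>I. c i * JGamma m p (K' i) (v i) A)"
proof -
  note [measurable] = jump_integrand_measurable[OF K' v] A
  have "JGamma m p K u A
      \<le> (\<integral>\<^sup>+x. (\<Sum>i\<in>I. c i * ((\<integral>\<^sup>+y. ennreal (\<bar>v i x - v i y\<bar> powr p * K' i x y) \<partial>m) * indicator A x)) \<partial>m)"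
    unfolding JGamma_def
  proof (rule nn_integral_mono)
    fix x
    show "(\<integral>\<^sup>+y. ennreal (\<bar>u x - u y\<bar> powr p * K x y) \<partial>m) * indicator A x
       \<le> (\<Sum>i\<in>I. c i * ((\<integral>\<^sup>+y. ennreal (\<bar>v i x - v i y\<bar> powr p * K' i x y) \<partial>m) * indicator A x))"
    proof (cases "x \<in> A")
      case True
      have "(\<integral>\<^sup>+y. ennreal (\<bar>u x - u y\<bar> powr p * K x y) \<partial>m)
         \<le> (\<integral>\<^sup>+y. (\<Sum>i\<in>I. c i * ennreal (\<bar>v i x - v i y\<bar> powr p * K' i x y)) \<partial>m)"
        by (intro nn_integral_mono le True)
      also have "\<dots> = (\<Sum>i\<in>I. \<integral>\<^sup>+y. c i * ennreal (\<bar>v i x - v i y\<bar> powr p * K' i x y) \<partial>m)"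
        by (rule nn_integral_sum) measurable
      also have "\<dots> = (\<Sum>i\<in>I. c i * (\<integral>\<^sup>+y. ennreal (\<bar>v i x - v i y\<bar> powr p * K' i x y) \<partial>m))"
        by (intro sum.cong refl nn_integral_cmult) measurable
      finally show ?thesis using True by simp
    qed simp
  qed
  also have "\<dots> = (\<Sum>i\<in>I. \<integral>\<^sup>+x. c i * ((\<integral>\<^sup>+y. ennreal (\<bar>v i x - v i y\<bar> powr p * K' i x y) \<partial>m) * indicator A x) \<partial>m)"
    by (rule nn_integral_sum) measurable
  also have "\<dots> = (\<Sum>i\<in>I. c i * JGamma m p (K' i) (v i) A)"
    unfolding JGamma_def by (intro sum.cong refl nn_integral_cmult) measurable
  finally show ?thesis .
qed

lemma JGamma_mono:
  assumes "kernel_measurable K'" "v \<in> borel_measurable m"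
    and "\<And>x y. x \<in> A \<Longrightarrow> ennreal (\<bar>u x - u y\<bar> powr p * K x y) \<le> c * ennreal (\<bar>v x - v y\<bar> powr p * K' x y)"
    and "A \<in> sets borel"
  shows "JGamma m p K u A \<le> c * JGamma m p K' v A"
  using JGamma_sum[where I = "{()}" and K' = "\<lambda>_. K'" and v = "\<lambda>_. v" and c = "\<lambda>_. c" and A = A
      and u = u and K = K and p = p] assms by simp

text \<open>Serves to decompose the short jumps into dyadic annuli.\<close>

lemma JGamma_suminf:
  fixes K' :: "nat \<Rightarrow> 'a \<Rightarrow> 'a \<Rightarrow> real"
  assumes K': "\<And>i. kernel_measurable (K' i)" and u: "u \<in> borel_measurable m"
    and le: "\<And>x y. x \<in> A \<Longrightarrow> ennreal (\<bar>u x - u y\<bar> powr p * K x y)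
        \<le> (\<Sum>i. ennreal (\<bar>u x - u y\<bar> powr p * K' i x y))"
    and A: "A \<in> sets borel"
  shows "JGamma m p K u A \<le> (\<Sum>i. JGamma m p (K' i) u A)"
proof -
  note [measurable] = jump_integrand_measurable[OF K' u] A
  have "JGamma m p K u A
      \<le> (\<integral>\<^sup>+x. (\<Sum>i. (\<integral>\<^sup>+y. ennreal (\<bar>u x - u y\<bar> powr p * K' i x y) \<partial>m) * indicator A x) \<partial>m)"
    unfolding JGamma_def
  proof (rule nn_integral_mono)
    fix x
    show "(\<integral>\<^sup>+y. ennreal (\<bar>u x - u y\<bar> powr p * K x y) \<partial>m) * indicator A x
       \<le> (\<Sum>i. (\<integral>\<^sup>+y. ennreal (\<bar>u x - u y\<bar> powr p * K' i x y) \<partial>m) * indicator A x)"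
    proof (cases "x \<in> A")
      case True
      have "(\<integral>\<^sup>+y. ennreal (\<bar>u x - u y\<bar> powr p * K x y) \<partial>m)
         \<le> (\<integral>\<^sup>+y. (\<Sum>i. ennreal (\<bar>u x - u y\<bar> powr p * K' i x y)) \<partial>m)"
        by (intro nn_integral_mono le True)
      also have "\<dots> = (\<Sum>i. \<integral>\<^sup>+y. ennreal (\<bar>u x - u y\<bar> powr p * K' i x y) \<partial>m)"
        by (rule nn_integral_suminf) measurable
      finally show ?thesis using True by simp
    qed simp
  qed
  also have "\<dots> = (\<Sum>i. JGamma m p (K' i) u A)"
    unfolding JGamma_def by (rule nn_integral_suminf) measurable
  finally show ?thesis .
qed

lemma JGamma_trunc_far:
  assumes K: "kernel_measurable K" and u: "u \<in> borel_measurable m" and A: "A \<in> sets borel"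
  shows "JGamma m p K u A = JGamma m p (trunc R K) u A + JGamma m p (far R K) u A"
proof -
  note [measurable] = jump_integrand_measurable[OF kernel_measurable_trunc(1)[OF K] u]
    jump_integrand_measurable[OF kernel_measurable_trunc(2)[OF K] u] A
  have "(\<integral>\<^sup>+y. ennreal (\<bar>u x - u y\<bar> powr p * K x y) \<partial>m)
      = (\<integral>\<^sup>+y. ennreal (\<bar>u x - u y\<bar> powr p * trunc R K x y) + ennreal (\<bar>u x - u y\<bar> powr p * far R K x y) \<partial>m)" for x
    by (intro nn_integral_cong) (auto simp: trunc_def far_def)
  then have "(\<integral>\<^sup>+y. ennreal (\<bar>u x - u y\<bar> powr p * K x y) \<partial>m)
      = (\<integral>\<^sup>+y. ennreal (\<bar>u x - u y\<bar> powr p * trunc R K x y) \<partial>m)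
      + (\<integral>\<^sup>+y. ennreal (\<bar>u x - u y\<bar> powr p * far R K x y) \<partial>m)" for x
    by (simp add: nn_integral_add)
  then show ?thesis
    unfolding JGamma_def by (simp add: distrib_right nn_integral_add)
qed

lemma JGamma_diff_le:
  assumes K: "kernel_measurable K" and u: "u \<in> borel_measurable m" and v: "v \<in> borel_measurable m"
    and A: "A \<in> sets borel" and p: "0 \<le> p"
  shows "JGamma m p K (\<lambda>x. u x - v x) A \<le> ennreal (2 powr p) * (JGamma m p K u A + JGamma m p K v A)"
proof -
  have "JGamma m p K (\<lambda>x. u x - v x) A
      \<le> (\<Sum>i\<in>{True, False}. ennreal (2 powr p) * JGamma m p K (if i then u else v) A)"
  proof (rule JGamma_sum[OF _ _ _ A])
    fix x y
    have "\<bar>(u x - v x) - (u y - v y)\<bar> powr p \<le> 2 powr p * (\<bar>u x - u y\<bar> powr p + \<bar>v x - v y\<bar> powr p)"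
      using abs_diff_powr_le[OF p, of "u x - u y" "v x - v y"] by (simp add: algebra_simps)
    then have "ennreal (\<bar>(u x - v x) - (u y - v y)\<bar> powr p) * ennreal (K x y)
        \<le> ennreal (2 powr p * (\<bar>u x - u y\<bar> powr p + \<bar>v x - v y\<bar> powr p)) * ennreal (K x y)"
      by (intro mult_right_mono ennreal_leI) auto
    then show "ennreal (\<bar>(u x - v x) - (u y - v y)\<bar> powr p * K x y)
        \<le> (\<Sum>i\<in>{True, False}. ennreal (2 powr p) *
             ennreal (\<bar>(if i then u else v) x - (if i then u else v) y\<bar> powr p * K x y))"
      by (simp add: ennreal_mult' distrib_left distrib_right mult.assoc)
  qed (use K u v in auto)
  then show ?thesis by (simp add: distrib_left)
qed

lemma JGamma_swap:
  assumes K: "kernel_measurable K" and sym: "\<And>x y. K x y = K y x"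
    and u[measurable]: "u \<in> borel_measurable m" and h[measurable]: "h \<in> borel_measurable m"
  shows "(\<integral>\<^sup>+x. \<integral>\<^sup>+y. ennreal (\<bar>u x - u y\<bar> powr p * K x y) * h y \<partial>m \<partial>m)
    = (\<integral>\<^sup>+x. (\<integral>\<^sup>+y. ennreal (\<bar>u x - u y\<bar> powr p * K x y) \<partial>m) * h x \<partial>m)"
proof -
  note [measurable] = jump_integrand_measurable[OF K u]
  have "(\<lambda>z. ennreal (\<bar>u (fst z) - u (snd z)\<bar> powr p * K (fst z) (snd z)) * h (snd z))
      \<in> borel_measurable (m \<Otimes>\<^sub>M m)" by measurable
  then have "(\<lambda>(x, y). ennreal (\<bar>u x - u y\<bar> powr p * K x y) * h y) \<in> borel_measurable (m \<Otimes>\<^sub>M m)"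
    by (simp add: split_beta')
  from pair.Fubini'[OF this]
  have "(\<integral>\<^sup>+x. \<integral>\<^sup>+y. ennreal (\<bar>u x - u y\<bar> powr p * K x y) * h y \<partial>m \<partial>m)
      = (\<integral>\<^sup>+y. \<integral>\<^sup>+x. ennreal (\<bar>u x - u y\<bar> powr p * K x y) * h y \<partial>m \<partial>m)"
    by simp
  also have "\<dots> = (\<integral>\<^sup>+y. \<integral>\<^sup>+x. ennreal (\<bar>u y - u x\<bar> powr p * K y x) * h y \<partial>m \<partial>m)"
    by (intro nn_integral_cong) (metis abs_minus_commute sym)
  finally show ?thesis by (simp add: nn_integral_multc)
qed

text \<open>A jump with nonzero increment starts or ends in \<open>B\<close>, and by symmetry both
  kinds carry the same energy. This turns the bound of the cutoff inequality on one ball into a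
  bound on the total energy.\<close>

lemma JGamma_support:
  assumes K: "kernel_measurable K" and sym: "\<And>x y. K x y = K y x"
    and u[measurable]: "u \<in> borel_measurable m" and B[measurable]: "B \<in> sets borel"
    and supp: "\<And>x. x \<notin> B \<Longrightarrow> u x = 0"
  shows "JGamma m p K u UNIV \<le> 2 * JGamma m p K u B"
proof -
  note [measurable] = jump_integrand_measurable[OF K u]
  have "JGamma m p K u UNIV
     \<le> (\<integral>\<^sup>+x. \<integral>\<^sup>+y. ennreal (\<bar>u x - u y\<bar> powr p * K x y) * indicator B x
            + ennreal (\<bar>u x - u y\<bar> powr p * K x y) * indicator B y \<partial>m \<partial>m)"
    unfolding JGamma_def
    by simp (intro nn_integral_mono, auto simp: indicator_def supp)
  also have "\<dots> = (\<integral>\<^sup>+x. (\<integral>\<^sup>+y. ennreal (\<bar>u x - u y\<bar> powr p * K x y) \<partial>m) * indicator B x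
            + (\<integral>\<^sup>+y. ennreal (\<bar>u x - u y\<bar> powr p * K x y) * indicator B y \<partial>m) \<partial>m)"
    by (simp add: nn_integral_add nn_integral_multc)
  also have "\<dots> = JGamma m p K u B + (\<integral>\<^sup>+x. \<integral>\<^sup>+y. ennreal (\<bar>u x - u y\<bar> powr p * K x y) * indicator B y \<partial>m \<partial>m)"
    unfolding JGamma_def
  proof (rule nn_integral_add)
    have "(\<lambda>z. ennreal (\<bar>u (fst z) - u (snd z)\<bar> powr p * K (fst z) (snd z)) * indicator B (snd z))
      \<in> borel_measurable (m \<Otimes>\<^sub>M m)" by measurable
    then have "(\<lambda>(x, y). ennreal (\<bar>u x - u y\<bar> powr p * K x y) * indicator B y) \<in> borel_measurable (m \<Otimes>\<^sub>M m)"
      by (simp add: split_beta')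
    then show "(\<lambda>x. \<integral>\<^sup>+y. ennreal (\<bar>u x - u y\<bar> powr p * K x y) * indicator B y \<partial>m) \<in> borel_measurable m"
      by (rule borel_measurable_nn_integral)
  qed measurable
  also have "\<dots> = 2 * JGamma m p K u B"
    by (subst JGamma_swap[OF K sym u]) (auto simp: JGamma_def mult_2)
  finally show ?thesis .
qed

text \<open>Bound the increment by the values at both ends; symmetry moves the value at the end
  point to the starting point, where the mass of the kernel is at most \<open>c\<close>. The kernel
  will be \<open>far R K\<close>.\<close>

lemma JGamma_far_le:
  assumes K: "kernel_measurable K" and sym: "\<And>x y. K x y = K y x"
    and u[measurable]: "u \<in> borel_measurable m" and p: "0 \<le> p"
    and tail: "\<And>x. (\<integral>\<^sup>+y. ennreal (K x y) \<partial>m) \<le> c"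
  shows "JGamma m p K u UNIV \<le> ennreal (2 powr p) * 2 * c * (\<integral>\<^sup>+x. ennreal (\<bar>u x\<bar> powr p) \<partial>m)"
proof -
  let ?h = "\<lambda>x. ennreal (\<bar>u x\<bar> powr p)"
  have [measurable]: "(\<lambda>z. K (fst z) (snd z)) \<in> borel_measurable (m \<Otimes>\<^sub>M m)"
    using K by (simp add: split_beta')
  have [measurable]: "(\<lambda>y. K x y) \<in> borel_measurable m" for x
    using measurable_compose[OF measurable_Pair1' K, of x] by simp
  have m1: "(\<lambda>z. ennreal (K (fst z) (snd z)) * ?h (snd z)) \<in> borel_measurable (m \<Otimes>\<^sub>M m)" by measurable
  have [measurable]: "(\<lambda>x. \<integral>\<^sup>+y. ennreal (K x y) * ?h y \<partial>m) \<in> borel_measurable m"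
    using borel_measurable_nn_integral[of "\<lambda>x y. ennreal (K x y) * ?h y" m] m1 by (simp add: split_beta')
  have [measurable]: "(\<lambda>x. \<integral>\<^sup>+y. ennreal (K x y) \<partial>m) \<in> borel_measurable m"
    using borel_measurable_nn_integral[of "\<lambda>x y. ennreal (K x y)" m] by (simp add: split_beta')
  have "JGamma m p K u UNIV \<le> (\<integral>\<^sup>+x. \<integral>\<^sup>+y. ennreal (2 powr p) * (ennreal (K x y) * ?h x + ennreal (K x y) * ?h y) \<partial>m \<partial>m)"
    unfolding JGamma_def
  proof (simp, intro nn_integral_mono)
    fix x y
    have "ennreal (\<bar>u x - u y\<bar> powr p) * ennreal (K x y)
        \<le> ennreal (2 powr p * (\<bar>u x\<bar> powr p + \<bar>u y\<bar> powr p)) * ennreal (K x y)"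
      by (intro mult_right_mono ennreal_leI abs_diff_powr_le p) auto
    moreover have "ennreal (\<bar>u x - u y\<bar> powr p * K x y) = ennreal (\<bar>u x - u y\<bar> powr p) * ennreal (K x y)"
      by (simp add: ennreal_mult')
    ultimately show "ennreal (\<bar>u x - u y\<bar> powr p * K x y) \<le> ennreal (2 powr p) * (ennreal (K x y) * ?h x + ennreal (K x y) * ?h y)"
      by (simp add: ennreal_mult distrib_left distrib_right mult_ac)
  qed
  also have "\<dots> = ennreal (2 powr p) * ((\<integral>\<^sup>+x. (\<integral>\<^sup>+y. ennreal (K x y) \<partial>m) * ?h x \<partial>m)
      + (\<integral>\<^sup>+x. \<integral>\<^sup>+y. ennreal (K x y) * ?h y \<partial>m \<partial>m))"
    by (simp add: nn_integral_cmult nn_integral_add nn_integral_multc)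
  also have "(\<integral>\<^sup>+x. \<integral>\<^sup>+y. ennreal (K x y) * ?h y \<partial>m \<partial>m) = (\<integral>\<^sup>+x. (\<integral>\<^sup>+y. ennreal (K x y) \<partial>m) * ?h x \<partial>m)"
  proof -
    have "(\<integral>\<^sup>+x. \<integral>\<^sup>+y. ennreal (K x y) * ?h y \<partial>m \<partial>m) = (\<integral>\<^sup>+y. \<integral>\<^sup>+x. ennreal (K x y) * ?h y \<partial>m \<partial>m)"
      using pair.Fubini'[of "\<lambda>x y. ennreal (K x y) * ?h y"] m1 by (simp add: split_beta')
    also have "\<dots> = (\<integral>\<^sup>+y. \<integral>\<^sup>+x. ennreal (K y x) * ?h y \<partial>m \<partial>m)"
      by (intro nn_integral_cong) (metis sym)
    finally show ?thesis by (simp add: nn_integral_multc)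
  qed
  also have "(\<integral>\<^sup>+x. (\<integral>\<^sup>+y. ennreal (K x y) \<partial>m) * ?h x \<partial>m) \<le> (\<integral>\<^sup>+x. c * ?h x \<partial>m)"
    by (intro nn_integral_mono mult_right_mono tail) auto
  also have "\<dots> = c * (\<integral>\<^sup>+x. ?h x \<partial>m)" by (rule nn_integral_cmult) measurable
  finally show ?thesis
    by (simp add: mult_2[symmetric] mult.assoc add_mono mult_left_mono)
qed

text \<open>Dominated convergence on pairs: on the diagonal the increment vanishes, and off it the
  truncated kernel is eventually zero.\<close>

lemma JGamma_trunc_small:
  assumes K: "kernel_measurable K" and u: "u \<in> borel_measurable m"
    and fin: "JGamma m p K u UNIV < \<infinity>" and "0 < e"
  obtains n :: nat where "JGamma m p (trunc (1 / Suc n) K) u UNIV < e"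
proof -
  note [measurable] = jump_integrand_measurable[OF K u]
    jump_integrand_measurable[OF kernel_measurable_trunc(1)[OF K] u]
  let ?f = "\<lambda>K z. ennreal (\<bar>u (fst z) - u (snd z)\<bar> powr p * K (fst z) (snd z))"
  have "(\<lambda>n. \<integral>\<^sup>+z. ?f (trunc (1 / Suc n) K) z \<partial>(m \<Otimes>\<^sub>M m)) \<longlonglongrightarrow> (\<integral>\<^sup>+z. 0 \<partial>(m \<Otimes>\<^sub>M m))"
  proof (rule nn_integral_dominated_convergence[where w = "?f K"])
    show "(\<integral>\<^sup>+z. ?f K z \<partial>(m \<Otimes>\<^sub>M m)) < \<infinity>"
      using fin JGamma_UNIV_pair[OF K u, of p] by simp
    show "AE z in m \<Otimes>\<^sub>M m. (\<lambda>n. ?f (trunc (1 / Suc n) K) z) \<longlonglongrightarrow> 0"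
    proof (rule AE_I2)
      fix z :: "'a \<times> 'a"
      show "(\<lambda>n. ?f (trunc (1 / Suc n) K) z) \<longlonglongrightarrow> 0"
      proof (cases "fst z = snd z")
        case False
        then have "0 < dist (fst z) (snd z)" by simp
        from order_tendstoD(2)[OF LIMSEQ_Suc[OF lim_1_over_n] this]
        have "\<forall>\<^sub>F n in sequentially. ?f (trunc (1 / Suc n) K) z = 0"
          by eventually_elim (simp add: trunc_def)
        then show ?thesis by (rule tendsto_eventually)
      qed simp
    qed
    show "AE z in m \<Otimes>\<^sub>M m. ?f (trunc (1 / Suc n) K) z \<le> ?f K z" for n
      by (rule AE_I2) (auto simp: trunc_def)
  qed measurable
  then have "(\<lambda>n. JGamma m p (trunc (1 / Suc n) K) u UNIV) \<longlonglongrightarrow> 0"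
    using JGamma_UNIV_pair[OF kernel_measurable_trunc(1)[OF K] u, of p] by simp
  from order_tendstoD(2)[OF this \<open>0 < e\<close>]
  obtain n where "JGamma m p (trunc (1 / Suc n) K) u UNIV < e"
    by (auto simp: eventually_sequentially)
  then show ?thesis by (rule that)
qed

end

lemma term_le_suminf_ennreal: "f n \<le> (\<Sum>n. f n)" for f :: "nat \<Rightarrow> ennreal"
  using sum_le_suminf[of f "{n}"] by simp

section \<open>Kernel bounds and tails\<close>

locale jump_form = doubling_space m for m :: "'a::metric_space measure" +
  fixes p :: real and \<Upsilon> :: "real \<Rightarrow> real" and K :: "'a \<Rightarrow> 'a \<Rightarrow> real"
  assumes p_gt_1: "1 < p"
    and dfun: "doubling_function \<Upsilon>"
    and kernel: "jump_kernel m \<Upsilon> K"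
begin

lemma p_pos: "0 < p" "0 \<le> p" "1 \<le> p" "p \<noteq> 0"
  using p_gt_1 by auto

lemma K_meas: "kernel_measurable K"
  using kernel by (simp add: jump_kernel_def)

lemma K_sym: "K x y = K y x"
  using kernel unfolding jump_kernel_def by blast

lemma \<Upsilon>_pos: "0 < r \<Longrightarrow> 0 < \<Upsilon> r"
  using dfun by (rule doubling_function_pos)

lemma K_bounds:
  obtains C where "1 \<le> C"
    "\<And>x y. x \<noteq> y \<Longrightarrow> 1 / (C * (Vol m x (dist x y) * \<Upsilon> (dist x y))) \<le> K x y"
    "\<And>x y. x \<noteq> y \<Longrightarrow> K x y \<le> C / (Vol m x (dist x y) * \<Upsilon> (dist x y))"
proof -
  obtain C1 C2 where C: "C1 > 0" "C2 > 0"
    "\<And>x y. x \<noteq> y \<Longrightarrow> C1 / (Vol m x (dist x y) * \<Upsilon> (dist x y)) \<le> K x y"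
    "\<And>x y. x \<noteq> y \<Longrightarrow> K x y \<le> C2 / (Vol m x (dist x y) * \<Upsilon> (dist x y))"
    using kernel unfolding jump_kernel_def by blast
  define C where "C = max 1 (max C2 (1 / C1))"
  have D: "0 < Vol m x (dist x y) * \<Upsilon> (dist x y)" if "x \<noteq> y" for x y :: 'a
    using that by (intro mult_pos_pos Vol_pos \<Upsilon>_pos) auto
  have C': "1 \<le> C" "C2 \<le> C" "1 / C1 \<le> C" by (auto simp: C_def)
  show ?thesis
  proof (rule that[of C])
    fix x y :: 'a assume xy: "x \<noteq> y"
    have "1 / C \<le> C1" using C' C(1) by (simp add: field_simps)
    then have "(1 / C) / (Vol m x (dist x y) * \<Upsilon> (dist x y)) \<le> C1 / (Vol m x (dist x y) * \<Upsilon> (dist x y))"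
      using D[OF xy] by (intro divide_right_mono) auto
    then show "1 / (C * (Vol m x (dist x y) * \<Upsilon> (dist x y))) \<le> K x y"
      using C(3)[OF xy] by simp
    have "C2 / (Vol m x (dist x y) * \<Upsilon> (dist x y)) \<le> C / (Vol m x (dist x y) * \<Upsilon> (dist x y))"
      using D[OF xy] C' by (intro divide_right_mono) auto
    then show "K x y \<le> C / (Vol m x (dist x y) * \<Upsilon> (dist x y))"
      using C(4)[OF xy] by simp
  qed (rule C'(1))
qed

lemma K_nonneg: "x \<noteq> y \<Longrightarrow> 0 \<le> K x y"
proof -
  assume xy: "x \<noteq> y"
  obtain C where C: "1 \<le> C"
    "\<And>x y. x \<noteq> y \<Longrightarrow> 1 / (C * (Vol m x (dist x y) * \<Upsilon> (dist x y))) \<le> K x y"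
    by (rule K_bounds) blast
  have "0 \<le> 1 / (C * (Vol m x (dist x y) * \<Upsilon> (dist x y)))"
    using C(1) xy by (intro divide_nonneg_nonneg mult_nonneg_nonneg less_imp_le[OF \<Upsilon>_pos]) auto
  then show ?thesis using C(2)[OF xy] by (rule order_trans)
qed

text \<open>For jumps near \<open>z\<close> of length at most of order \<open>r\<close>, the kernel
  is bounded below by the reciprocal of \<open>Vol m z r * \<Upsilon> r\<close>. The reference point
  and scale are free, so that one value serves a whole ball of pairs; the product form avoids
  quotients.\<close>

lemma K_lower:
  obtains C where "1 \<le> C"
    "\<And>x y z r. \<lbrakk>0 < r; x \<noteq> y; dist x y \<le> L * r; dist x z \<le> L * r\<rbrakk> \<Longrightarrow>
       1 \<le> C * (Vol m z r * \<Upsilon> r) * K x y"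
proof -
  obtain C where C: "1 \<le> C"
    "\<And>x y. x \<noteq> y \<Longrightarrow> 1 / (C * (Vol m x (dist x y) * \<Upsilon> (dist x y))) \<le> K x y"
    by (rule K_bounds) blast
  obtain C' where C': "1 \<le> C'"
    "\<And>x y r s. 0 < r \<Longrightarrow> dist x y + s \<le> (2 * L) * r \<Longrightarrow> Vol m x s \<le> C' * Vol m y r"
    using Vol_comparable[of "2 * L"] by metis
  obtain C'' where C'': "1 \<le> C''" "\<And>s r. 0 < s \<Longrightarrow> 0 < r \<Longrightarrow> s \<le> L * r \<Longrightarrow> \<Upsilon> s \<le> C'' * \<Upsilon> r"
    using doubling_function_comparable[OF dfun, of L] by metis
  show ?thesis
  proof (rule that[of "C * (C' * C'')"])
    show "1 \<le> C * (C' * C'')" using C(1) C'(1) C''(1) by (metis mult_mono' mult_1 zero_le_one)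
    fix x y z :: 'a and r :: real
    assume r: "0 < r" "x \<noteq> y" "dist x y \<le> L * r" "dist x z \<le> L * r"
    have Vp: "0 < Vol m x (dist x y) * \<Upsilon> (dist x y)"
      using r by (intro mult_pos_pos Vol_pos \<Upsilon>_pos) auto
    have "1 \<le> C * (Vol m x (dist x y) * \<Upsilon> (dist x y)) * K x y"
      using C(2)[OF r(2)] C(1) Vp by (simp add: field_simps)
    also have "\<dots> \<le> C * ((C' * Vol m z r) * (C'' * \<Upsilon> r)) * K x y"
      using C(1) C'(1) r K_nonneg[OF r(2)] \<Upsilon>_pos
      by (intro mult_right_mono mult_left_mono mult_mono C'(2) C''(2)) (auto simp: less_imp_le)
    finally show "1 \<le> C * (C' * C'') * (Vol m z r * \<Upsilon> r) * K x y"
      by (simp add: mult_ac)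
  qed
qed

text \<open>The counterpart for jumps that are not much shorter than \<open>r\<close> or than the
  distance to the reference point \<open>z\<close>.\<close>

lemma K_upper:
  assumes "0 < L"
  obtains C where "1 \<le> C"
    "\<And>x y z r. \<lbrakk>0 < r; r \<le> L * dist x y; dist x z \<le> L * dist x y\<rbrakk> \<Longrightarrow>
       K x y \<le> C / (Vol m z r * \<Upsilon> r)"
proof -
  obtain C where C: "1 \<le> C"
    "\<And>x y. x \<noteq> y \<Longrightarrow> K x y \<le> C / (Vol m x (dist x y) * \<Upsilon> (dist x y))"
    by (rule K_bounds) blast
  obtain C' where C': "1 \<le> C'"
    "\<And>x y r s. 0 < r \<Longrightarrow> dist x y + s \<le> (2 * L) * r \<Longrightarrow> Vol m x s \<le> C' * Vol m y r"
    using Vol_comparable[of "2 * L"] by metis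
  obtain C'' where C'': "1 \<le> C''" "\<And>s r. 0 < s \<Longrightarrow> 0 < r \<Longrightarrow> s \<le> L * r \<Longrightarrow> \<Upsilon> s \<le> C'' * \<Upsilon> r"
    using doubling_function_comparable[OF dfun, of L] by metis
  show ?thesis
  proof (rule that[of "C * (C' * C'')"])
    show "1 \<le> C * (C' * C'')" using C(1) C'(1) C''(1) by (metis mult_mono' mult_1 zero_le_one)
    fix x y z :: 'a and r :: real
    assume r: "0 < r" "r \<le> L * dist x y" "dist x z \<le> L * dist x y"
    then have d: "0 < dist x y" using assms by (smt (verit) mult_nonneg_nonpos zero_le_dist)
    then have xy: "x \<noteq> y" by auto
    have Vp: "0 < Vol m x (dist x y) * \<Upsilon> (dist x y)" "0 < Vol m z r * \<Upsilon> r"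
      using r d by (auto intro!: mult_pos_pos Vol_pos \<Upsilon>_pos)
    have "Vol m z r * \<Upsilon> r \<le> (C' * Vol m x (dist x y)) * (C'' * \<Upsilon> (dist x y))"
      using C'(1) r d \<Upsilon>_pos
      by (intro mult_mono C'(2) C''(2)) (auto simp: less_imp_le dist_commute)
    then have "C * (Vol m z r * \<Upsilon> r) \<le> C * ((C' * C'') * (Vol m x (dist x y) * \<Upsilon> (dist x y)))"
      using C(1) by (intro mult_left_mono) (auto simp: mult_ac)
    then have "C / (Vol m x (dist x y) * \<Upsilon> (dist x y)) \<le> C * (C' * C'') / (Vol m z r * \<Upsilon> r)"
      using Vp by (simp add: field_simps)
    then show "K x y \<le> C * (C' * C'') / (Vol m z r * \<Upsilon> r)"
      using C(2)[OF xy] by simp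
  qed
qed

text \<open>Integrate over the annuli \<open>2\<^sup>n R \<le> d < 2\<^bsup>n+1\<^esup> R\<close>, whose contributions decay geometrically.\<close>
lemma K_tail:
  obtains b where "0 < b"
    "\<And>a. 0 \<le> a \<Longrightarrow> a < b \<Longrightarrow> \<exists>C>0. \<forall>x R. 0 < R \<longrightarrow>
       (\<integral>\<^sup>+y. ennreal (dist x y powr a * far R K x y) \<partial>m) \<le> ennreal (C * R powr a / \<Upsilon> R)"
proof -
  \<comment> \<open>The exponent \<open>b\<close> is the lower growth exponent of
    \<open>\<Upsilon>\<close>; weights of smaller exponent remain integrable against the
    tail.\<close>
  obtain C0 b where C0: "1 \<le> C0" "0 < b"
    "\<And>r R. 0 < r \<Longrightarrow> r \<le> R \<Longrightarrow> (R / r) powr b * \<Upsilon> r \<le> C0 * \<Upsilon> R"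
    using doubling_functionE[OF dfun] by metis
  obtain C1 where C1: "1 \<le> C1"
    "\<And>x y z r. \<lbrakk>0 < r; r \<le> 1 * dist x y; dist x z \<le> 1 * dist x y\<rbrakk> \<Longrightarrow>
       K x y \<le> C1 / (Vol m z r * \<Upsilon> r)"
    using K_upper[of 1] by (metis zero_less_one)
  obtain C2 where C2: "1 \<le> C2"
    "\<And>x y r s. 0 < r \<Longrightarrow> dist x y + s \<le> 2 * r \<Longrightarrow> Vol m x s \<le> C2 * Vol m y r"
    using Vol_comparable[of 2] by metis
  show ?thesis
  proof (rule that[OF C0(2)])
    fix a :: real assume a: "0 \<le> a" "a < b"
    define q where "q = 2 powr (a - b)"
    have q: "0 < q" "q < 1" using a powr_less_mono[of "a - b" 0 2] by (auto simp: q_def)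
    define C where "C = C1 * C2 * C0 * 2 powr a / (1 - q)"
    have Cp: "0 < C" unfolding C_def using C0 C1 C2 q by (intro divide_pos_pos mult_pos_pos) auto
    have "(\<integral>\<^sup>+y. ennreal (dist x y powr a * far R K x y) \<partial>m) \<le> ennreal (C * R powr a / \<Upsilon> R)"
      if R: "0 < R" for x R
    proof -
      define t where "t n = 2 ^ n * R" for n :: nat
      have t: "0 < t n" "R \<le> t n" "t (Suc n) = 2 * t n" for n using R by (auto simp: t_def)
      define c where "c n = (t (Suc n)) powr a * (C1 / (Vol m x (t n) * \<Upsilon> (t n)))" for n
      have c: "0 \<le> c n" for n
        unfolding c_def using C1 t[of n] \<Upsilon>_pos[of "t n"] by (intro mult_nonneg_nonneg divide_nonneg_nonneg) auto
      have pw: "ennreal (dist x y powr a * far R K x y) \<le> (\<Sum>n. ennreal (c n) * indicator (ball x (t (Suc n))) y)" for y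
      proof (cases "dist x y < R")
        case False
        have "\<exists>n. dist x y < t (Suc n)"
        proof -
          obtain n where "dist x y / R < 2 ^ n" using real_arch_pow[of 2] by auto
          then have "dist x y < t n" using R by (simp add: t_def field_simps)
          then show ?thesis using t[of n] by (intro exI[of _ n]) auto
        qed
        define n where "n = (LEAST n. dist x y < t (Suc n))"
        have n: "dist x y < t (Suc n)"
          unfolding n_def using \<open>\<exists>n. _\<close> by (rule LeastI_ex)
        have n': "t n \<le> dist x y"
        proof (cases n)
          case 0
          then show ?thesis using False by (simp add: t_def)
        next
          case (Suc k)
          then have "\<not> dist x y < t (Suc k)" using not_less_Least[of k "\<lambda>n. dist x y < t (Suc n)"] n_def by simp
          then show ?thesis using Suc by simp
        qed
        then have xy: "x \<noteq> y" using t(1)[of n] by auto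
        have "dist x y powr a * K x y \<le> c n"
          unfolding c_def using n n' a t(1)[of n] K_nonneg[OF xy]
          by (intro mult_mono powr_mono2 C1(2)) auto
        then have "ennreal (dist x y powr a * far R K x y) \<le> ennreal (c n) * indicator (ball x (t (Suc n))) y"
          using False n by (simp add: far_def ennreal_leI)
        also have "\<dots> \<le> (\<Sum>n. ennreal (c n) * indicator (ball x (t (Suc n))) y)"
          by (rule term_le_suminf_ennreal)
        finally show ?thesis .
      qed (simp add: far_def)
      \<comment> \<open>Volume doubling removes the volumes, and \<open>\<Upsilon> (t n)\<close>
        exceeds a multiple of \<open>(2 ^ n) powr b * \<Upsilon> R\<close>, so the terms decay like
        \<open>2 powr (n * (a - b))\<close>.\<close>
      have bd: "c n * Vol m x (t (Suc n)) \<le> C1 * C2 * C0 * 2 powr a * (R powr a / \<Upsilon> R) * q ^ n" for n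
      proof -
        have V: "0 < Vol m x (t n)" "0 < \<Upsilon> (t n)" "0 < \<Upsilon> R" using t(1) R by (auto intro: Vol_pos \<Upsilon>_pos)
        have "Vol m x (t (Suc n)) \<le> C2 * Vol m x (t n)" by (rule C2(2)) (use t in auto)
        then have "c n * Vol m x (t (Suc n)) \<le> c n * (C2 * Vol m x (t n))"
          using c by (intro mult_left_mono) auto
        also have "\<dots> = C1 * C2 * (t (Suc n)) powr a / \<Upsilon> (t n)"
          using V by (simp add: c_def)
        also have "(t (Suc n)) powr a = 2 powr a * R powr a * (2 ^ n) powr a"
          using R by (simp add: t_def powr_mult mult_ac)
        also have "C1 * C2 * (2 powr a * R powr a * (2 ^ n) powr a) / \<Upsilon> (t n)
           \<le> C1 * C2 * (2 powr a * R powr a * (2 ^ n) powr a) * (C0 / ((2 ^ n) powr b * \<Upsilon> R))"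
        proof -
          have "(2 ^ n) powr b * \<Upsilon> R \<le> C0 * \<Upsilon> (t n)"
            using C0(3)[OF R t(2)[of n]] R by (simp add: t_def)
          then have "1 / \<Upsilon> (t n) \<le> C0 / ((2 ^ n) powr b * \<Upsilon> R)"
            using V by (simp add: field_simps)
          then have "C1 * C2 * (2 powr a * R powr a * (2 ^ n) powr a) * (1 / \<Upsilon> (t n))
           \<le> C1 * C2 * (2 powr a * R powr a * (2 ^ n) powr a) * (C0 / ((2 ^ n) powr b * \<Upsilon> R))"
            using C1 C2 by (intro mult_left_mono) auto
          then show ?thesis by simp
        qed
        also have "\<dots> = C1 * C2 * C0 * 2 powr a * (R powr a / \<Upsilon> R) * ((2 ^ n) powr a / (2 ^ n) powr b)"
          by (simp add: mult_ac)
        also have "(2 ^ n) powr a / (2 ^ n) powr b = q ^ n"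
        proof -
          have "(2 ^ n) powr a / (2 ^ n) powr b = ((2::real) ^ n) powr (a - b)" by (simp add: powr_diff)
          also have "\<dots> = q ^ n"
            by (simp add: q_def powr_realpow[symmetric] powr_powr powr_power mult.commute)
          finally show ?thesis .
        qed
        finally show ?thesis .
      qed
      have "(\<integral>\<^sup>+y. ennreal (dist x y powr a * far R K x y) \<partial>m)
          \<le> (\<integral>\<^sup>+y. (\<Sum>n. ennreal (c n) * indicator (ball x (t (Suc n))) y) \<partial>m)"
        by (intro nn_integral_mono pw)
      also have "\<dots> = (\<Sum>n. \<integral>\<^sup>+y. ennreal (c n) * indicator (ball x (t (Suc n))) y \<partial>m)"
        by (rule nn_integral_suminf) measurable
      also have "\<dots> = (\<Sum>n. ennreal (c n * Vol m x (t (Suc n))))"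
        by (simp add: nn_integral_cmult_indicator emeasure_ball ennreal_mult c)
      also have "\<dots> \<le> (\<Sum>n. ennreal (C1 * C2 * C0 * 2 powr a * (R powr a / \<Upsilon> R) * q ^ n))"
        by (intro suminf_le ennreal_leI bd) auto
      also have "\<dots> = ennreal (\<Sum>n. C1 * C2 * C0 * 2 powr a * (R powr a / \<Upsilon> R) * q ^ n)"
      proof (rule suminf_ennreal2)
        show "0 \<le> C1 * C2 * C0 * 2 powr a * (R powr a / \<Upsilon> R) * q ^ n" for n
          using C0 C1 C2 \<Upsilon>_pos[OF R] q by (intro mult_nonneg_nonneg divide_nonneg_nonneg) auto
        show "summable (\<lambda>n. C1 * C2 * C0 * 2 powr a * (R powr a / \<Upsilon> R) * q ^ n)"
          using q by (intro summable_mult summable_geometric) auto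
      qed
      also have "(\<Sum>n. C1 * C2 * C0 * 2 powr a * (R powr a / \<Upsilon> R) * q ^ n) = C * R powr a / \<Upsilon> R"
        using q by (subst suminf_mult) (auto simp: C_def suminf_geometric intro: summable_geometric)
      finally show ?thesis .
    qed
    then show "\<exists>C>0. \<forall>x R. 0 < R \<longrightarrow>
       (\<integral>\<^sup>+y. ennreal (dist x y powr a * far R K x y) \<partial>m) \<le> ennreal (C * R powr a / \<Upsilon> R)"
      using Cp by blast
  qed
qed

lemma far_energy_le:
  obtains C where "0 < C"
    "\<And>R (u::'a \<Rightarrow> real). 0 < R \<Longrightarrow> u \<in> borel_measurable m \<Longrightarrow>
       JGamma m p (far R K) u UNIV \<le> ennreal (C / \<Upsilon> R) * (\<integral>\<^sup>+x. ennreal (\<bar>u x\<bar> powr p) \<partial>m)"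
proof -
  obtain b where b: "0 < b" "\<And>a. 0 \<le> a \<Longrightarrow> a < b \<Longrightarrow> \<exists>C>0. \<forall>x R. 0 < R \<longrightarrow>
       (\<integral>\<^sup>+y. ennreal (dist x y powr a * far R K x y) \<partial>m) \<le> ennreal (C * R powr a / \<Upsilon> R)"
    by (rule K_tail) blast
  from b(2)[of 0] b(1) obtain C where C: "C > 0" "\<And>x R. 0 < R \<Longrightarrow>
       (\<integral>\<^sup>+y. ennreal (dist x y powr 0 * far R K x y) \<partial>m) \<le> ennreal (C * R powr 0 / \<Upsilon> R)"
    by auto
  show ?thesis
  proof (rule that[of "2 powr p * 2 * C"])
    show "0 < 2 powr p * 2 * C" using C by simp
    fix R :: real and u :: "'a \<Rightarrow> real" assume R: "0 < R" and u: "u \<in> borel_measurable m"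
    have "JGamma m p (far R K) u UNIV
        \<le> ennreal (2 powr p) * 2 * ennreal (C / \<Upsilon> R) * (\<integral>\<^sup>+x. ennreal (\<bar>u x\<bar> powr p) \<partial>m)"
    proof (rule JGamma_far_le[OF kernel_measurable_trunc(2)[OF K_meas] _ u])
      show "far R K x y = far R K y x" for x y by (simp add: far_def dist_commute K_sym)
      fix x
      \<comment> \<open>On the diagonal the factor is \<open>0 powr 0 = 0\<close>, but there
        \<open>far R K\<close> vanishes as well.\<close>
      have e: "dist x y powr 0 * far R K x y = far R K x y" for y
        using R by (auto simp: far_def)
      then show "(\<integral>\<^sup>+y. ennreal (far R K x y) \<partial>m) \<le> ennreal (C / \<Upsilon> R)"
        using C(2)[OF R, of x] R unfolding e by simp
    qed (use p_pos in auto)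
    also have "ennreal (2 powr p) * 2 * ennreal (C / \<Upsilon> R) = ennreal (2 powr p * 2 * C / \<Upsilon> R)"
      using C(1) \<Upsilon>_pos[OF R] by (simp add: ennreal_mult[symmetric] ennreal_numeral[symmetric] del: ennreal_numeral)
    finally show "JGamma m p (far R K) u UNIV
        \<le> ennreal (2 powr p * 2 * C / \<Upsilon> R) * (\<integral>\<^sup>+x. ennreal (\<bar>u x\<bar> powr p) \<partial>m)" .
  qed
qed

section \<open>The jump form as an L^p space of increments\<close>

text \<open>The energy of \<open>u\<close> is the p-th power of the L^p norm of
  \<open>incr u\<close> for this measure, so the triangle inequality, the Clarkson inequality, the
  Markov property and the Fatou argument become statements about L^p.\<close>

definition jump_measure :: "('a \<times> 'a) measure" where
  "jump_measure = density (m \<Otimes>\<^sub>M m) (\<lambda>(x, y). ennreal (K x y))"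

definition incr :: "('a \<Rightarrow> real) \<Rightarrow> 'a \<times> 'a \<Rightarrow> real" where
  "incr u z = u (fst z) - u (snd z)"

lemma K_meas'[measurable]: "(\<lambda>z. K (fst z) (snd z)) \<in> borel_measurable (m \<Otimes>\<^sub>M m)"
  using K_meas by (simp add: split_beta')

lemma sets_jump_measure[measurable_cong, simp]: "sets jump_measure = sets (m \<Otimes>\<^sub>M m)"
  by (simp add: jump_measure_def)

lemma incr_measurable[measurable]:
  assumes [measurable]: "u \<in> borel_measurable m"
  shows "incr u \<in> borel_measurable (m \<Otimes>\<^sub>M m)"
  unfolding incr_def by measurable

lemma incr_measurable':
  assumes "u \<in> borel_measurable m"
  shows "incr u \<in> borel_measurable jump_measure"
  using incr_measurable[OF assms] measurable_cong_sets[OF sets_jump_measure refl] by blast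

lemma JGamma_eq_jump_measure:
  assumes [measurable]: "u \<in> borel_measurable m"
  shows "JGamma m p K u UNIV = (\<integral>\<^sup>+z. ennreal (\<bar>incr u z\<bar> powr p) \<partial>jump_measure)"
proof -
  have "(\<integral>\<^sup>+z. ennreal (\<bar>incr u z\<bar> powr p) \<partial>jump_measure)
     = (\<integral>\<^sup>+z. ennreal (K (fst z) (snd z)) * ennreal (\<bar>incr u z\<bar> powr p) \<partial>(m \<Otimes>\<^sub>M m))"
    unfolding jump_measure_def split_beta' by (rule nn_integral_density) measurable
  also have "\<dots> = JGamma m p K u UNIV"
    unfolding JGamma_UNIV_pair[OF K_meas assms]
    by (intro nn_integral_cong) (simp add: incr_def ennreal_mult' mult.commute[of "ennreal (K _ _)"])
  finally show ?thesis ..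
qed

lemma JF_iff: "u \<in> JF m p K \<longleftrightarrow> Lp m p u \<and> Lp jump_measure p (incr u)"
proof (cases "u \<in> borel_measurable m")
  case True
  then show ?thesis
    using Lp_iff_nn[OF incr_measurable'[OF True], of p] JGamma_eq_jump_measure[OF True]
    by (simp add: JF_def)
qed (auto simp: JF_def Lp_def)

lemma JFD:
  assumes "u \<in> JF m p K"
  shows "Lp m p u" "u \<in> borel_measurable m" "JGamma m p K u UNIV < \<infinity>"
    "Lp jump_measure p (incr u)"
    "ennreal (JE m p K u) = JGamma m p K u UNIV"
proof -
  show u: "Lp m p u" "Lp jump_measure p (incr u)" using assms by (simp_all add: JF_iff)
  show "u \<in> borel_measurable m" using u(1) by (rule LpD)
  show fin: "JGamma m p K u UNIV < \<infinity>" using assms by (simp add: JF_def)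
  then show "ennreal (JE m p K u) = JGamma m p K u UNIV" by (simp add: JE_def less_top)
qed

lemma JE_eq:
  assumes "u \<in> JF m p K"
  shows "JE m p K u = Lp_pow jump_measure p (incr u)"
  using Lp_pow_eq_enn2real[OF incr_measurable'[OF JFD(2)[OF assms]], of p]
    JGamma_eq_jump_measure[OF JFD(2)[OF assms]]
  by (simp add: JE_def)

lemma incr_simps:
  "incr (\<lambda>x. u x + v x) = (\<lambda>z. incr u z + incr v z)"
  "incr (\<lambda>x. u x - v x) = (\<lambda>z. incr u z - incr v z)"
  "incr (\<lambda>x. c * u x) = (\<lambda>z. c * incr u z)"
  by (auto simp: incr_def algebra_simps)

lemma JF_add: "u \<in> JF m p K \<Longrightarrow> v \<in> JF m p K \<Longrightarrow> (\<lambda>x. u x + v x) \<in> JF m p K"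
  by (auto simp: JF_iff incr_simps p_pos intro!: Lp_add)

lemma JF_diff: "u \<in> JF m p K \<Longrightarrow> v \<in> JF m p K \<Longrightarrow> (\<lambda>x. u x - v x) \<in> JF m p K"
  by (auto simp: JF_iff incr_simps p_pos intro!: Lp_diff)

lemma JF_cmult: "u \<in> JF m p K \<Longrightarrow> (\<lambda>x. c * u x) \<in> JF m p K"
  by (auto simp: JF_iff incr_simps intro!: Lp_cmult)

lemma JF_zero: "(\<lambda>x. 0) \<in> JF m p K"
proof -
  have "incr (\<lambda>x. 0) = (\<lambda>z. 0)" by (auto simp: incr_def)
  then show ?thesis unfolding JF_iff by (simp add: Lp_zero)
qed

lemma JF_sum: "(\<And>i. i \<in> I \<Longrightarrow> u i \<in> JF m p K) \<Longrightarrow> (\<lambda>x. \<Sum>i\<in>I. u i x) \<in> JF m p K"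
  by (induction I rule: infinite_finite_induct) (auto intro: JF_zero JF_add)

text \<open>For a null set, the pairs with at least one entry in it are null for the product and
  hence for its density. The energy thus ignores the choice of representative, and convergence
  almost everywhere passes to increments.\<close>

lemma AE_jump_measure:
  assumes "AE x in m. P x"
  shows "AE z in jump_measure. P (fst z) \<and> P (snd z)"
proof -
  obtain N where N: "{x \<in> space m. \<not> P x} \<subseteq> N" "emeasure m N = 0" "N \<in> sets m"
    using assms by (rule AE_E)
  have null: "N \<times> UNIV \<union> UNIV \<times> N \<in> null_sets (m \<Otimes>\<^sub>M m)"
  proof (rule null_sets.Un)
    have U: "(UNIV :: 'a set) \<in> sets m" by simp
    show "N \<times> UNIV \<in> null_sets (m \<Otimes>\<^sub>M m)"
      using N(2) emeasure_pair_measure_Times[OF N(3) U] N(3) U by (auto intro!: null_setsI pair_measureI)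
    show "UNIV \<times> N \<in> null_sets (m \<Otimes>\<^sub>M m)"
      using N(2) emeasure_pair_measure_Times[OF U N(3)] N(3) U by (auto intro!: null_setsI pair_measureI)
  qed
  have "AE z in m \<Otimes>\<^sub>M m. P (fst z) \<and> P (snd z)"
    by (rule AE_I'[OF null]) (use N in \<open>auto simp: space_pair_measure\<close>)
  then show ?thesis
    unfolding jump_measure_def by (subst AE_density) (auto simp: split_beta')
qed

lemma JF_AE_cong:
  assumes u: "u \<in> JF m p K" and v: "v \<in> borel_measurable m" and eq: "AE x in m. u x = v x"
  shows "v \<in> JF m p K" "JE m p K v = JE m p K u"
proof -
  have ae: "AE z in jump_measure. incr u z = incr v z"
    using AE_jump_measure[OF eq] by eventually_elim (simp add: incr_def)
  note L = Lp_AE_cong[OF JFD(4)[OF u] incr_measurable'[OF v] ae]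
  show "v \<in> JF m p K"
    unfolding JF_iff using Lp_AE_cong[OF JFD(1)[OF u] v eq] L by blast
  then show "JE m p K v = JE m p K u" using JE_eq u L by simp
qed

lemma p_form_JF: "p_form m p (JF m p K) (JE m p K)"
  unfolding p_form_def
proof (intro conjI ballI allI impI)
  fix u v c assume u: "u \<in> JF m p K"
  show "Lp m p u" using JFD(1)[OF u] .
  show cu: "(\<lambda>x. c * u x) \<in> JF m p K" using JF_cmult[OF u] .
  show "JE m p K (\<lambda>x. c * u x) = \<bar>c\<bar> powr p * JE m p K u"
    unfolding JE_eq[OF cu] JE_eq[OF u] incr_simps by (rule Lp_cmult(2)[OF JFD(4)[OF u]])
  show "0 \<le> JE m p K u" by (simp add: JE_def)
  { assume v: "v \<in> JF m p K"
    show uv: "(\<lambda>x. u x + v x) \<in> JF m p K" using JF_add[OF u v] .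
    show "JE m p K (\<lambda>x. u x + v x) powr (1/p) \<le> JE m p K u powr (1/p) + JE m p K v powr (1/p)"
      unfolding JE_eq[OF uv] JE_eq[OF u] JE_eq[OF v] incr_simps
      by (rule Lp_triangle[OF p_pos(3) JFD(4)[OF u] JFD(4)[OF v]]) }
  { assume "v \<in> borel_measurable m \<and> (AE x in m. u x = v x)"
    then show "v \<in> JF m p K" "JE m p K v = JE m p K u" using JF_AE_cong[OF u] by auto }
qed (rule JF_zero)

lemma JF_Markov:
  assumes \<phi>: "\<And>s t. \<bar>\<phi> s - \<phi> t\<bar> \<le> \<bar>s - t\<bar>" "\<phi> 0 = 0" and u: "u \<in> JF m p K"
  shows "\<phi> \<circ> u \<in> JF m p K" "JE m p K (\<phi> \<circ> u) \<le> JE m p K u"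
proof -
  have "continuous_on UNIV \<phi>"
    using \<phi>(1) by (intro lipschitz_on_continuous_on[of 1]) (auto simp: lipschitz_on_def dist_real_def)
  then have [measurable]: "\<phi> \<in> borel_measurable borel" by (rule borel_measurable_continuous_onI)
  note [measurable] = JFD(2)[OF u]
  have [measurable]: "\<phi> \<circ> u \<in> borel_measurable m" by simp
  note L = Lp_mono[OF p_pos(2) JFD(4)[OF u] incr_measurable'[of "\<phi> \<circ> u"]]
  show *: "\<phi> \<circ> u \<in> JF m p K"
    unfolding JF_iff
    using Lp_mono(1)[OF p_pos(2) JFD(1)[OF u], of "\<phi> \<circ> u"] L(1) \<phi>(1) \<phi>(1)[of _ 0]
    by (auto simp: incr_def \<phi>(2))
  show "JE m p K (\<phi> \<circ> u) \<le> JE m p K u"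
    unfolding JE_eq[OF *] JE_eq[OF u] by (rule L(2)) (auto simp: incr_def \<phi>(1))
qed

lemma JF_clarkson:
  assumes "scalar_clarkson p"
  shows "clarkson p (JF m p K) (JE m p K)"
  unfolding clarkson_def
proof (intro ballI)
  fix u v assume u: "u \<in> JF m p K" and v: "v \<in> JF m p K"
  have "incr u \<in> Collect (Lp jump_measure p)" "incr v \<in> Collect (Lp jump_measure p)"
    using JFD(4) u v by auto
  note C = Lp_clarkson[OF p_gt_1 assms, unfolded clarkson_def, rule_format, OF this]
  show "(p \<le> 2 \<longrightarrow> 2 * (JE m p K u powr (1/(p-1)) + JE m p K v powr (1/(p-1))) powr (p-1)
        \<le> JE m p K (\<lambda>x. u x + v x) + JE m p K (\<lambda>x. u x - v x)) \<and>
     (2 \<le> p \<longrightarrow> JE m p K (\<lambda>x. u x + v x) + JE m p K (\<lambda>x. u x - v x)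
        \<le> 2 * (JE m p K u powr (1/(p-1)) + JE m p K v powr (1/(p-1))) powr (p-1))"
    unfolding JE_eq[OF u] JE_eq[OF v] JE_eq[OF JF_add[OF u v]] JE_eq[OF JF_diff[OF u v]] incr_simps
    by (rule C)
qed

text \<open>An extended real version of \<open>E1\<close>: among measurable functions it is finite
  exactly on \<open>JF\<close>, so an estimate of it can establish membership.\<close>

definition nrm :: "('a \<Rightarrow> real) \<Rightarrow> ennreal" where
  "nrm u = JGamma m p K u UNIV + (\<integral>\<^sup>+x. ennreal (\<bar>u x\<bar> powr p) \<partial>m)"

lemma JF_iff_nrm:
  assumes "u \<in> borel_measurable m"
  shows "u \<in> JF m p K \<longleftrightarrow> nrm u < \<infinity>"
  using Lp_iff_nn[OF assms, of p] by (auto simp: JF_def nrm_def)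

lemma ennreal_E1:
  assumes "u \<in> JF m p K"
  shows "ennreal (E1 m p (JE m p K) u) = nrm u"
  unfolding E1_def nrm_def
  using JFD(5)[OF assms] LpD(3)[OF JFD(1)[OF assms]]
  by (subst ennreal_plus) (auto simp: JE_def Lp_pow_nonneg)

lemma nrm_diff_le:
  assumes u[measurable]: "u \<in> borel_measurable m" and v[measurable]: "v \<in> borel_measurable m"
  shows "nrm (\<lambda>x. u x - v x) \<le> ennreal (2 powr p) * (nrm u + nrm v)"
proof -
  have "(\<integral>\<^sup>+x. ennreal (\<bar>u x - v x\<bar> powr p) \<partial>m)
      \<le> (\<integral>\<^sup>+x. ennreal (2 powr p) * (ennreal (\<bar>u x\<bar> powr p) + ennreal (\<bar>v x\<bar> powr p)) \<partial>m)"
  proof (rule nn_integral_mono)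
    fix x
    have "ennreal (\<bar>u x - v x\<bar> powr p) \<le> ennreal (2 powr p * (\<bar>u x\<bar> powr p + \<bar>v x\<bar> powr p))"
      by (intro ennreal_leI abs_diff_powr_le p_pos)
    then show "ennreal (\<bar>u x - v x\<bar> powr p)
        \<le> ennreal (2 powr p) * (ennreal (\<bar>u x\<bar> powr p) + ennreal (\<bar>v x\<bar> powr p))"
      by (simp add: ennreal_mult)
  qed
  also have "\<dots> = ennreal (2 powr p) *
      ((\<integral>\<^sup>+x. ennreal (\<bar>u x\<bar> powr p) \<partial>m) + (\<integral>\<^sup>+x. ennreal (\<bar>v x\<bar> powr p) \<partial>m))"
    by (simp add: nn_integral_cmult nn_integral_add)
  finally have "nrm (\<lambda>x. u x - v x) \<le> ennreal (2 powr p) * (JGamma m p K u UNIV + JGamma m p K v UNIV)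
     + ennreal (2 powr p) * ((\<integral>\<^sup>+x. ennreal (\<bar>u x\<bar> powr p) \<partial>m) + (\<integral>\<^sup>+x. ennreal (\<bar>v x\<bar> powr p) \<partial>m))"
    unfolding nrm_def using JGamma_diff_le[OF K_meas u v _ p_pos(2), of UNIV] by (intro add_mono) auto
  also have "\<dots> = ennreal (2 powr p) * (nrm u + nrm v)"
    unfolding nrm_def by (simp only: distrib_left[symmetric] ac_simps)
  finally show ?thesis .
qed

text \<open>Fatou's lemma is applied to the energy and to the L^p part separately, each bounded by
  \<open>e\<close>; hence the factor 2.\<close>

lemma nrm_Fatou:
  assumes h: "\<And>k. h k \<in> borel_measurable m"
    and lim: "AE x in m. (\<lambda>k. h k x) \<longlonglongrightarrow> g x"
    and bd: "\<And>k. k \<ge> n \<Longrightarrow> nrm (h k) \<le> e"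
    and g: "g \<in> borel_measurable m"
  shows "nrm g \<le> 2 * e"
proof -
  have "(\<integral>\<^sup>+x. ennreal (\<bar>g x\<bar> powr p) \<partial>m) \<le> e"
  proof (rule Fatou_powr[OF h p_pos(1) lim])
    fix k assume "n \<le> k"
    from bd[OF this] show "(\<integral>\<^sup>+x. ennreal (\<bar>h k x\<bar> powr p) \<partial>m) \<le> e"
      unfolding nrm_def by (rule order_trans[rotated]) simp
  qed
  moreover have "(\<integral>\<^sup>+z. ennreal (\<bar>incr g z\<bar> powr p) \<partial>jump_measure) \<le> e"
  proof (rule Fatou_powr[OF incr_measurable'[OF h] p_pos(1)])
    show "AE z in jump_measure. (\<lambda>k. incr (h k) z) \<longlonglongrightarrow> incr g z"
      using AE_jump_measure[OF lim] by eventually_elim (auto simp: incr_def intro: tendsto_diff)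
    fix k assume "n \<le> k"
    from bd[OF this] show "(\<integral>\<^sup>+z. ennreal (\<bar>incr (h k) z\<bar> powr p) \<partial>jump_measure) \<le> e"
      unfolding nrm_def JGamma_eq_jump_measure[OF h] by (rule order_trans[rotated]) simp
  qed
  ultimately show ?thesis
    unfolding nrm_def JGamma_eq_jump_measure[OF g] mult_2 by (intro add_mono)
qed

text \<open>The limit \<open>g\<close> is found in L^p along a subsequence. Fatou's lemma for
  \<open>f n - f (r k)\<close> as \<open>k\<close> grows then bounds \<open>f n - g\<close> in the
  full norm, for all large \<open>n\<close> and not just along the subsequence.\<close>

lemma JF_complete:
  fixes f :: "nat \<Rightarrow> 'a \<Rightarrow> real"
  assumes f: "\<And>n. f n \<in> JF m p K"
    and Cau: "\<And>e. 0 < e \<Longrightarrow> \<exists>N. \<forall>n\<ge>N. \<forall>k\<ge>N. E1 m p (JE m p K) (\<lambda>x. f n x - f k x) < e"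
  shows "\<exists>g\<in>JF m p K. (\<lambda>n. E1 m p (JE m p K) (\<lambda>x. f n x - g x)) \<longlonglongrightarrow> 0"
proof -
  have fm[measurable]: "f n \<in> borel_measurable m" for n using JFD(2)[OF f] .
  have le: "Lp_pow m p u \<le> E1 m p (JE m p K) u" for u by (simp add: E1_def JE_def)
  have CauL: "\<exists>N. \<forall>n\<ge>N. \<forall>k\<ge>N. Lp_pow m p (\<lambda>x. f n x - f k x) < e" if "0 < e" for e
    using Cau[OF that] le le_less_trans by blast
  obtain r g where r: "strict_mono r" and g[measurable]: "g \<in> borel_measurable m"
    and lim: "AE x in m. (\<lambda>k. f (r k) x) \<longlonglongrightarrow> g x"
    using Lp_Cauchy_subseq[OF p_gt_1 JFD(1)[OF f] CauL] by metis
  have est: "\<exists>N. \<forall>n\<ge>N. nrm (\<lambda>x. f n x - g x) \<le> ennreal e" if e: "0 < e" for e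
  proof -
    obtain N where N: "\<And>n k. n \<ge> N \<Longrightarrow> k \<ge> N \<Longrightarrow> E1 m p (JE m p K) (\<lambda>x. f n x - f k x) < e / 2"
      using Cau[of "e/2"] e by auto
    have "nrm (\<lambda>x. f n x - g x) \<le> ennreal e" if n: "n \<ge> N" for n
    proof -
      have "nrm (\<lambda>x. f n x - g x) \<le> 2 * ennreal (e / 2)"
      proof (rule nrm_Fatou[where h = "\<lambda>k x. f n x - f (r k) x" and n = N])
        show "AE x in m. (\<lambda>k. f n x - f (r k) x) \<longlonglongrightarrow> f n x - g x"
          using lim by eventually_elim (intro tendsto_intros)
        fix k assume "N \<le> k"
        then have "N \<le> r k" using seq_suble[OF r, of k] by simp
        then show "nrm (\<lambda>x. f n x - f (r k) x) \<le> ennreal (e / 2)"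
          using N[OF n] ennreal_E1[OF JF_diff[OF f f]] by (metis ennreal_leI less_imp_le)
      qed measurable
      also have "\<dots> = ennreal (2 * (e / 2))" using e by (subst ennreal_mult) auto
      finally show ?thesis by simp
    qed
    then show ?thesis by blast
  qed
  have fg: "(\<lambda>x. f n x - g x) \<in> JF m p K" if "nrm (\<lambda>x. f n x - g x) \<le> ennreal 1" for n
    using that by (subst JF_iff_nrm) (auto simp: order_le_less_trans)
  obtain N where N: "\<And>n. n \<ge> N \<Longrightarrow> nrm (\<lambda>x. f n x - g x) \<le> ennreal 1" using est[of 1] by auto
  \<comment> \<open>\<open>g\<close> is recovered as \<open>f N - (f N - g)\<close>.\<close>
  have gJ: "g \<in> JF m p K"
    using JF_diff[OF f[of N] fg[OF N[of N]]] by simp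
  have "(\<lambda>n. E1 m p (JE m p K) (\<lambda>x. f n x - g x)) \<longlonglongrightarrow> 0"
  proof (rule LIMSEQ_I)
    fix e :: real assume "0 < e"
    then obtain N where N: "\<And>n. n \<ge> N \<Longrightarrow> nrm (\<lambda>x. f n x - g x) \<le> ennreal (e / 2)" using est[of "e/2"] by auto
    have "norm (E1 m p (JE m p K) (\<lambda>x. f n x - g x) - 0) < e" if "n \<ge> N" for n
    proof -
      have "ennreal (E1 m p (JE m p K) (\<lambda>x. f n x - g x)) \<le> ennreal (e / 2)"
        using N[OF that] ennreal_E1[OF JF_diff[OF f gJ]] by simp
      then have "E1 m p (JE m p K) (\<lambda>x. f n x - g x) \<le> e / 2" using \<open>0 < e\<close> by simp
      moreover have "0 \<le> E1 m p (JE m p K) (\<lambda>x. f n x - g x)"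
        by (simp add: E1_def JE_def Lp_pow_nonneg)
      ultimately show ?thesis using \<open>0 < e\<close> by simp
    qed
    then show "\<exists>N. \<forall>n\<ge>N. norm (E1 m p (JE m p K) (\<lambda>x. f n x - g x) - 0) < e" by blast
  qed
  then show ?thesis using gJ by blast
qed

end

section \<open>Smoothing by averages over a net\<close>

lemma Lp_integrable_on_ball:
  assumes "Lp m p f" "1 \<le> p" and B: "B \<in> sets m" "emeasure m B < \<infinity>"
  shows "set_integrable m B f"
  unfolding set_integrable_def
proof (rule Bochner_Integration.integrable_bound)
  have [measurable]: "f \<in> borel_measurable m" using assms(1) by (rule LpD)
  note [measurable] = B(1)
  show "integrable m (\<lambda>x. indicator B x + \<bar>f x\<bar> powr p)"
    using LpD(2)[OF assms(1)] B by (intro Bochner_Integration.integrable_add) auto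
  show "(\<lambda>x. indicator B x *\<^sub>R f x) \<in> borel_measurable m" by simp
  show "AE x in m. norm (indicator B x *\<^sub>R f x) \<le> norm (indicator B x + \<bar>f x\<bar> powr p)"
  proof (rule AE_I2)
    fix x
    have "\<bar>f x\<bar> \<le> 1 + \<bar>f x\<bar> powr p"
    proof (cases "\<bar>f x\<bar> \<le> 1")
      case False
      then have "\<bar>f x\<bar> powr 1 \<le> \<bar>f x\<bar> powr p" using assms(2) by (intro powr_mono) auto
      then show ?thesis by simp
    qed (use powr_ge_zero[of "\<bar>f x\<bar>" p] in linarith)
    then show "norm (indicator B x *\<^sub>R f x) \<le> norm (indicator B x + \<bar>f x\<bar> powr p)"
      by (auto simp: indicator_def)
  qed
qed

context doubling_space
begin

definition avg :: "('a \<Rightarrow> real) \<Rightarrow> 'a \<Rightarrow> real \<Rightarrow> real" where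
  "avg f x r = (\<integral>y\<in>ball x r. f y \<partial>m) / Vol m x r"

text \<open>Instead of Jensen's inequality, optimize \<open>t \<le> l + l powr (1 - p) * t powr p\<close> over \<open>l\<close>.\<close>
lemma avg_diff_powr_le:
  assumes f: "Lp m p f" and p: "1 \<le> p" and r: "0 < r"
  shows "ennreal (\<bar>avg f x r - a\<bar> powr p * Vol m x r)
    \<le> ennreal (2 powr p) * (\<integral>\<^sup>+y\<in>ball x r. ennreal (\<bar>f y - a\<bar> powr p) \<partial>m)"
proof -
  let ?B = "ball x r" and ?V = "Vol m x r"
  have [measurable]: "f \<in> borel_measurable m" using f by (rule LpD)
  have V: "0 < ?V" using r by (rule Vol_pos)
  have B: "?B \<in> sets m" "emeasure m ?B < \<infinity>" using emeasure_ball_finite by auto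
  have iB: "integrable m (\<lambda>y. indicator ?B y :: real)" using B by simp
  have intf: "set_integrable m ?B f" by (rule Lp_integrable_on_ball[OF f p B])
  have inta: "set_integrable m ?B (\<lambda>y. a)"
    using iB by (simp add: set_integrable_def)
  have intd: "set_integrable m ?B (\<lambda>y. f y - a)" using set_integral_diff(1)[OF intf inta] .
  have intp: "integrable m (\<lambda>y. indicator ?B y * \<bar>f y - a\<bar> powr p)"
  proof (rule Bochner_Integration.integrable_bound)
    show "integrable m (\<lambda>y. 2 powr p * (\<bar>f y\<bar> powr p + \<bar>a\<bar> powr p * indicator ?B y))"
      using LpD(2)[OF f] iB by simp
    show "AE y in m. norm (indicator ?B y * \<bar>f y - a\<bar> powr p)
        \<le> norm (2 powr p * (\<bar>f y\<bar> powr p + \<bar>a\<bar> powr p * indicator ?B y))"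
      using abs_diff_powr_le[of p "f _" a] p by (auto simp: indicator_def)
  qed simp
  define Q where "Q = (\<integral>y. indicator ?B y * \<bar>f y - a\<bar> powr p \<partial>m)"
  have Q0: "0 \<le> Q" unfolding Q_def by (rule Bochner_Integration.integral_nonneg) simp
  have Q: "(\<integral>\<^sup>+y\<in>?B. ennreal (\<bar>f y - a\<bar> powr p) \<partial>m) = ennreal Q"
  proof -
    have "(\<integral>\<^sup>+y\<in>?B. ennreal (\<bar>f y - a\<bar> powr p) \<partial>m) = (\<integral>\<^sup>+y. ennreal (indicator ?B y * \<bar>f y - a\<bar> powr p) \<partial>m)"
      by (intro nn_integral_cong) (auto simp: indicator_def)
    then show ?thesis unfolding Q_def using intp by (simp add: nn_integral_eq_integral)
  qed
  have opt: "\<bar>avg f x r - a\<bar> * ?V \<le> l * ?V + l powr (1 - p) * Q" if l: "0 < l" for l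
  proof -
    have "(avg f x r - a) * ?V = (\<integral>y\<in>?B. f y - a \<partial>m)"
    proof -
      have "(\<integral>y\<in>?B. a \<partial>m) = a * ?V"
        by (simp add: set_lebesgue_integral_def Vol_def)
      then show ?thesis
        using V set_integral_diff(2)[OF intf inta] by (simp add: avg_def left_diff_distrib)
    qed
    then have "\<bar>avg f x r - a\<bar> * ?V = \<bar>\<integral>y\<in>?B. f y - a \<partial>m\<bar>"
      using V by (metis abs_mult abs_of_pos)
    also have "\<dots> \<le> (\<integral>y. \<bar>indicator ?B y *\<^sub>R (f y - a)\<bar> \<partial>m)"
      unfolding set_lebesgue_integral_def by (rule integral_abs_bound)
    also have "\<dots> \<le> (\<integral>y. l * indicator ?B y + l powr (1 - p) * (indicator ?B y * \<bar>f y - a\<bar> powr p) \<partial>m)"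
    proof (rule integral_mono)
      show "integrable m (\<lambda>y. \<bar>indicator ?B y *\<^sub>R (f y - a)\<bar>)"
        using intd unfolding set_integrable_def by (rule integrable_abs)
      show "integrable m (\<lambda>y. l * indicator ?B y + l powr (1 - p) * (indicator ?B y * \<bar>f y - a\<bar> powr p))"
        using intp iB by simp
      fix y
      have "t \<le> l + l powr (1 - p) * t powr p" if t: "0 \<le> t" for t
      proof (cases "t \<le> l")
        case False
        then have "t powr (1 - p) \<le> l powr (1 - p)" using l p by (intro powr_mono2') auto
        then have "t powr (1 - p) * t powr p \<le> l powr (1 - p) * t powr p" by (intro mult_right_mono) auto
        moreover have "t powr (1 - p) * t powr p = t" using False l t by (simp add: powr_add[symmetric])
        ultimately show ?thesis using l by simp
      qed (simp add: add_increasing2)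
      from this[of "\<bar>f y - a\<bar>"]
      show "\<bar>indicator ?B y *\<^sub>R (f y - a)\<bar> \<le> l * indicator ?B y + l powr (1 - p) * (indicator ?B y * \<bar>f y - a\<bar> powr p)"
        by (simp add: indicator_def)
    qed
    also have "\<dots> = l * ?V + l powr (1 - p) * Q"
      using intp iB by (simp add: Q_def Vol_def)
    finally show ?thesis .
  qed
  have "\<bar>avg f x r - a\<bar> powr p * ?V \<le> 2 powr p * Q"
  proof (cases "Q = 0")
    case True
    have "\<bar>avg f x r - a\<bar> \<le> l" if "0 < l" for l using opt[OF that] True V by simp
    then have "\<bar>avg f x r - a\<bar> \<le> 0" by (rule dense_ge)
    then show ?thesis using True by simp
  next
    case False
    \<comment> \<open>This choice balances the bound: both terms on the right of \<open>opt\<close>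
      equal \<open>l * ?V\<close>.\<close>
    define l where "l = (Q / ?V) powr (1/p)"
    have l: "0 < l" using False Q0 V by (simp add: l_def)
    have lp: "l powr p = Q / ?V" using p Q0 V by (simp add: l_def powr_powr)
    have "l powr (1 - p) * Q = l powr (1 - p) * l powr p * ?V" using V lp by simp
    also have "\<dots> = l * ?V" using l by (simp add: powr_add[symmetric])
    finally have "\<bar>avg f x r - a\<bar> * ?V \<le> (2 * l) * ?V" using opt[OF l] by simp
    then have "\<bar>avg f x r - a\<bar> \<le> 2 * l" using V by (rule mult_right_le_imp_le)
    then have "\<bar>avg f x r - a\<bar> powr p \<le> (2 * l) powr p" using p by (intro powr_mono2) auto
    then have "\<bar>avg f x r - a\<bar> powr p * ?V \<le> (2 powr p * (Q / ?V)) * ?V"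
      using V by (intro mult_right_mono) (auto simp: powr_mult lp)
    then show ?thesis using V by simp
  qed
  then have "ennreal (\<bar>avg f x r - a\<bar> powr p * ?V) \<le> ennreal (2 powr p * Q)" by (rule ennreal_leI)
  then show ?thesis unfolding Q by (simp add: ennreal_mult Q0)
qed

end

context jump_form
begin

lemma JGamma_sum_powr:
  assumes v: "\<And>i. i \<in> I \<Longrightarrow> v i \<in> borel_measurable m" and c: "\<And>i. i \<in> I \<Longrightarrow> 0 \<le> c i"
    and le: "\<And>x y. \<bar>u x - u y\<bar> powr p \<le> (\<Sum>i\<in>I. c i * \<bar>v i x - v i y\<bar> powr p)"
  shows "JGamma m p K u UNIV \<le> (\<Sum>i\<in>I. ennreal (c i) * JGamma m p K (v i) UNIV)"
proof (rule JGamma_sum[OF K_meas v])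
  fix x y
  have "ennreal (\<bar>u x - u y\<bar> powr p * K x y) = ennreal (\<bar>u x - u y\<bar> powr p) * ennreal (K x y)"
    by (simp add: ennreal_mult')
  also have "\<dots> \<le> ennreal (\<Sum>i\<in>I. c i * \<bar>v i x - v i y\<bar> powr p) * ennreal (K x y)"
    by (intro mult_right_mono ennreal_leI le) simp
  also have "ennreal (\<Sum>i\<in>I. c i * \<bar>v i x - v i y\<bar> powr p) = (\<Sum>i\<in>I. ennreal (c i * \<bar>v i x - v i y\<bar> powr p))"
    using c by (intro sum_ennreal[symmetric]) auto
  also have "\<dots> * ennreal (K x y) = (\<Sum>i\<in>I. ennreal (c i) * ennreal (\<bar>v i x - v i y\<bar> powr p * K x y))"
    unfolding sum_distrib_right using c
    by (intro sum.cong refl) (simp add: ennreal_mult' ennreal_mult mult.assoc)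
  finally show "ennreal (\<bar>u x - u y\<bar> powr p * K x y)
      \<le> (\<Sum>i\<in>I. ennreal (c i) * ennreal (\<bar>v i x - v i y\<bar> powr p * K x y))" .
qed auto

section \<open>Partitions of unity of controlled energy\<close>

text \<open>A capacity bound for annuli: all that the density argument takes from the cutoff
  inequality. The values are prescribed at every point and not only almost everywhere, which
  continuity makes possible.\<close>

definition cap_cutoffs :: "real \<Rightarrow> real \<Rightarrow> bool" where
  "cap_cutoffs A C \<longleftrightarrow> (\<forall>x r. 0 < r \<longrightarrow> (\<exists>\<phi>\<in>JF m p K. continuous_on UNIV \<phi> \<and>
     (\<forall>y. 0 \<le> \<phi> y \<and> \<phi> y \<le> 1) \<and> (\<forall>y. dist x y < r \<longrightarrow> \<phi> y = 1) \<and>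
     (\<forall>y. A * r \<le> dist x y \<longrightarrow> \<phi> y = 0) \<and>
     JGamma m p K \<phi> UNIV \<le> ennreal (C * Vol m x r / \<Upsilon> r)))"

text \<open>The overlap radius \<open>(2 * A + 8) * e\<close> exceeds all radii at which indices are
  counted later. As the net is infinite in general, the sum condition is required for every finite
  index set that contains the indices active at the point.\<close>

definition partition_of_unity ::
  "real \<Rightarrow> real \<Rightarrow> real \<Rightarrow> real \<Rightarrow> 'a set \<Rightarrow> ('a \<Rightarrow> 'a \<Rightarrow> real) \<Rightarrow> bool" where
  "partition_of_unity A C M e N \<psi> \<longleftrightarrow> 0 < e \<and> is_net e N \<and>
     (\<forall>x. finite {z\<in>N. dist z x < (2 * A + 8) * e} \<and> real (card {z\<in>N. dist z x < (2 * A + 8) * e}) \<le> M) \<and>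
     (\<forall>z\<in>N. \<psi> z \<in> JF m p K \<and> continuous_on UNIV (\<psi> z) \<and> (\<forall>x. 0 \<le> \<psi> z x \<and> \<psi> z x \<le> 1) \<and>
        (\<forall>x. A * e \<le> dist z x \<longrightarrow> \<psi> z x = 0) \<and>
        JGamma m p K (\<psi> z) UNIV \<le> ennreal (C * Vol m z e / \<Upsilon> e)) \<and>
     (\<forall>x I. finite I \<and> I \<subseteq> N \<and> {z\<in>N. dist z x < A * e} \<subseteq> I \<longrightarrow> (\<Sum>z\<in>I. \<psi> z x) = 1)"

text \<open>Each cutoff function is divided by the sum of those of its neighbours. The unit balls of
  the cutoffs cover the space, so the sum is at least 1 where it matters, and the energy of the
  quotient is bounded by that of at most \<open>M\<close> cutoff functions on balls of comparable
  volume.\<close>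

lemma partition_of_unity_exists:
  assumes cap: "cap_cutoffs A C" and A: "1 \<le> A" and C: "0 \<le> C"
  obtains C' M where "1 \<le> C'" "1 \<le> M" "\<And>e. 0 < e \<Longrightarrow> \<exists>N \<psi>. partition_of_unity A C' M e N \<psi>"
proof -
  obtain M where M: "1 \<le> M" "\<And>e N (x::'a). 0 < e \<Longrightarrow> separated e N \<Longrightarrow>
       finite {z\<in>N. dist z x < (2 * A + 8) * e} \<and> real (card {z\<in>N. dist z x < (2 * A + 8) * e}) \<le> M"
    by (rule separated_card[of "2 * A + 8"], blast)
  obtain CV where CV: "1 \<le> CV"
    "\<And>x y r s. 0 < r \<Longrightarrow> dist x y + s \<le> (2 * A + 1) * r \<Longrightarrow> Vol m x s \<le> CV * Vol m y r"
    using Vol_comparable[of "2 * A + 1"] by metis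
  \<comment> \<open>The factor \<open>2 powr p * M powr p\<close> comes from the increments of a
    quotient, the next \<open>M\<close> counts the neighbours, and \<open>CV\<close> compares their
    volumes.\<close>
  define C' where "C' = max 1 (2 powr p * M powr p * M * C * CV)"
  show ?thesis
  proof (rule that[of C' M])
    show "1 \<le> C'" by (simp add: C'_def)
    show "1 \<le> M" by (rule M)
    fix e :: real assume e: "0 < e"
    obtain N :: "'a set" where N: "is_net e N" using is_net_exists[OF e] .
    then have sN: "separated e N" by (simp add: is_net_def)
    have "\<forall>z. \<exists>\<phi>. \<phi> \<in> JF m p K \<and> continuous_on UNIV \<phi> \<and>
     (\<forall>y. 0 \<le> \<phi> y \<and> \<phi> y \<le> 1) \<and> (\<forall>y. dist z y < e \<longrightarrow> \<phi> y = 1) \<and>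
     (\<forall>y. A * e \<le> dist z y \<longrightarrow> \<phi> y = 0) \<and>
     JGamma m p K \<phi> UNIV \<le> ennreal (C * Vol m z e / \<Upsilon> e)"
      using cap e unfolding cap_cutoffs_def by blast
    from choice[OF this] obtain \<phi> where \<phi>: "\<And>z. \<phi> z \<in> JF m p K" "\<And>z. continuous_on UNIV (\<phi> z)"
      "\<And>z y. 0 \<le> \<phi> z y" "\<And>z y. \<phi> z y \<le> 1" "\<And>z y. dist z y < e \<Longrightarrow> \<phi> z y = 1"
      "\<And>z y. A * e \<le> dist z y \<Longrightarrow> \<phi> z y = 0"
      "\<And>z. JGamma m p K (\<phi> z) UNIV \<le> ennreal (C * Vol m z e / \<Upsilon> e)" by blast
    note [measurable] = JFD(2)[OF \<phi>(1)]
    \<comment> \<open>Cutoff functions that are both nonzero at one point have centres closer than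
      \<open>2 * A * e\<close>.\<close>
    define Nb where "Nb z = {j\<in>N. dist j z < 2 * A * e}" for z
    have Nb: "finite (Nb z)" "real (card (Nb z)) \<le> M" for z
    proof -
      have sub: "Nb z \<subseteq> {j\<in>N. dist j z < (2 * A + 8) * e}"
        using e by (auto simp: Nb_def algebra_simps)
      have f: "finite {j\<in>N. dist j z < (2 * A + 8) * e}" and c: "real (card {j\<in>N. dist j z < (2 * A + 8) * e}) \<le> M"
        using M(2)[OF e sN, of z] by auto
      show "finite (Nb z)" using finite_subset[OF sub f] .
      show "real (card (Nb z)) \<le> M" using card_mono[OF f sub] c by linarith
    qed
    \<comment> \<open>Summing over neighbours of \<open>z\<close> only keeps \<open>\<psi> z\<close> a function of finitely many cutoffs;
      where \<open>\<phi> z\<close> does not vanish, \<open>S z\<close> is the full sum.\<close>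
    define S where "S z x = max 1 (\<Sum>j\<in>Nb z. \<phi> j x)" for z x
    define \<psi> where "\<psi> z x = \<phi> z x / S z x" for z x
    have S1: "1 \<le> S z x" for z x by (simp add: S_def)
    have "partition_of_unity A C' M e N \<psi>"
      unfolding partition_of_unity_def
    proof (intro conjI ballI allI impI)
      fix z assume z: "z \<in> N"
      have zNb: "z \<in> Nb z" using z e A by (simp add: Nb_def)
      show c\<psi>: "continuous_on UNIV (\<psi> z)"
        unfolding \<psi>_def S_def using \<phi>(2)
        by (intro continuous_on_divide continuous_on_max continuous_on_sum continuous_on_const) auto
      then have [measurable]: "\<psi> z \<in> borel_measurable m"
        using borel_measurable_continuous_onI measurable_cong_sets[OF sets_m refl] by blast
      show nn: "0 \<le> \<psi> z x" for x using \<phi>(3) S1[of z x] by (simp add: \<psi>_def)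
      have le: "\<psi> z x \<le> \<phi> z x" for x
        using \<phi>(3)[of z x] S1[of z x] by (simp add: \<psi>_def divide_le_eq mult_le_cancel_left1)
      then show "\<psi> z x \<le> 1" for x using \<phi>(4) order_trans by blast
      show "\<psi> z x = 0" if "A * e \<le> dist z x" for x using \<phi>(6)[OF that] by (simp add: \<psi>_def)
      \<comment> \<open>Quotient rule for differences: the divisors are at least 1, the quotient is
        at most 1, and \<open>max 1\<close> does not increase differences.\<close>
      have d1: "\<bar>\<psi> z x - \<psi> z y\<bar> \<le> 2 * (\<Sum>j\<in>Nb z. \<bar>\<phi> j x - \<phi> j y\<bar>)" for x y
      proof -
        let ?D = "\<Sum>j\<in>Nb z. \<bar>\<phi> j x - \<phi> j y\<bar>"
        have "\<bar>S z x - S z y\<bar> \<le> \<bar>(\<Sum>j\<in>Nb z. \<phi> j x) - (\<Sum>j\<in>Nb z. \<phi> j y)\<bar>" by (simp add: S_def)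
        also have "\<dots> \<le> ?D" by (simp add: sum_subtractf[symmetric])
        finally have s: "\<bar>S z x - S z y\<bar> \<le> ?D" .
        have f: "\<bar>\<phi> z x - \<phi> z y\<bar> \<le> ?D"
          using zNb Nb(1) by (intro member_le_sum) auto
        have "\<psi> z x - \<psi> z y = (\<phi> z x - \<phi> z y) / S z x + \<psi> z y * ((S z y - S z x) / S z x)"
          using S1[of z x] S1[of z y] by (simp add: \<psi>_def field_simps)
        also have "\<bar>\<dots>\<bar> \<le> \<bar>\<phi> z x - \<phi> z y\<bar> / S z x + \<psi> z y * (\<bar>S z y - S z x\<bar> / S z x)"
          using S1[of z x] nn[of y] by (intro order_trans[OF abs_triangle_ineq] add_mono) (simp_all add: abs_mult)
        also have "\<dots> \<le> \<bar>\<phi> z x - \<phi> z y\<bar> / 1 + 1 * (\<bar>S z y - S z x\<bar> / 1)"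
          using S1[of z x] nn[of y] le[of y] \<phi>(4)[of z y]
          by (intro add_mono mult_mono divide_left_mono) auto
        finally show ?thesis using s f by simp
      qed
      have "JGamma m p K (\<psi> z) UNIV \<le> (\<Sum>j\<in>Nb z. ennreal (2 powr p * M powr p) * JGamma m p K (\<phi> j) UNIV)"
      proof (rule JGamma_sum_powr)
        fix x y
        have "\<bar>\<psi> z x - \<psi> z y\<bar> powr p \<le> (2 * \<bar>\<Sum>j\<in>Nb z. \<bar>\<phi> j x - \<phi> j y\<bar>\<bar>) powr p"
          using d1[of x y] p_pos by (intro powr_mono2) auto
        also have "\<dots> \<le> 2 powr p * (M powr p * (\<Sum>j\<in>Nb z. \<bar>\<phi> j x - \<phi> j y\<bar> powr p))"
          using abs_sum_powr_le[OF Nb(1)[of z] Nb(2)[of z] p_pos(2), of "\<lambda>j. \<bar>\<phi> j x - \<phi> j y\<bar>"]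
          by (simp add: powr_mult)
        finally show "\<bar>\<psi> z x - \<psi> z y\<bar> powr p \<le> (\<Sum>j\<in>Nb z. (2 powr p * M powr p) * \<bar>\<phi> j x - \<phi> j y\<bar> powr p)"
          by (simp add: sum_distrib_left mult.assoc)
      qed auto
      also have "\<dots> \<le> (\<Sum>j\<in>Nb z. ennreal (2 powr p * M powr p * (C * (CV * Vol m z e) / \<Upsilon> e)))"
      proof (rule sum_mono)
        fix j assume j: "j \<in> Nb z"
        have "Vol m j e \<le> CV * Vol m z e"
          using j e by (intro CV(2)) (auto simp: Nb_def algebra_simps)
        then have "C * Vol m j e / \<Upsilon> e \<le> C * (CV * Vol m z e) / \<Upsilon> e"
          using C \<Upsilon>_pos[OF e] by (intro divide_right_mono mult_left_mono) auto
        then have "JGamma m p K (\<phi> j) UNIV \<le> ennreal (C * (CV * Vol m z e) / \<Upsilon> e)"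
          using \<phi>(7)[of j] ennreal_leI order_trans by blast
        then have "ennreal (2 powr p * M powr p) * JGamma m p K (\<phi> j) UNIV
          \<le> ennreal (2 powr p * M powr p) * ennreal (C * (CV * Vol m z e) / \<Upsilon> e)"
          by (rule mult_left_mono) simp
        also have "\<dots> = ennreal (2 powr p * M powr p * (C * (CV * Vol m z e) / \<Upsilon> e))"
          by (subst ennreal_mult'[symmetric]) auto
        finally show "ennreal (2 powr p * M powr p) * JGamma m p K (\<phi> j) UNIV
          \<le> ennreal (2 powr p * M powr p * (C * (CV * Vol m z e) / \<Upsilon> e))" .
      qed
      also have "\<dots> = ennreal (real (card (Nb z)) * (2 powr p * M powr p * (C * (CV * Vol m z e) / \<Upsilon> e)))"
        by (simp add: ennreal_mult'[symmetric] ennreal_of_nat_eq_real_of_nat)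
      also have "\<dots> \<le> ennreal (M * (2 powr p * M powr p * (C * (CV * Vol m z e) / \<Upsilon> e)))"
        using C CV(1) \<Upsilon>_pos[OF e] Nb(2)
        by (intro ennreal_leI mult_right_mono mult_nonneg_nonneg divide_nonneg_nonneg) auto
      also have "\<dots> \<le> ennreal (C' * Vol m z e / \<Upsilon> e)"
      proof (rule ennreal_leI)
        have "M * (2 powr p * M powr p * (C * (CV * Vol m z e) / \<Upsilon> e))
            = (2 powr p * M powr p * M * C * CV) * (Vol m z e / \<Upsilon> e)" by simp
        also have "\<dots> \<le> C' * (Vol m z e / \<Upsilon> e)"
          using \<Upsilon>_pos[OF e] by (intro mult_right_mono) (auto simp: C'_def)
        finally show "M * (2 powr p * M powr p * (C * (CV * Vol m z e) / \<Upsilon> e)) \<le> C' * Vol m z e / \<Upsilon> e" by simp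
      qed
      finally show J: "JGamma m p K (\<psi> z) UNIV \<le> ennreal (C' * Vol m z e / \<Upsilon> e)" .
      have "Lp m p (\<psi> z)"
        by (rule Lp_mono(1)[OF p_pos(2) JFD(1)[OF \<phi>(1)[of z]]]) (use le nn \<phi>(3) in auto)
      then show "\<psi> z \<in> JF m p K"
        using J by (auto simp: JF_def order_le_less_trans)
    next
      fix x I assume "finite I \<and> I \<subseteq> N \<and> {z\<in>N. dist z x < A * e} \<subseteq> I"
      then have I: "finite I" "I \<subseteq> N" "{z\<in>N. dist z x < A * e} \<subseteq> I" by auto
      let ?Nx = "{z\<in>N. dist z x < A * e}"
      have fin: "finite ?Nx" using I by (auto intro: finite_subset)
      define s where "s = (\<Sum>j\<in>?Nx. \<phi> j x)"
      have s1: "1 \<le> s"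
      proof -
        obtain z where z: "z \<in> N" "dist z x < e" using N by (auto simp: is_net_def)
        then have "dist z x < A * e" using A e by (smt (verit) mult_le_cancel_right1)
        then have "\<phi> z x \<le> s" unfolding s_def using z fin \<phi>(3) by (intro member_le_sum) auto
        then show ?thesis using \<phi>(5)[OF z(2)] by simp
      qed
      have "S z x = s" if z: "z \<in> ?Nx" for z
      proof -
        have "(\<Sum>j\<in>Nb z. \<phi> j x) = s"
          unfolding s_def
        proof (rule sum.mono_neutral_right[OF Nb(1)])
          show "?Nx \<subseteq> Nb z"
          proof
            fix j assume "j \<in> ?Nx"
            then show "j \<in> Nb z" using z dist_triangle2[of j z x] by (auto simp: Nb_def)
          qed
          show "\<forall>j\<in>Nb z - ?Nx. \<phi> j x = 0"
          proof
            fix j assume "j \<in> Nb z - ?Nx"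
            then have "A * e \<le> dist j x" by (auto simp: Nb_def)
            then show "\<phi> j x = 0" by (rule \<phi>(6))
          qed
        qed
        then show ?thesis using s1 by (simp add: S_def)
      qed
      then have "(\<Sum>z\<in>?Nx. \<psi> z x) = (\<Sum>z\<in>?Nx. \<phi> z x / s)"
        by (intro sum.cong) (auto simp: \<psi>_def)
      also have "\<dots> = 1" using s1 by (simp add: sum_divide_distrib[symmetric] s_def[symmetric])
      finally have one: "(\<Sum>z\<in>?Nx. \<psi> z x) = 1" .
      have "\<psi> z x = 0" if "z \<in> I - ?Nx" for z
      proof -
        have "A * e \<le> dist z x" using that I(2) by auto
        then show ?thesis using \<phi>(6) by (simp add: \<psi>_def)
      qed
      then have "(\<Sum>z\<in>I. \<psi> z x) = (\<Sum>z\<in>?Nx. \<psi> z x)"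
        using I by (intro sum.mono_neutral_right) blast+
      then show "(\<Sum>z\<in>I. \<psi> z x) = 1" using one by simp
    qed (use e N M(2)[OF e sN] in auto)
    then show "\<exists>N \<psi>. partition_of_unity A C' M e N \<psi>" by blast
  qed
qed

end

lemma ennreal_cancel_pos:
  assumes "0 < V" "0 \<le> t" "0 \<le> c" "ennreal (t * V) \<le> ennreal (c * V) * X"
  shows "ennreal t \<le> ennreal c * X"
proof -
  have "ennreal (1 / V) * ennreal (t * V) \<le> ennreal (1 / V) * (ennreal (c * V) * X)"
    using assms(4) by (rule mult_left_mono) simp
  moreover have "ennreal (1 / V) * ennreal (t * V) = ennreal t"
    using assms by (subst ennreal_mult[symmetric]) auto
  moreover have "ennreal (1 / V) * (ennreal (c * V) * X) = ennreal c * X"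
    using assms by (subst mult.assoc[symmetric], subst ennreal_mult[symmetric]) auto
  ultimately show ?thesis by simp
qed

context jump_form
begin

section \<open>Discrete convolution over a net\<close>

text \<open>The discrete convolution of \<open>f\<close> at scale \<open>e\<close>. Summation over
  the indices active at \<open>x\<close> keeps the sum finite.\<close>

definition smoothing :: "real \<Rightarrow> real \<Rightarrow> 'a set \<Rightarrow> ('a \<Rightarrow> 'a \<Rightarrow> real) \<Rightarrow> ('a \<Rightarrow> real) \<Rightarrow> 'a \<Rightarrow> real" where
  "smoothing A e N \<psi> f x = (\<Sum>z\<in>{z\<in>N. dist z x < A * e}. avg f z e * \<psi> z x)"

lemma pouD:
  assumes "partition_of_unity A C M e N \<psi>"
  shows "0 < e" "is_net e N" "separated e N"
    "\<And>x R. R \<le> (2 * A + 8) * e \<Longrightarrow> finite {z\<in>N. dist z x < R}"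
    "\<And>x R. R \<le> (2 * A + 8) * e \<Longrightarrow> real (card {z\<in>N. dist z x < R}) \<le> M"
    "\<And>z. z \<in> N \<Longrightarrow> \<psi> z \<in> JF m p K" "\<And>z. z \<in> N \<Longrightarrow> continuous_on UNIV (\<psi> z)"
    "\<And>z x. z \<in> N \<Longrightarrow> 0 \<le> \<psi> z x" "\<And>z x. z \<in> N \<Longrightarrow> \<psi> z x \<le> 1"
    "\<And>z x. z \<in> N \<Longrightarrow> A * e \<le> dist z x \<Longrightarrow> \<psi> z x = 0"
    "\<And>z. z \<in> N \<Longrightarrow> JGamma m p K (\<psi> z) UNIV \<le> ennreal (C * Vol m z e / \<Upsilon> e)"
    "\<And>x I. finite I \<Longrightarrow> I \<subseteq> N \<Longrightarrow> {z\<in>N. dist z x < A * e} \<subseteq> I \<Longrightarrow> (\<Sum>z\<in>I. \<psi> z x) = 1"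
proof -
  note P = assms[unfolded partition_of_unity_def]
  show e: "0 < e" "is_net e N" using P by auto
  then show "separated e N" by (simp add: is_net_def)
  fix x R assume R: "R \<le> (2 * A + 8) * e"
  have sub: "{z\<in>N. dist z x < R} \<subseteq> {z\<in>N. dist z x < (2 * A + 8) * e}" using R by auto
  have f: "finite {z\<in>N. dist z x < (2 * A + 8) * e}" and c: "real (card {z\<in>N. dist z x < (2 * A + 8) * e}) \<le> M"
    using P by auto
  show "finite {z\<in>N. dist z x < R}" using finite_subset[OF sub f] .
  show "real (card {z\<in>N. dist z x < R}) \<le> M" using card_mono[OF f sub] c by linarith
qed (use assms[unfolded partition_of_unity_def] in auto)

text \<open>For a given pair of points only the indices active at one of them contribute, at most
  \<open>2 * M\<close> in number, so the constant does not depend on the size of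
  \<open>I\<close>.\<close>

lemma pou_sum_energy:
  assumes pou: "partition_of_unity A C M e N \<psi>" and A: "1 \<le> A" and C: "0 \<le> C" and I: "finite I" "I \<subseteq> N"
  shows "JGamma m p K (\<lambda>x. \<Sum>z\<in>I. a z * \<psi> z x) UNIV
    \<le> ennreal ((2 * M) powr p * C / \<Upsilon> e) * (\<Sum>z\<in>I. ennreal (\<bar>a z\<bar> powr p * Vol m z e))"
proof -
  note P = pouD[OF pou]
  have "JGamma m p K (\<lambda>x. \<Sum>z\<in>I. a z * \<psi> z x) UNIV
    \<le> (\<Sum>z\<in>I. ennreal ((2 * M) powr p * \<bar>a z\<bar> powr p) * JGamma m p K (\<psi> z) UNIV)"
  proof (rule JGamma_sum_powr)
    show "\<psi> z \<in> borel_measurable m" if "z \<in> I" for z using JFD(2)[OF P(6)] that I by auto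
    fix x y
    define T where "T = I \<inter> ({z\<in>N. dist z x < A * e} \<union> {z\<in>N. dist z y < A * e})"
    have Ae: "A * e \<le> (2 * A + 8) * e" using A P(1) by (intro mult_right_mono) auto
    have T: "finite T" using I by (simp add: T_def)
    have "card T \<le> card ({z\<in>N. dist z x < A * e} \<union> {z\<in>N. dist z y < A * e})"
      unfolding T_def using P(4)[OF Ae] by (intro card_mono) auto
    also have "\<dots> \<le> card {z\<in>N. dist z x < A * e} + card {z\<in>N. dist z y < A * e}" by (rule card_Un_le)
    finally have cT: "real (card T) \<le> 2 * M" using P(5)[OF Ae, of x] P(5)[OF Ae, of y] by linarith
    have "(\<Sum>z\<in>I. a z * \<psi> z x) - (\<Sum>z\<in>I. a z * \<psi> z y) = (\<Sum>z\<in>I. a z * (\<psi> z x - \<psi> z y))"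
      by (simp add: sum_subtractf right_diff_distrib)
    also have "\<dots> = (\<Sum>z\<in>T. a z * (\<psi> z x - \<psi> z y))"
    proof (intro sum.mono_neutral_right ballI)
      fix z assume "z \<in> I - T"
      then have "z \<in> N" "A * e \<le> dist z x" "A * e \<le> dist z y" using I by (auto simp: T_def)
      then show "a z * (\<psi> z x - \<psi> z y) = 0" using P(10) by simp
    qed (use I in \<open>auto simp: T_def\<close>)
    finally have "\<bar>(\<Sum>z\<in>I. a z * \<psi> z x) - (\<Sum>z\<in>I. a z * \<psi> z y)\<bar> powr p
        \<le> (2 * M) powr p * (\<Sum>z\<in>T. \<bar>a z * (\<psi> z x - \<psi> z y)\<bar> powr p)"
      using abs_sum_powr_le[OF T cT p_pos(2)] by simp
    also have "\<dots> \<le> (2 * M) powr p * (\<Sum>z\<in>I. \<bar>a z * (\<psi> z x - \<psi> z y)\<bar> powr p)"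
      using I by (intro mult_left_mono sum_mono2) (auto simp: T_def)
    finally show "\<bar>(\<Sum>z\<in>I. a z * \<psi> z x) - (\<Sum>z\<in>I. a z * \<psi> z y)\<bar> powr p
        \<le> (\<Sum>z\<in>I. ((2 * M) powr p * \<bar>a z\<bar> powr p) * \<bar>\<psi> z x - \<psi> z y\<bar> powr p)"
      by (simp add: abs_mult powr_mult sum_distrib_left mult.assoc)
  qed auto
  also have "\<dots> \<le> (\<Sum>z\<in>I. ennreal ((2 * M) powr p * C / \<Upsilon> e) * ennreal (\<bar>a z\<bar> powr p * Vol m z e))"
  proof (rule sum_mono)
    fix z assume z: "z \<in> I"
    have "ennreal ((2 * M) powr p * \<bar>a z\<bar> powr p) * JGamma m p K (\<psi> z) UNIV
       \<le> ennreal ((2 * M) powr p * \<bar>a z\<bar> powr p) * ennreal (C * Vol m z e / \<Upsilon> e)"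
      using P(11) z I by (intro mult_left_mono) auto
    also have "\<dots> = ennreal ((2 * M) powr p * C / \<Upsilon> e) * ennreal (\<bar>a z\<bar> powr p * Vol m z e)"
      using C \<Upsilon>_pos[OF P(1)] by (subst (1 2) ennreal_mult[symmetric]) (auto simp: mult_ac)
    finally show "ennreal ((2 * M) powr p * \<bar>a z\<bar> powr p) * JGamma m p K (\<psi> z) UNIV
       \<le> ennreal ((2 * M) powr p * C / \<Upsilon> e) * ennreal (\<bar>a z\<bar> powr p * Vol m z e)" .
  qed
  finally show ?thesis by (simp only: sum_distrib_left)
qed

lemma pou_sum_Lp:
  assumes pou: "partition_of_unity A C M e N \<psi>" and A: "1 \<le> A" and I: "finite I" "I \<subseteq> N"
  shows "(\<integral>\<^sup>+x. ennreal (\<bar>\<Sum>z\<in>I. a z * \<psi> z x\<bar> powr p) \<partial>m)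
    \<le> ennreal (M powr p) * (\<Sum>z\<in>I. ennreal (\<bar>a z\<bar> powr p * Vol m z (A * e)))"
proof -
  note P = pouD[OF pou]
  have "(\<integral>\<^sup>+x. ennreal (\<bar>\<Sum>z\<in>I. a z * \<psi> z x\<bar> powr p) \<partial>m)
    \<le> (\<integral>\<^sup>+x. (\<Sum>z\<in>I. ennreal (M powr p * \<bar>a z\<bar> powr p) * indicator (ball z (A * e)) x) \<partial>m)"
  proof (rule nn_integral_mono)
    fix x
    define T where "T = I \<inter> {z\<in>N. dist z x < A * e}"
    have Ae: "A * e \<le> (2 * A + 8) * e" using A P(1) by (intro mult_right_mono) auto
    have T: "finite T" using I by (simp add: T_def)
    have "card T \<le> card {z\<in>N. dist z x < A * e}"
      unfolding T_def using P(4)[OF Ae] by (intro card_mono) auto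
    then have cT: "real (card T) \<le> M" using P(5)[OF Ae, of x] by linarith
    have "(\<Sum>z\<in>I. a z * \<psi> z x) = (\<Sum>z\<in>T. a z * \<psi> z x)"
    proof (intro sum.mono_neutral_right ballI)
      fix z assume "z \<in> I - T"
      then have "z \<in> N" "A * e \<le> dist z x" using I by (auto simp: T_def)
      then show "a z * \<psi> z x = 0" using P(10) by simp
    qed (use I in \<open>auto simp: T_def\<close>)
    then have "\<bar>\<Sum>z\<in>I. a z * \<psi> z x\<bar> powr p \<le> M powr p * (\<Sum>z\<in>T. \<bar>a z * \<psi> z x\<bar> powr p)"
      using abs_sum_powr_le[OF T cT p_pos(2)] by simp
    also have "\<dots> \<le> M powr p * (\<Sum>z\<in>T. \<bar>a z\<bar> powr p)"
    proof (intro mult_left_mono sum_mono powr_mono2)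
      fix z assume "z \<in> T"
      then show "\<bar>a z * \<psi> z x\<bar> \<le> \<bar>a z\<bar>"
        using P(8,9)[of z x] by (auto simp: T_def abs_mult mult_left_le)
    qed (use p_pos in auto)
    finally have "ennreal (\<bar>\<Sum>z\<in>I. a z * \<psi> z x\<bar> powr p) \<le> ennreal (\<Sum>z\<in>T. M powr p * \<bar>a z\<bar> powr p)"
      by (intro ennreal_leI) (simp add: sum_distrib_left)
    also have "\<dots> = (\<Sum>z\<in>T. ennreal (M powr p * \<bar>a z\<bar> powr p) * indicator (ball z (A * e)) x)"
    proof -
      have "(\<Sum>z\<in>T. ennreal (M powr p * \<bar>a z\<bar> powr p) * indicator (ball z (A * e)) x)
          = (\<Sum>z\<in>T. ennreal (M powr p * \<bar>a z\<bar> powr p))"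
        by (intro sum.cong refl) (auto simp: T_def)
      then show ?thesis by simp
    qed
    also have "\<dots> \<le> (\<Sum>z\<in>I. ennreal (M powr p * \<bar>a z\<bar> powr p) * indicator (ball z (A * e)) x)"
      using I by (intro sum_mono2) (auto simp: T_def)
    finally show "ennreal (\<bar>\<Sum>z\<in>I. a z * \<psi> z x\<bar> powr p)
      \<le> (\<Sum>z\<in>I. ennreal (M powr p * \<bar>a z\<bar> powr p) * indicator (ball z (A * e)) x)" .
  qed
  also have "\<dots> = (\<Sum>z\<in>I. \<integral>\<^sup>+x. ennreal (M powr p * \<bar>a z\<bar> powr p) * indicator (ball z (A * e)) x \<partial>m)"
    by (rule nn_integral_sum) simp
  also have "\<dots> = (\<Sum>z\<in>I. ennreal (M powr p) * ennreal (\<bar>a z\<bar> powr p * Vol m z (A * e)))"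
    by (intro sum.cong refl, subst nn_integral_cmult_indicator) (auto simp: emeasure_ball ennreal_mult mult.assoc)
  finally show ?thesis by (simp only: sum_distrib_left)
qed

text \<open>The constant \<open>D\<close> depends on \<open>e\<close>, which is harmless: it serves
  to cut off the series for one fixed net.\<close>

lemma pou_sum_nrm:
  assumes pou: "partition_of_unity A C M e N \<psi>" and A: "1 \<le> A" and C: "0 \<le> C"
  obtains D where "0 \<le> D"
    "\<And>I a. finite I \<Longrightarrow> I \<subseteq> N \<Longrightarrow> nrm (\<lambda>x. \<Sum>z\<in>I. a z * \<psi> z x)
        \<le> ennreal D * (\<Sum>z\<in>I. ennreal (\<bar>a z\<bar> powr p * Vol m z e))"
proof -
  note P = pouD[OF pou]
  obtain CV where CV: "1 \<le> CV"
    "\<And>x y r s. 0 < r \<Longrightarrow> dist x y + s \<le> A * r \<Longrightarrow> Vol m x s \<le> CV * Vol m y r"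
    using Vol_comparable[of A] by metis
  let ?D1 = "(2 * M) powr p * C / \<Upsilon> e" and ?D2 = "M powr p * CV"
  have D: "0 \<le> ?D1" "0 \<le> ?D2" using C CV(1) \<Upsilon>_pos[OF P(1)] by auto
  show ?thesis
  proof (rule that[of "?D1 + ?D2"])
    show "0 \<le> ?D1 + ?D2" using D by simp
    fix I a assume I: "finite I" "I \<subseteq> N"
    let ?s = "\<Sum>z\<in>I. ennreal (\<bar>a z\<bar> powr p * Vol m z e)"
    have "(\<integral>\<^sup>+x. ennreal (\<bar>\<Sum>z\<in>I. a z * \<psi> z x\<bar> powr p) \<partial>m)
        \<le> ennreal (M powr p) * (\<Sum>z\<in>I. ennreal CV * ennreal (\<bar>a z\<bar> powr p * Vol m z e))"
    proof (rule order_trans[OF pou_sum_Lp[OF pou A I]], intro mult_left_mono sum_mono)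
      fix z
      have "Vol m z (A * e) \<le> CV * Vol m z e" using P(1) by (intro CV(2)) auto
      then have "\<bar>a z\<bar> powr p * Vol m z (A * e) \<le> \<bar>a z\<bar> powr p * (CV * Vol m z e)"
        by (intro mult_left_mono) auto
      then have "ennreal (\<bar>a z\<bar> powr p * Vol m z (A * e)) \<le> ennreal (CV * (\<bar>a z\<bar> powr p * Vol m z e))"
        by (intro ennreal_leI) (simp add: mult_ac)
      then show "ennreal (\<bar>a z\<bar> powr p * Vol m z (A * e)) \<le> ennreal CV * ennreal (\<bar>a z\<bar> powr p * Vol m z e)"
        using CV(1) by (simp add: ennreal_mult)
    qed auto
    also have "\<dots> = ennreal ?D2 * ?s"
      using CV(1) by (simp add: sum_distrib_left[symmetric] ennreal_mult mult.assoc del: sum_ennreal)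
    finally have "nrm (\<lambda>x. \<Sum>z\<in>I. a z * \<psi> z x) \<le> ennreal ?D1 * ?s + ennreal ?D2 * ?s"
      unfolding nrm_def using pou_sum_energy[OF pou A C I] by (intro add_mono)
    then show "nrm (\<lambda>x. \<Sum>z\<in>I. a z * \<psi> z x) \<le> ennreal (?D1 + ?D2) * ?s"
      using D by (simp add: distrib_right del: sum_ennreal)
  qed
qed

lemma smoothing_eq:
  assumes pou: "partition_of_unity A C M e N \<psi>"
    and I: "finite I" "I \<subseteq> N" "{z\<in>N. dist z x < A * e} \<subseteq> I"
  shows "smoothing A e N \<psi> f x = (\<Sum>z\<in>I. avg f z e * \<psi> z x)"
  unfolding smoothing_def
proof (intro sum.mono_neutral_left ballI)
  fix z assume "z \<in> I - {z\<in>N. dist z x < A * e}"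
  then have "z \<in> N" "A * e \<le> dist z x" using I by auto
  then show "avg f z e * \<psi> z x = 0" using pouD(10)[OF pou] by simp
qed (use I in auto)

text \<open>At each point the partial sums are eventually constant. This gives measurability of the
  smoothing and the pointwise limit for Fatou's lemma.\<close>

lemma smoothing_limit:
  assumes pou: "partition_of_unity A C M e N \<psi>"
  shows "(\<lambda>n. \<Sum>z\<in>{z\<in>N. dist z o' < real n}. avg f z e * \<psi> z x) \<longlonglongrightarrow> smoothing A e N \<psi> f x"
proof (rule tendsto_eventually)
  note P = pouD[OF pou]
  obtain n0 :: nat where n0: "dist o' x + A * e < n0" using reals_Archimedean2 by blast
  have "(\<Sum>z\<in>{z\<in>N. dist z o' < real n}. avg f z e * \<psi> z x) = smoothing A e N \<psi> f x" if "n0 \<le> n" for n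
  proof (rule smoothing_eq[OF pou, symmetric])
    show "finite {z\<in>N. dist z o' < real n}" by (rule separated_finite[OF P(1,3)])
    show "{z\<in>N. dist z x < A * e} \<subseteq> {z\<in>N. dist z o' < real n}"
    proof
      fix z assume "z \<in> {z\<in>N. dist z x < A * e}"
      then show "z \<in> {z\<in>N. dist z o' < real n}"
        using n0 that dist_triangle[of z o' x] by (auto simp: dist_commute)
    qed
  qed auto
  then show "\<forall>\<^sub>F n in sequentially. (\<Sum>z\<in>{z\<in>N. dist z o' < real n}. avg f z e * \<psi> z x) = smoothing A e N \<psi> f x"
    by (auto simp: eventually_sequentially)
qed

lemma pou_sum_JF:
  assumes pou: "partition_of_unity A C M e N \<psi>" and I: "I \<subseteq> N"
  shows "(\<lambda>x. \<Sum>z\<in>I. a z * \<psi> z x) \<in> JF m p K"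
  using pouD(6)[OF pou] I by (intro JF_sum JF_cmult) auto

lemma smoothing_measurable:
  assumes pou: "partition_of_unity A C M e N \<psi>"
  shows "smoothing A e N \<psi> f \<in> borel_measurable m"
proof (rule borel_measurable_LIMSEQ_real)
  show "(\<lambda>n. \<Sum>z\<in>{z\<in>N. dist z undefined < real n}. avg f z e * \<psi> z x) \<longlonglongrightarrow> smoothing A e N \<psi> f x" for x
    by (rule smoothing_limit[OF pou])
  show "(\<lambda>x. \<Sum>z\<in>{z\<in>N. dist z undefined < real n}. avg f z e * \<psi> z x) \<in> borel_measurable m" for n
    by (rule JFD(2)[OF pou_sum_JF[OF pou]]) auto
qed

text \<open>The smoothing itself need not have compact support, its partial sums do. Differences of
  two partial sums are controlled by the L^p mass of \<open>f\<close> far away, and Fatou's lemma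
  extends this to the whole tail.\<close>

lemma smoothing_tail:
  assumes pou: "partition_of_unity A C M e N \<psi>" and A: "1 \<le> A" and C: "0 \<le> C"
    and f: "f \<in> JF m p K" and \<eta>: "0 < \<eta>"
  obtains n :: nat where
    "nrm (\<lambda>x. (\<Sum>z\<in>{z\<in>N. dist z o' < real n}. avg f z e * \<psi> z x) - smoothing A e N \<psi> f x) < \<eta>"
proof -
  note P = pouD[OF pou]
  have [measurable]: "f \<in> borel_measurable m" using JFD(2)[OF f] .
  obtain D where D: "0 \<le> D"
    "\<And>I a. finite I \<Longrightarrow> I \<subseteq> N \<Longrightarrow> nrm (\<lambda>x. \<Sum>z\<in>I. a z * \<psi> z x)
        \<le> ennreal D * (\<Sum>z\<in>I. ennreal (\<bar>a z\<bar> powr p * Vol m z e))"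
    using pou_sum_nrm[OF pou A C] by blast
  define I where "I n = {z\<in>N. dist z o' < real n}" for n :: nat
  have fin: "finite (I n)" and IN: "I n \<subseteq> N" for n
    using separated_finite[OF P(1,3)] by (auto simp: I_def)
  define F where "F n x = (\<Sum>z\<in>I n. avg f z e * \<psi> z x)" for n x
  have FJ: "F n \<in> JF m p K" for n
    unfolding F_def[abs_def] by (rule pou_sum_JF[OF pou IN])
  have [measurable]: "F n \<in> borel_measurable m" for n by (rule JFD(2)[OF FJ])
  \<comment> \<open>Averages over balls with centres at distance at least \<open>n\<close> from
    \<open>o'\<close> see \<open>f\<close> only at distance at least \<open>n - e\<close>.\<close>
  define \<tau> where "\<tau> n = (\<integral>\<^sup>+x. ennreal (\<bar>f x\<bar> powr p) * indicator {x. real n - e \<le> dist o' x} x \<partial>m)" for n :: nat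
  have cl: "closed {x. c \<le> dist o' x}" for c by (intro closed_Collect_le continuous_intros)
  have [measurable]: "{x. c \<le> dist o' x} \<in> sets borel" for c using cl by (rule borel_closed)
  have tail: "nrm (\<lambda>x. F n x - F k x) \<le> ennreal D * (ennreal (2 powr p) * (ennreal M * \<tau> n))" if nk: "n \<le> k" for n k
  proof -
    have sub: "I n \<subseteq> I k" using nk by (auto simp: I_def)
    have "F n x - F k x = (\<Sum>z\<in>I k - I n. (- avg f z e) * \<psi> z x)" for x
      using sum.subset_diff[OF sub fin, of "\<lambda>z. avg f z e * \<psi> z x"] by (simp add: F_def sum_negf)
    then have "nrm (\<lambda>x. F n x - F k x) \<le> ennreal D * (\<Sum>z\<in>I k - I n. ennreal (\<bar>- avg f z e\<bar> powr p * Vol m z e))"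
      using D(2)[of "I k - I n" "\<lambda>z. - avg f z e"] fin IN by auto
    also have "\<dots> \<le> ennreal D * (\<Sum>z\<in>I k - I n. ennreal (2 powr p) * (\<integral>\<^sup>+y\<in>ball z e. ennreal (\<bar>f y\<bar> powr p) \<partial>m))"
      using avg_diff_powr_le[OF JFD(1)[OF f] p_pos(3) P(1), of _ 0] by (intro mult_left_mono sum_mono) auto
    also have "(\<Sum>z\<in>I k - I n. ennreal (2 powr p) * (\<integral>\<^sup>+y\<in>ball z e. ennreal (\<bar>f y\<bar> powr p) \<partial>m))
        = ennreal (2 powr p) * (\<integral>\<^sup>+y. (\<Sum>z\<in>I k - I n. ennreal (\<bar>f y\<bar> powr p) * indicator (ball z e) y) \<partial>m)"
      by (subst nn_integral_sum) (auto simp: sum_distrib_left)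
    also have "\<dots> \<le> ennreal (2 powr p) * (\<integral>\<^sup>+y. ennreal M * (ennreal (\<bar>f y\<bar> powr p) * indicator {x. real n - e \<le> dist o' x} y) \<partial>m)"
    proof (intro mult_left_mono nn_integral_mono)
      fix y
      have ee: "e \<le> (2 * A + 8) * e" using A P(1) by (simp add: mult_le_cancel_right1)
      show "(\<Sum>z\<in>I k - I n. ennreal (\<bar>f y\<bar> powr p) * indicator (ball z e) y)
         \<le> ennreal M * (ennreal (\<bar>f y\<bar> powr p) * indicator {x. real n - e \<le> dist o' x} y)"
      proof (cases "real n - e \<le> dist o' y")
        case False
        have "indicator (ball z e) y = (0::ennreal)" if "z \<in> I k - I n" for z
          using False that dist_triangle[of z o' y] by (auto simp: I_def dist_commute indicator_def)
        then show ?thesis by simp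
      next
        case True
        have "(\<Sum>z\<in>I k - I n. ennreal (\<bar>f y\<bar> powr p) * indicator (ball z e) y)
            = (\<Sum>z\<in>(I k - I n) \<inter> {z\<in>N. dist z y < e}. ennreal (\<bar>f y\<bar> powr p))"
          using fin IN by (intro sum.mono_neutral_cong_right) (auto simp: indicator_def)
        also have "\<dots> \<le> (\<Sum>z\<in>{z\<in>N. dist z y < e}. ennreal (\<bar>f y\<bar> powr p))"
          using P(4)[OF ee, of y] by (intro sum_mono2) auto
        also have "\<dots> = ennreal (real (card {z\<in>N. dist z y < e})) * ennreal (\<bar>f y\<bar> powr p)"
          by (simp add: ennreal_of_nat_eq_real_of_nat)
        also have "\<dots> \<le> ennreal M * ennreal (\<bar>f y\<bar> powr p)"
          using P(5)[OF ee, of y] by (intro mult_right_mono ennreal_leI) auto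
        finally show ?thesis using True by simp
      qed
    qed auto
    also have "\<dots> = ennreal (2 powr p) * (ennreal M * \<tau> n)"
      unfolding \<tau>_def by (subst nn_integral_cmult) auto
    finally show ?thesis by (simp add: mult_left_mono)
  qed
  have "\<tau> \<longlonglongrightarrow> (\<integral>\<^sup>+x. 0 \<partial>m)"
    unfolding \<tau>_def[abs_def]
  proof (rule nn_integral_dominated_convergence[where w = "\<lambda>x. ennreal (\<bar>f x\<bar> powr p)"])
    show "(\<integral>\<^sup>+x. ennreal (\<bar>f x\<bar> powr p) \<partial>m) < \<infinity>"
      using JFD(1)[OF f] Lp_iff_nn[of f m p] by auto
    show "AE x in m. (\<lambda>n. ennreal (\<bar>f x\<bar> powr p) * indicator {x. real n - e \<le> dist o' x} x) \<longlonglongrightarrow> 0"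
    proof (rule AE_I2)
      fix x
      obtain n0 :: nat where "dist o' x + e < n0" using reals_Archimedean2 by blast
      then have "\<forall>\<^sub>F n in sequentially. ennreal (\<bar>f x\<bar> powr p) * indicator {x. real n - e \<le> dist o' x} x = 0"
        by (auto simp: eventually_sequentially indicator_def intro!: exI[of _ n0])
      then show "(\<lambda>n. ennreal (\<bar>f x\<bar> powr p) * indicator {x. real n - e \<le> dist o' x} x) \<longlonglongrightarrow> 0"
        by (rule tendsto_eventually)
    qed
  qed (auto simp: indicator_def)
  \<comment> \<open>The leading 2 anticipates the loss in \<open>nrm_Fatou\<close>.\<close>
  then have "(\<lambda>n. 2 * (ennreal D * (ennreal (2 powr p) * (ennreal M * \<tau> n)))) \<longlonglongrightarrow> 2 * (ennreal D * (ennreal (2 powr p) * (ennreal M * 0)))"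
    by (intro ennreal_tendsto_cmult) (auto simp: ennreal_mult_eq_top_iff)
  then have "(\<lambda>n. 2 * (ennreal D * (ennreal (2 powr p) * (ennreal M * \<tau> n)))) \<longlonglongrightarrow> 0" by simp
  from order_tendstoD(2)[OF this \<eta>] obtain n where n: "2 * (ennreal D * (ennreal (2 powr p) * (ennreal M * \<tau> n))) < \<eta>"
    by (auto simp: eventually_sequentially)
  have "nrm (\<lambda>x. F n x - smoothing A e N \<psi> f x) \<le> 2 * (ennreal D * (ennreal (2 powr p) * (ennreal M * \<tau> n)))"
  proof (rule nrm_Fatou[where h = "\<lambda>k x. F n x - F k x" and n = n])
    have "(\<lambda>k. F n x - F k x) \<longlonglongrightarrow> F n x - smoothing A e N \<psi> f x" for x
      using smoothing_limit[OF pou, where o' = o' and f = f and x = x] by (intro tendsto_intros) (simp add: F_def I_def)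
    then show "AE x in m. (\<lambda>k. F n x - F k x) \<longlonglongrightarrow> F n x - smoothing A e N \<psi> f x" by simp
    show "(\<lambda>x. F n x - smoothing A e N \<psi> f x) \<in> borel_measurable m"
      using smoothing_measurable[OF pou, of f] by simp
  qed (use tail in auto)
  then have "nrm (\<lambda>x. F n x - smoothing A e N \<psi> f x) < \<eta>" using n by (rule le_less_trans)
  then show ?thesis unfolding F_def I_def by (rule that)
qed

end

lemma ennreal_mult_assoc:
  assumes "0 \<le> a" "0 \<le> b"
  shows "ennreal a * (ennreal b * X) = ennreal (a * b) * X"
  using assms by (simp add: ennreal_mult mult.assoc)

context jump_form
begin

section \<open>Approximation error of the smoothing\<close>

text \<open>The difference is an average of increments from \<open>x\<close> to points of
  \<open>ball z e\<close>. These jumps are shorter than \<open>(A + 4) * e\<close>, hence within the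
  truncation radius, and \<open>K_lower\<close> inserts the kernel at the cost of
  \<open>Vol m z e * \<Upsilon> e\<close>, whose volume cancels against that of the average.\<close>

lemma avg_diff_le_jump:
  assumes A: "1 \<le> A"
  obtains C where "1 \<le> C"
    "\<And>f e x z. \<lbrakk>f \<in> JF m p K; 0 < e; dist z x < (A + 3) * e\<rbrakk> \<Longrightarrow>
       ennreal (\<bar>avg f z e - f x\<bar> powr p)
       \<le> ennreal (C * \<Upsilon> e) * (\<integral>\<^sup>+y. ennreal (\<bar>f x - f y\<bar> powr p * trunc ((A + 5) * e) K x y) \<partial>m)"
proof -
  obtain C where C: "1 \<le> C"
    "\<And>x y z r. \<lbrakk>0 < r; x \<noteq> y; dist x y \<le> (A + 5) * r; dist x z \<le> (A + 5) * r\<rbrakk> \<Longrightarrow>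
       1 \<le> C * (Vol m z r * \<Upsilon> r) * K x y"
    using K_lower[of "A + 5"] by metis
  show ?thesis
  proof (rule that[of "2 powr p * C"])
    have "1 \<le> 2 powr p" using p_pos by (intro ge_one_powr_ge_zero) auto
    then have "1 * 1 \<le> 2 powr p * C" using C(1) by (intro mult_mono) auto
    then show "1 \<le> 2 powr p * C" by simp
    fix f e and x z :: 'a assume f: "f \<in> JF m p K" and e: "0 < e" and xz: "dist z x < (A + 3) * e"
    note [measurable] = JFD(2)[OF f]
    let ?T = "trunc ((A + 5) * e) K"
    note [measurable] = jump_integrand_measurable[OF kernel_measurable_trunc(1)[OF K_meas] JFD(2)[OF f]]
    have V: "0 < Vol m z e" "0 < \<Upsilon> e" using e by (auto intro: Vol_pos \<Upsilon>_pos)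
    have "ennreal (\<bar>avg f z e - f x\<bar> powr p * Vol m z e)
       \<le> ennreal (2 powr p) * (\<integral>\<^sup>+y\<in>ball z e. ennreal (\<bar>f y - f x\<bar> powr p) \<partial>m)"
      by (rule avg_diff_powr_le[OF JFD(1)[OF f] p_pos(3) e])
    also have "\<dots> \<le> ennreal (2 powr p) * (\<integral>\<^sup>+y. ennreal (C * (Vol m z e * \<Upsilon> e)) * ennreal (\<bar>f x - f y\<bar> powr p * ?T x y) \<partial>m)"
    proof (intro mult_left_mono nn_integral_mono)
      fix y
      show "ennreal (\<bar>f y - f x\<bar> powr p) * indicator (ball z e) y
         \<le> ennreal (C * (Vol m z e * \<Upsilon> e)) * ennreal (\<bar>f x - f y\<bar> powr p * ?T x y)"
      proof (cases "y \<in> ball z e \<and> x \<noteq> y")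
        case False
        then show ?thesis by auto
      next
        case True
        have "dist x y < (A + 5) * e"
          using True xz e dist_triangle3[of x y z] by (simp add: algebra_simps)
        moreover have "dist x z \<le> (A + 5) * e"
          using xz e by (simp add: algebra_simps dist_commute)
        ultimately have "1 \<le> C * (Vol m z e * \<Upsilon> e) * ?T x y"
          using C(2)[of e x y z] True e by (simp add: trunc_def)
        then have "\<bar>f x - f y\<bar> powr p * 1 \<le> \<bar>f x - f y\<bar> powr p * (C * (Vol m z e * \<Upsilon> e) * ?T x y)"
          by (intro mult_left_mono) auto
        then have "ennreal (\<bar>f y - f x\<bar> powr p) \<le> ennreal (C * (Vol m z e * \<Upsilon> e) * (\<bar>f x - f y\<bar> powr p * ?T x y))"
          by (intro ennreal_leI) (simp add: mult_ac abs_minus_commute)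
        also have "\<dots> = ennreal (C * (Vol m z e * \<Upsilon> e)) * ennreal (\<bar>f x - f y\<bar> powr p * ?T x y)"
          using C(1) V by (intro ennreal_mult') auto
        finally show ?thesis using True by simp
      qed
    qed auto
    also have "\<dots> = ennreal (2 powr p) * (ennreal (C * (Vol m z e * \<Upsilon> e)) * (\<integral>\<^sup>+y. ennreal (\<bar>f x - f y\<bar> powr p * ?T x y) \<partial>m))"
      by (subst nn_integral_cmult) auto
    also have "\<dots> = ennreal ((2 powr p * C * \<Upsilon> e) * Vol m z e) * (\<integral>\<^sup>+y. ennreal (\<bar>f x - f y\<bar> powr p * ?T x y) \<partial>m)"
    proof -
      have e: "2 powr p * (C * (Vol m z e * \<Upsilon> e)) = (2 powr p * C * \<Upsilon> e) * Vol m z e" by simp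
      have "0 \<le> C * (Vol m z e * \<Upsilon> e)" using C(1) V by simp
      then show ?thesis by (subst ennreal_mult_assoc) (simp_all only: e powr_ge_zero)
    qed
    finally have est: "ennreal (\<bar>avg f z e - f x\<bar> powr p * Vol m z e)
       \<le> ennreal ((2 powr p * C * \<Upsilon> e) * Vol m z e) * (\<integral>\<^sup>+y. ennreal (\<bar>f x - f y\<bar> powr p * ?T x y) \<partial>m)" .
    show "ennreal (\<bar>avg f z e - f x\<bar> powr p)
       \<le> ennreal (2 powr p * C * \<Upsilon> e) * (\<integral>\<^sup>+y. ennreal (\<bar>f x - f y\<bar> powr p * ?T x y) \<partial>m)"
      by (rule ennreal_cancel_pos[OF V(1) _ _ est]) (use C(1) V in auto)
  qed
qed

text \<open>As the partition sums to 1, the error at \<open>x\<close> is a combination of the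
  boundedly many differences between \<open>f x\<close> and the averages nearby.\<close>

lemma smoothing_Lp_error:
  assumes A: "1 \<le> A" and M: "1 \<le> M"
  obtains D where "0 \<le> D"
    "\<And>C e N \<psi> f. \<lbrakk>partition_of_unity A C M e N \<psi>; f \<in> JF m p K\<rbrakk> \<Longrightarrow>
       (\<integral>\<^sup>+x. ennreal (\<bar>f x - smoothing A e N \<psi> f x\<bar> powr p) \<partial>m)
       \<le> ennreal (D * \<Upsilon> e) * JGamma m p (trunc ((A + 5) * e) K) f UNIV"
proof -
  obtain C0 where C0: "1 \<le> C0"
    "\<And>f e x z. \<lbrakk>f \<in> JF m p K; 0 < e; dist z x < (A + 3) * e\<rbrakk> \<Longrightarrow>
       ennreal (\<bar>avg f z e - f x\<bar> powr p)
       \<le> ennreal (C0 * \<Upsilon> e) * (\<integral>\<^sup>+y. ennreal (\<bar>f x - f y\<bar> powr p * trunc ((A + 5) * e) K x y) \<partial>m)"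
    by (rule avg_diff_le_jump[OF A]) blast
  show ?thesis
  proof (rule that[of "M powr p * M * C0"])
    show "0 \<le> M powr p * M * C0" using M C0(1) by simp
    fix C e N \<psi> f assume pou: "partition_of_unity A C M e N \<psi>" and f: "f \<in> JF m p K"
    note P = pouD[OF pou]
    let ?T = "trunc ((A + 5) * e) K"
    let ?J = "\<lambda>x. \<integral>\<^sup>+y. ennreal (\<bar>f x - f y\<bar> powr p * ?T x y) \<partial>m"
    note [measurable] = jump_integrand_measurable[OF kernel_measurable_trunc(1)[OF K_meas] JFD(2)[OF f]]
    have U: "0 < \<Upsilon> e" using P(1) by (rule \<Upsilon>_pos)
    have "(\<integral>\<^sup>+x. ennreal (\<bar>f x - smoothing A e N \<psi> f x\<bar> powr p) \<partial>m)
       \<le> (\<integral>\<^sup>+x. ennreal (M powr p * M * C0 * \<Upsilon> e) * ?J x \<partial>m)"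
    proof (rule nn_integral_mono)
      fix x
      define I where "I = {z\<in>N. dist z x < A * e}"
      have Ae: "A * e \<le> (2 * A + 8) * e" using A P(1) by (intro mult_right_mono) auto
      have I: "finite I" "real (card I) \<le> M" "I \<subseteq> N" using P(4,5)[OF Ae] by (auto simp: I_def)
      have one: "(\<Sum>z\<in>I. \<psi> z x) = 1" by (rule P(12)) (use I in \<open>auto simp: I_def\<close>)
      have "f x - smoothing A e N \<psi> f x = f x * (\<Sum>z\<in>I. \<psi> z x) - (\<Sum>z\<in>I. avg f z e * \<psi> z x)"
        unfolding one by (simp add: smoothing_def I_def)
      also have "\<dots> = (\<Sum>z\<in>I. (f x - avg f z e) * \<psi> z x)"
        by (simp add: sum_distrib_left sum_subtractf left_diff_distrib)
      finally have "\<bar>f x - smoothing A e N \<psi> f x\<bar> powr p \<le> M powr p * (\<Sum>z\<in>I. \<bar>(f x - avg f z e) * \<psi> z x\<bar> powr p)"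
        using abs_sum_powr_le[OF I(1,2) p_pos(2)] by simp
      also have "\<dots> \<le> M powr p * (\<Sum>z\<in>I. \<bar>avg f z e - f x\<bar> powr p)"
      proof (intro mult_left_mono sum_mono powr_mono2)
        fix z assume "z \<in> I"
        then have "0 \<le> \<psi> z x" "\<psi> z x \<le> 1" using P(8,9) I by auto
        then show "\<bar>(f x - avg f z e) * \<psi> z x\<bar> \<le> \<bar>avg f z e - f x\<bar>"
          by (simp add: abs_mult abs_minus_commute mult_left_le)
      qed (use p_pos in auto)
      finally have "ennreal (\<bar>f x - smoothing A e N \<psi> f x\<bar> powr p)
          \<le> ennreal (M powr p) * (\<Sum>z\<in>I. ennreal (\<bar>avg f z e - f x\<bar> powr p))"
        by (simp add: ennreal_mult[symmetric] sum_nonneg ennreal_leI)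
      also have "\<dots> \<le> ennreal (M powr p) * (\<Sum>z\<in>I. ennreal (C0 * \<Upsilon> e) * ?J x)"
      proof (intro mult_left_mono sum_mono C0(2)[OF f P(1)])
        fix z assume "z \<in> I"
        then show "dist z x < (A + 3) * e" using P(1) by (simp add: I_def algebra_simps)
      qed auto
      also have "\<dots> = ennreal (M powr p) * (ennreal (real (card I)) * (ennreal (C0 * \<Upsilon> e) * ?J x))"
        by (simp add: ennreal_of_nat_eq_real_of_nat)
      also have "\<dots> \<le> ennreal (M powr p) * (ennreal M * (ennreal (C0 * \<Upsilon> e) * ?J x))"
        using I(2) by (intro mult_left_mono mult_right_mono ennreal_leI) auto
      also have "\<dots> = ennreal (M powr p * M * C0 * \<Upsilon> e) * ?J x"
        using M C0(1) U by (simp add: ennreal_mult_assoc mult.assoc)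
      finally show "ennreal (\<bar>f x - smoothing A e N \<psi> f x\<bar> powr p) \<le> ennreal (M powr p * M * C0 * \<Upsilon> e) * ?J x" .
    qed
    also have "\<dots> = ennreal (M powr p * M * C0 * \<Upsilon> e) * JGamma m p ?T f UNIV"
      unfolding JGamma_def by (subst nn_integral_cmult) auto
    finally show "(\<integral>\<^sup>+x. ennreal (\<bar>f x - smoothing A e N \<psi> f x\<bar> powr p) \<partial>m)
       \<le> ennreal (M powr p * M * C0 * \<Upsilon> e) * JGamma m p ?T f UNIV" .
  qed
qed

text \<open>Insert \<open>f x\<close> between the two averages and integrate over \<open>x\<close>
  in \<open>ball w e\<close>. Keeping the right side on this one ball lets all neighbours
  \<open>z\<close> of \<open>w\<close> share the same local energy.\<close>

lemma avg_diff_avg_le_jump: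
  assumes A: "1 \<le> A"
  obtains C where "1 \<le> C"
    "\<And>f e z w. \<lbrakk>f \<in> JF m p K; 0 < e; dist z w < (A + 2) * e\<rbrakk> \<Longrightarrow>
       ennreal (\<bar>avg f z e - avg f w e\<bar> powr p * Vol m z e)
       \<le> ennreal (C * \<Upsilon> e) * JGamma m p (trunc ((A + 5) * e) K) f (ball w e)"
proof -
  obtain C0 where C0: "1 \<le> C0"
    "\<And>f e x z. \<lbrakk>f \<in> JF m p K; 0 < e; dist z x < (A + 3) * e\<rbrakk> \<Longrightarrow>
       ennreal (\<bar>avg f z e - f x\<bar> powr p)
       \<le> ennreal (C0 * \<Upsilon> e) * (\<integral>\<^sup>+y. ennreal (\<bar>f x - f y\<bar> powr p * trunc ((A + 5) * e) K x y) \<partial>m)"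
    by (rule avg_diff_le_jump[OF A]) blast
  obtain CV where CV: "1 \<le> CV"
    "\<And>x y r s. 0 < r \<Longrightarrow> dist x y + s \<le> (A + 3) * r \<Longrightarrow> Vol m x s \<le> CV * Vol m y r"
    using Vol_comparable[of "A + 3"] by metis
  show ?thesis
  proof (rule that[of "CV * (2 powr p * 2 * C0)"])
    have "1 \<le> 2 powr p" using p_pos by (intro ge_one_powr_ge_zero) auto
    then have "1 * (1 * 1 * 1) \<le> CV * (2 powr p * 2 * C0)" using C0(1) CV(1) by (intro mult_mono) auto
    then show "1 \<le> CV * (2 powr p * 2 * C0)" by simp
    fix f e and z w :: 'a assume f: "f \<in> JF m p K" and e: "0 < e" and zw: "dist z w < (A + 2) * e"
    let ?T = "trunc ((A + 5) * e) K"
    let ?J = "\<lambda>x. \<integral>\<^sup>+y. ennreal (\<bar>f x - f y\<bar> powr p * ?T x y) \<partial>m"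
    let ?d = "\<bar>avg f z e - avg f w e\<bar> powr p"
    note [measurable] = jump_integrand_measurable[OF kernel_measurable_trunc(1)[OF K_meas] JFD(2)[OF f]]
    have U: "0 < \<Upsilon> e" using e by (rule \<Upsilon>_pos)
    have "Vol m z e \<le> CV * Vol m w e" using zw e by (intro CV(2)) (auto simp: algebra_simps)
    then have "?d * Vol m z e \<le> CV * (?d * Vol m w e)"
      using mult_left_mono[of "Vol m z e" "CV * Vol m w e" ?d] by (simp add: mult_ac)
    then have "ennreal (?d * Vol m z e) \<le> ennreal CV * (ennreal ?d * emeasure m (ball w e))"
      using CV(1) by (simp add: emeasure_ball ennreal_mult[symmetric] ennreal_leI)
    also have "ennreal ?d * emeasure m (ball w e) = (\<integral>\<^sup>+x. ennreal ?d * indicator (ball w e) x \<partial>m)"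
      by (subst nn_integral_cmult_indicator) auto
    also have "\<dots> \<le> (\<integral>\<^sup>+x. ennreal (2 powr p * 2 * C0 * \<Upsilon> e) * (?J x * indicator (ball w e) x) \<partial>m)"
    proof (rule nn_integral_mono)
      fix x
      show "ennreal ?d * indicator (ball w e) x \<le> ennreal (2 powr p * 2 * C0 * \<Upsilon> e) * (?J x * indicator (ball w e) x)"
      proof (cases "x \<in> ball w e")
        case True
        then have d: "dist w x < (A + 3) * e" "dist z x < (A + 3) * e"
        proof -
          have "e \<le> A * e" using A e by (simp add: mult_le_cancel_right1)
          moreover have "dist w x < e" using True by simp
          ultimately have "dist w x < A * e + 3 * e" using e by linarith
          then show "dist w x < (A + 3) * e" by (simp add: distrib_right)
          show "dist z x < (A + 3) * e" using True zw dist_triangle[of z x w] by (simp add: algebra_simps)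
        qed
        have "?d \<le> 2 powr p * (\<bar>avg f z e - f x\<bar> powr p + \<bar>avg f w e - f x\<bar> powr p)"
          using abs_diff_powr_le[OF p_pos(2), of "avg f z e - f x" "avg f w e - f x"] by simp
        then have "ennreal ?d \<le> ennreal (2 powr p) * (ennreal (\<bar>avg f z e - f x\<bar> powr p) + ennreal (\<bar>avg f w e - f x\<bar> powr p))"
          by (simp add: ennreal_mult[symmetric] ennreal_plus[symmetric] ennreal_leI del: ennreal_plus)
        also have "\<dots> \<le> ennreal (2 powr p) * (ennreal (C0 * \<Upsilon> e) * ?J x + ennreal (C0 * \<Upsilon> e) * ?J x)"
          by (intro mult_left_mono add_mono C0(2)[OF f e] d) auto
        also have "\<dots> = ennreal (2 powr p * 2 * C0 * \<Upsilon> e) * ?J x"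
          using C0(1) U
          by (simp add: distrib_right[symmetric] ennreal_plus[symmetric] ennreal_mult_assoc mult.assoc del: ennreal_plus)
        finally show ?thesis using True by simp
      qed simp
    qed
    also have "\<dots> = ennreal (2 powr p * 2 * C0 * \<Upsilon> e) * JGamma m p ?T f (ball w e)"
      unfolding JGamma_def by (subst nn_integral_cmult) auto
    finally have "ennreal (?d * Vol m z e) \<le> ennreal CV * (ennreal (2 powr p * 2 * C0 * \<Upsilon> e) * JGamma m p ?T f (ball w e))"
      by (simp add: mult_left_mono)
    then show "ennreal (?d * Vol m z e) \<le> ennreal (CV * (2 powr p * 2 * C0) * \<Upsilon> e) * JGamma m p ?T f (ball w e)"
      using CV(1) C0(1) U by (simp add: ennreal_mult_assoc mult.assoc)
  qed
qed

text \<open>Near a net point \<open>w\<close> the smoothing is the constant \<open>avg f w e\<close>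
  plus a finite sum with coefficients \<open>avg f z e - avg f w e\<close>, and constants carry no
  energy. The resulting bounds on the balls \<open>ball w e\<close> are added up over the
  net.\<close>

lemma smoothing_near_energy:
  assumes A: "1 \<le> A" and M: "1 \<le> M" and C: "0 \<le> C"
  obtains D where "0 \<le> D"
    "\<And>e N \<psi> f. \<lbrakk>partition_of_unity A C M e N \<psi>; f \<in> JF m p K\<rbrakk> \<Longrightarrow>
       JGamma m p (trunc e K) (smoothing A e N \<psi> f) UNIV
       \<le> ennreal D * JGamma m p (trunc ((A + 5) * e) K) f UNIV"
proof -
  obtain C0 where C0: "1 \<le> C0"
    "\<And>f e z w. \<lbrakk>f \<in> JF m p K; 0 < e; dist z w < (A + 2) * e\<rbrakk> \<Longrightarrow>
       ennreal (\<bar>avg f z e - avg f w e\<bar> powr p * Vol m z e)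
       \<le> ennreal (C0 * \<Upsilon> e) * JGamma m p (trunc ((A + 5) * e) K) f (ball w e)"
    by (rule avg_diff_avg_le_jump[OF A]) blast
  obtain M1 :: real where M1: "1 \<le> M1"
    "\<And>e N g \<nu> c. \<lbrakk>0 < e; is_net e N; g \<in> borel_measurable m; sets \<nu> = sets borel;
       \<And>z. z \<in> N \<Longrightarrow> (\<integral>\<^sup>+y\<in>ball z e. g y \<partial>m) \<le> c * emeasure \<nu> (ball z (1 * e))\<rbrakk> \<Longrightarrow>
       (\<integral>\<^sup>+y. g y \<partial>m) \<le> c * ennreal M1 * emeasure \<nu> UNIV"
    by (rule net_integral_bound[OF order_refl]) blast
  let ?c = "(2 * M) powr p * C * C0 * M"
  show ?thesis
  proof (rule that[of "?c * M1"])
    show "0 \<le> ?c * M1" using M C C0(1) M1(1) by simp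
    fix e N \<psi> f assume pou: "partition_of_unity A C M e N \<psi>" and f: "f \<in> JF m p K"
    note P = pouD[OF pou]
    define s where "s = smoothing A e N \<psi> f"
    have s[measurable]: "s \<in> borel_measurable m" unfolding s_def by (rule smoothing_measurable[OF pou])
    have U: "0 < \<Upsilon> e" using P(1) by (rule \<Upsilon>_pos)
    let ?T = "trunc ((A + 5) * e) K"
    note [measurable] = jump_integrand_measurable[OF kernel_measurable_trunc(1)[OF K_meas] JFD(2)[OF f]]
      jump_integrand_measurable[OF kernel_measurable_trunc(1)[OF K_meas] s]
    \<comment> \<open>The jump energy of \<open>f\<close> as a measure, in the form required by
      \<open>net_integral_bound\<close>.\<close>
    define \<nu> where "\<nu> = density m (\<lambda>x. \<integral>\<^sup>+y. ennreal (\<bar>f x - f y\<bar> powr p * ?T x y) \<partial>m)"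
    have \<nu>: "emeasure \<nu> B = JGamma m p ?T f B" if "B \<in> sets borel" for B
      unfolding \<nu>_def JGamma_def using that by (subst emeasure_density) auto
    have loc: "(\<integral>\<^sup>+x\<in>ball w e. (\<integral>\<^sup>+y. ennreal (\<bar>s x - s y\<bar> powr p * trunc e K x y) \<partial>m) \<partial>m)
        \<le> ennreal ?c * emeasure \<nu> (ball w (1 * e))" if w: "w \<in> N" for w
    proof -
      \<comment> \<open>All indices active somewhere in the ball of radius \<open>2 * e\<close>
        around \<open>w\<close>.\<close>
      define I where "I = {z\<in>N. dist z w < (A + 2) * e}"
      have Ae: "(A + 2) * e \<le> (2 * A + 8) * e" using A P(1) by (intro mult_right_mono) auto
      have I: "finite I" "real (card I) \<le> M" "I \<subseteq> N" using P(4,5)[OF Ae] by (auto simp: I_def)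
      define a where "a z = avg f z e - avg f w e" for z
      define h where "h x = (\<Sum>z\<in>I. a z * \<psi> z x)" for x
      have hJ: "h \<in> JF m p K" unfolding h_def[abs_def] by (rule pou_sum_JF[OF pou I(3)])
      \<comment> \<open>Radius \<open>2 * e\<close> contains both ends of a jump shorter than
        \<open>e\<close> that starts in \<open>ball w e\<close>.\<close>
      have sh: "s x = h x + avg f w e" if "dist w x < 2 * e" for x
      proof -
        have sub: "{z\<in>N. dist z x < A * e} \<subseteq> I"
        proof
          fix z assume "z \<in> {z\<in>N. dist z x < A * e}"
          then show "z \<in> I"
            using that dist_triangle[of z w x] by (auto simp: I_def algebra_simps dist_commute)
        qed
        have "s x = (\<Sum>z\<in>I. avg f z e * \<psi> z x)"
          unfolding s_def by (rule smoothing_eq[OF pou I(1,3) sub])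
        also have "\<dots> = h x + avg f w e * (\<Sum>z\<in>I. \<psi> z x)"
          by (simp add: h_def a_def sum_distrib_left sum.distrib[symmetric] algebra_simps)
        finally show ?thesis using P(12)[OF I(1,3) sub] by simp
      qed
      have "(\<integral>\<^sup>+x\<in>ball w e. (\<integral>\<^sup>+y. ennreal (\<bar>s x - s y\<bar> powr p * trunc e K x y) \<partial>m) \<partial>m)
          = JGamma m p (trunc e K) s (ball w e)" by (simp add: JGamma_def)
      also have "\<dots> \<le> 1 * JGamma m p K h (ball w e)"
      proof (rule JGamma_mono[OF K_meas JFD(2)[OF hJ]])
        fix x y assume x: "x \<in> ball w e"
        show "ennreal (\<bar>s x - s y\<bar> powr p * trunc e K x y) \<le> 1 * ennreal (\<bar>h x - h y\<bar> powr p * K x y)"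
        proof (cases "dist x y < e")
          case True
          then have "dist w x < 2 * e" "dist w y < 2 * e"
            using x P(1) dist_triangle[of w y x] by auto
          then have "s x - s y = h x - h y" using sh by simp
          then show ?thesis using True by (simp add: trunc_def)
        qed (simp add: trunc_def)
      qed simp
      also have "\<dots> \<le> JGamma m p K h UNIV" by (simp add: JGamma_mono_set)
      also have "\<dots> \<le> ennreal ((2 * M) powr p * C / \<Upsilon> e) * (\<Sum>z\<in>I. ennreal (\<bar>a z\<bar> powr p * Vol m z e))"
        unfolding h_def[abs_def] by (rule pou_sum_energy[OF pou A C I(1,3)])
      also have "\<dots> \<le> ennreal ((2 * M) powr p * C / \<Upsilon> e) * (\<Sum>z\<in>I. ennreal (C0 * \<Upsilon> e) * JGamma m p ?T f (ball w e))"
        unfolding a_def by (intro mult_left_mono sum_mono C0(2)[OF f P(1)]) (auto simp: I_def)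
      also have "\<dots> = ennreal ((2 * M) powr p * C / \<Upsilon> e) * (ennreal (real (card I)) * (ennreal (C0 * \<Upsilon> e) * JGamma m p ?T f (ball w e)))"
        by (simp add: ennreal_of_nat_eq_real_of_nat)
      also have "\<dots> \<le> ennreal ((2 * M) powr p * C / \<Upsilon> e) * (ennreal M * (ennreal (C0 * \<Upsilon> e) * JGamma m p ?T f (ball w e)))"
        using I(2) by (intro mult_left_mono mult_right_mono ennreal_leI) auto
      also have "\<dots> = ennreal ((2 * M) powr p * C / \<Upsilon> e * M * (C0 * \<Upsilon> e)) * JGamma m p ?T f (ball w e)"
        using M C C0(1) U by (simp add: ennreal_mult_assoc mult.assoc)
      \<comment> \<open>The cost \<open>1 / \<Upsilon> e\<close> of the partition functions cancels
        the gain \<open>\<Upsilon> e\<close> of the averages, which makes the constant independent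
        of \<open>e\<close>.\<close>
      also have "(2 * M) powr p * C / \<Upsilon> e * M * (C0 * \<Upsilon> e) = ?c" using U by simp
      finally show ?thesis using \<nu>[of "ball w e"] by simp
    qed
    have "(\<integral>\<^sup>+x. (\<integral>\<^sup>+y. ennreal (\<bar>s x - s y\<bar> powr p * trunc e K x y) \<partial>m) \<partial>m)
        \<le> ennreal ?c * ennreal M1 * emeasure \<nu> UNIV"
      by (rule M1(2)[OF P(1,2) _ _ loc]) (auto simp: \<nu>_def)
    also have "\<dots> = ennreal (?c * M1) * JGamma m p ?T f UNIV"
      using M C C0(1) M1(1) \<nu>[of UNIV] by (subst ennreal_mult[symmetric]) auto
    finally show "JGamma m p (trunc e K) (smoothing A e N \<psi> f) UNIV \<le> ennreal (?c * M1) * JGamma m p ?T f UNIV"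
      by (simp add: JGamma_def s_def)
  qed
qed

text \<open>Jumps of the error longer than \<open>e\<close> cost \<open>1 / \<Upsilon> e\<close>
  times its L^p part, which is itself of order \<open>\<Upsilon> e\<close>; shorter ones are bounded
  for \<open>f\<close> and for its smoothing separately. The condition \<open>e \<le> 1\<close>
  bounds \<open>\<Upsilon> e\<close> by a multiple of \<open>\<Upsilon> 1\<close> in the L^p
  part.\<close>

lemma smoothing_error:
  assumes A: "1 \<le> A" and M: "1 \<le> M" and C: "0 \<le> C"
  obtains D where "0 \<le> D"
    "\<And>e N \<psi> f. \<lbrakk>e \<le> 1; partition_of_unity A C M e N \<psi>; f \<in> JF m p K\<rbrakk> \<Longrightarrow>
       nrm (\<lambda>x. f x - smoothing A e N \<psi> f x) \<le> ennreal D * JGamma m p (trunc ((A + 5) * e) K) f UNIV"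
proof -
  obtain D1 where D1: "0 \<le> D1"
    "\<And>C e N \<psi> f. \<lbrakk>partition_of_unity A C M e N \<psi>; f \<in> JF m p K\<rbrakk> \<Longrightarrow>
       (\<integral>\<^sup>+x. ennreal (\<bar>f x - smoothing A e N \<psi> f x\<bar> powr p) \<partial>m)
       \<le> ennreal (D1 * \<Upsilon> e) * JGamma m p (trunc ((A + 5) * e) K) f UNIV"
    by (rule smoothing_Lp_error[OF A M]) blast
  obtain D2 where D2: "0 \<le> D2"
    "\<And>e N \<psi> f. \<lbrakk>partition_of_unity A C M e N \<psi>; f \<in> JF m p K\<rbrakk> \<Longrightarrow>
       JGamma m p (trunc e K) (smoothing A e N \<psi> f) UNIV
       \<le> ennreal D2 * JGamma m p (trunc ((A + 5) * e) K) f UNIV"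
    by (rule smoothing_near_energy[OF A M C]) blast
  obtain D3 where D3: "0 < D3"
    "\<And>R u. 0 < R \<Longrightarrow> u \<in> borel_measurable m \<Longrightarrow>
       JGamma m p (far R K) u UNIV \<le> ennreal (D3 / \<Upsilon> R) * (\<integral>\<^sup>+x. ennreal (\<bar>u x\<bar> powr p) \<partial>m)"
    by (rule far_energy_le) blast
  obtain D4 where D4: "1 \<le> D4" "\<And>s r. 0 < s \<Longrightarrow> 0 < r \<Longrightarrow> s \<le> 1 * r \<Longrightarrow> \<Upsilon> s \<le> D4 * \<Upsilon> r"
    using doubling_function_comparable[OF dfun, of 1] by metis
  have U1: "0 < \<Upsilon> 1" by (rule \<Upsilon>_pos) simp
  show ?thesis
  proof (rule that[of "2 powr p * (1 + D2) + D3 * D1 + D1 * (D4 * \<Upsilon> 1)"])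
    show "0 \<le> 2 powr p * (1 + D2) + D3 * D1 + D1 * (D4 * \<Upsilon> 1)"
      using D1(1) D2(1) D3(1) D4(1) U1 by simp
    fix e N \<psi> f assume e1: "e \<le> 1" and pou: "partition_of_unity A C M e N \<psi>" and f: "f \<in> JF m p K"
    note P = pouD[OF pou]
    have U: "0 < \<Upsilon> e" using P(1) by (rule \<Upsilon>_pos)
    define s where "s = smoothing A e N \<psi> f"
    note [measurable] = JFD(2)[OF f]
    have s[measurable]: "s \<in> borel_measurable m" unfolding s_def by (rule smoothing_measurable[OF pou])
    let ?J = "JGamma m p (trunc ((A + 5) * e) K) f UNIV"
    have L: "(\<integral>\<^sup>+x. ennreal (\<bar>f x - s x\<bar> powr p) \<partial>m) \<le> ennreal (D1 * \<Upsilon> e) * ?J"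
      unfolding s_def by (rule D1(2)[OF pou f])
    have "JGamma m p (trunc e K) (\<lambda>x. f x - s x) UNIV
        \<le> ennreal (2 powr p) * (JGamma m p (trunc e K) f UNIV + JGamma m p (trunc e K) s UNIV)"
      by (rule JGamma_diff_le[OF kernel_measurable_trunc(1)[OF K_meas]]) (auto simp: p_pos)
    also have "\<dots> \<le> ennreal (2 powr p) * (1 * ?J + ennreal D2 * ?J)"
    proof (intro mult_left_mono add_mono)
      show "JGamma m p (trunc e K) f UNIV \<le> 1 * ?J"
      proof (rule JGamma_mono[OF kernel_measurable_trunc(1)[OF K_meas] JFD(2)[OF f]])
        fix x y
        have "e \<le> (A + 5) * e" using A P(1) by (simp add: mult_le_cancel_right1)
        then show "ennreal (\<bar>f x - f y\<bar> powr p * trunc e K x y)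
            \<le> 1 * ennreal (\<bar>f x - f y\<bar> powr p * trunc ((A + 5) * e) K x y)"
          by (auto simp: trunc_def)
      qed simp
      show "JGamma m p (trunc e K) s UNIV \<le> ennreal D2 * ?J"
        unfolding s_def by (rule D2(2)[OF pou f])
    qed auto
    also have "\<dots> = ennreal (2 powr p * (1 + D2)) * ?J"
      using D2(1) by (simp add: ennreal_mult distrib_right mult.assoc)
    finally have near: "JGamma m p (trunc e K) (\<lambda>x. f x - s x) UNIV \<le> ennreal (2 powr p * (1 + D2)) * ?J" .
    have "JGamma m p (far e K) (\<lambda>x. f x - s x) UNIV \<le> ennreal (D3 / \<Upsilon> e) * (\<integral>\<^sup>+x. ennreal (\<bar>f x - s x\<bar> powr p) \<partial>m)"
      by (rule D3(2)[OF P(1)]) simp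
    also have "\<dots> \<le> ennreal (D3 / \<Upsilon> e) * (ennreal (D1 * \<Upsilon> e) * ?J)"
      using L by (intro mult_left_mono) auto
    also have "\<dots> = ennreal (D3 * D1) * ?J"
      using D1(1) D3(1) U by (simp add: ennreal_mult_assoc mult.assoc)
    finally have fr: "JGamma m p (far e K) (\<lambda>x. f x - s x) UNIV \<le> ennreal (D3 * D1) * ?J" .
    have "\<Upsilon> e \<le> D4 * \<Upsilon> 1" using D4(2)[of e 1] P(1) e1 by simp
    then have "ennreal (D1 * \<Upsilon> e) * ?J \<le> ennreal (D1 * (D4 * \<Upsilon> 1)) * ?J"
      using D1(1) by (intro mult_right_mono ennreal_leI mult_left_mono) auto
    then have L': "(\<integral>\<^sup>+x. ennreal (\<bar>f x - s x\<bar> powr p) \<partial>m) \<le> ennreal (D1 * (D4 * \<Upsilon> 1)) * ?J"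
      using L by (rule order_trans[rotated])
    have "nrm (\<lambda>x. f x - s x) \<le> ennreal (2 powr p * (1 + D2)) * ?J + ennreal (D3 * D1) * ?J + ennreal (D1 * (D4 * \<Upsilon> 1)) * ?J"
      unfolding nrm_def using near fr L'
      by (subst JGamma_trunc_far[OF K_meas _ _, where R = e]) (auto intro!: add_mono)
    also have "\<dots> = ennreal (2 powr p * (1 + D2) + D3 * D1 + D1 * (D4 * \<Upsilon> 1)) * ?J"
      using D1(1) D2(1) D3(1) D4(1) U1 by (simp add: distrib_right)
    finally show "nrm (\<lambda>x. f x - smoothing A e N \<psi> f x)
       \<le> ennreal (2 powr p * (1 + D2) + D3 * D1 + D1 * (D4 * \<Upsilon> 1)) * ?J" by (simp add: s_def)
  qed
qed

section \<open>Density of compactly supported continuous functions\<close>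

lemma Cc_bounded_support:
  fixes g :: "'a \<Rightarrow> real"
  assumes "continuous_on UNIV g" "\<And>x. g x \<noteq> 0 \<Longrightarrow> dist z x < R"
  shows "Cc g"
proof -
  have "closure {x. g x \<noteq> 0} \<subseteq> closure (ball z R)"
    using assms(2) by (intro closure_mono) auto
  moreover have "compact (closure (ball z R))" using standing by (simp add: standing_space_def)
  ultimately have "compact (closure {x. g x \<noteq> 0})"
    by (metis closed_closure compact_Int_closed inf.absorb_iff2)
  then show ?thesis using assms(1) by (simp add: Cc_def)
qed

text \<open>The scale is chosen so that \<open>f\<close> has little energy in jumps shorter than
  \<open>(A + 5) * e\<close>; then the series for the smoothing is cut off.\<close>

lemma Cc_dense_JF:
  assumes cap: "cap_cutoffs A C" and A: "1 \<le> A" and C: "0 \<le> C"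
    and f: "f \<in> JF m p K" and \<eta>: "0 < \<eta>"
  shows "\<exists>g\<in>JF m p K. Cc g \<and> E1 m p (JE m p K) (\<lambda>x. f x - g x) < \<eta>"
proof -
  obtain C' M where CM: "1 \<le> C'" "1 \<le> M" "\<And>e. 0 < e \<Longrightarrow> \<exists>N \<psi>. partition_of_unity A C' M e N \<psi>"
    using partition_of_unity_exists[OF cap A C] by metis
  have C0: "0 \<le> C'" using CM(1) by simp
  obtain D where D: "0 \<le> D"
    "\<And>e N \<psi> f. \<lbrakk>e \<le> 1; partition_of_unity A C' M e N \<psi>; f \<in> JF m p K\<rbrakk> \<Longrightarrow>
       nrm (\<lambda>x. f x - smoothing A e N \<psi> f x) \<le> ennreal D * JGamma m p (trunc ((A + 5) * e) K) f UNIV"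
    by (rule smoothing_error[OF A CM(2) C0]) blast
  \<comment> \<open>Smoothing contributes \<open>D * \<rho>\<close> and cutting the series
    \<open>\<rho>\<close>; with the factor \<open>2 powr p\<close> of the quasi-triangle inequality
    the total is \<open>\<eta> / 4\<close>.\<close>
  define \<rho> where "\<rho> = \<eta> / (4 * 2 powr p * (D + 1))"
  have \<rho>: "0 < \<rho>" using \<eta> D(1) by (simp add: \<rho>_def)
  obtain n :: nat where n: "JGamma m p (trunc (1 / Suc n) K) f UNIV < ennreal \<rho>"
    by (rule JGamma_trunc_small[OF K_meas JFD(2,3)[OF f], of "ennreal \<rho>"]) (use \<rho> in auto)
  define e where "e = (1 / Suc n) / (A + 5)"
  have e: "0 < e" "(A + 5) * e = 1 / Suc n" using A by (auto simp: e_def)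
  have "e \<le> 1"
  proof -
    have "1 * e \<le> (A + 5) * e" using A e by (intro mult_right_mono) auto
    also have "\<dots> \<le> 1" using e(2) by simp
    finally show ?thesis by simp
  qed
  obtain N \<psi> where pou: "partition_of_unity A C' M e N \<psi>" using CM(3)[OF e(1)] by blast
  note P = pouD[OF pou]
  define s where "s = smoothing A e N \<psi> f"
  have s: "s \<in> borel_measurable m" unfolding s_def by (rule smoothing_measurable[OF pou])
  have 1: "nrm (\<lambda>x. f x - s x) \<le> ennreal (D * \<rho>)"
  proof -
    have "nrm (\<lambda>x. f x - s x) \<le> ennreal D * JGamma m p (trunc ((A + 5) * e) K) f UNIV"
      unfolding s_def by (rule D(2)[OF \<open>e \<le> 1\<close> pou f])
    also have "\<dots> \<le> ennreal D * ennreal \<rho>" using n e(2) by (intro mult_left_mono) auto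
    finally show ?thesis using D(1) \<rho> by (simp add: ennreal_mult)
  qed
  \<comment> \<open>\<open>undefined\<close> serves as an arbitrary base point.\<close>
  obtain k :: nat where k: "nrm (\<lambda>x. (\<Sum>z\<in>{z\<in>N. dist z undefined < real k}. avg f z e * \<psi> z x) - s x) < ennreal \<rho>"
    unfolding s_def by (rule smoothing_tail[OF pou A C0 f, of "ennreal \<rho>" undefined]) (use \<rho> in auto)
  define I where "I = {z\<in>N. dist z undefined < real k}"
  define g where "g x = (\<Sum>z\<in>I. avg f z e * \<psi> z x)" for x
  have I: "finite I" "I \<subseteq> N" using separated_finite[OF P(1,3)] by (auto simp: I_def)
  have gJ: "g \<in> JF m p K" unfolding g_def[abs_def] by (rule pou_sum_JF[OF pou I(2)])
  have gC: "Cc g"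
  proof (rule Cc_bounded_support)
    show "continuous_on UNIV g"
      unfolding g_def[abs_def]
    proof (rule continuous_on_sum)
      fix z assume "z \<in> I"
      then have "continuous_on UNIV (\<psi> z)" using P(7) I by blast
      then show "continuous_on UNIV (\<lambda>x. avg f z e * \<psi> z x)"
        by (rule continuous_on_mult[OF continuous_on_const])
    qed
    fix x assume "g x \<noteq> 0"
    then obtain z where z: "z \<in> I" "avg f z e * \<psi> z x \<noteq> 0"
      unfolding g_def by (rule sum.not_neutral_contains_not_neutral)
    then have "dist z x < A * e" using P(10)[of z x] I(2) by (cases "A * e \<le> dist z x") auto
    then show "dist undefined x < real k + A * e"
      using z dist_triangle[of undefined x z] by (auto simp: I_def dist_commute)
  qed
  have "nrm (\<lambda>x. f x - g x) = nrm (\<lambda>x. (f x - s x) - (g x - s x))" by simp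
  also have "\<dots> \<le> ennreal (2 powr p) * (nrm (\<lambda>x. f x - s x) + nrm (\<lambda>x. g x - s x))"
    using JFD(2)[OF f] JFD(2)[OF gJ] s by (intro nrm_diff_le) auto
  also have "\<dots> \<le> ennreal (2 powr p) * (ennreal (D * \<rho>) + ennreal \<rho>)"
    using 1 k unfolding g_def I_def by (intro mult_left_mono add_mono) auto
  also have "\<dots> = ennreal (2 powr p * (D * \<rho> + \<rho>))"
    using D(1) \<rho> by (simp add: ennreal_mult ennreal_plus)
  finally have "E1 m p (JE m p K) (\<lambda>x. f x - g x) \<le> 2 powr p * (D * \<rho> + \<rho>)"
    unfolding ennreal_E1[OF JF_diff[OF f gJ], symmetric]
    by (rule iffD1[OF ennreal_le_iff, rotated]) (use D(1) \<rho> in \<open>intro mult_nonneg_nonneg add_nonneg_nonneg; simp\<close>)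
  also have "2 powr p * (D * \<rho> + \<rho>) = (2 powr p * (D + 1)) * \<rho>" by (simp add: algebra_simps)
  also have "\<dots> = \<eta> / 4"
  proof -
    have "(2 powr p * (D + 1)) \<noteq> 0" using D(1) by simp
    then show ?thesis unfolding \<rho>_def by (simp add: field_simps)
  qed
  also have "\<dots> < \<eta>" using \<eta> by simp
  finally show ?thesis using gJ gC by blast
qed

end

section \<open>Transfer of the cutoff energy inequality\<close>

context doubling_space
begin

text \<open>The points of \<open>U\<close> that violate the claim form an open set; if nonempty, it
  would contain a ball, which has positive measure by full support.\<close>

lemma AE_open_continuous:
  fixes h :: "'a \<Rightarrow> real"
  assumes cont: "continuous_on UNIV h" and S: "closed S" and U: "open U"
    and ae: "AE x in m. x \<in> U \<longrightarrow> h x \<in> S" and x: "x \<in> U"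
  shows "h x \<in> S"
proof (rule ccontr)
  assume "h x \<notin> S"
  have "open (U \<inter> h -` (- S))"
    using cont S U by (intro open_Int open_vimage) auto
  moreover have "x \<in> U \<inter> h -` (- S)" using x \<open>h x \<notin> S\<close> by simp
  ultimately obtain e where e: "0 < e" "ball x e \<subseteq> U \<inter> h -` (- S)"
    unfolding open_contains_ball by blast
  have "AE y in m. y \<notin> ball x e" using ae by eventually_elim (use e in auto)
  then have "emeasure m (ball x e) = 0"
    by (subst (asm) AE_iff_measurable[where N = "ball x e"]) auto
  then show False using Vol_pos[OF e(1), of x] by (simp add: emeasure_ball)
qed

lemma Hoelder_continuous:
  fixes \<phi> :: "'a \<Rightarrow> real"
  assumes "0 < \<delta>" "0 < r" and H: "\<And>x y. \<bar>\<phi> x - \<phi> y\<bar> \<le> C * (min (dist x y / r) 1) powr \<delta>"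
  shows "continuous_on UNIV \<phi>"
  unfolding continuous_on_def
proof
  fix x :: 'a
  have "((\<lambda>y. C * (min (dist y x / r) 1) powr \<delta>) \<longlongrightarrow> C * (min (dist x x / r) 1) powr \<delta>) (at x)"
    using assms(1,2) by (intro tendsto_intros) (auto simp: eventually_at_filter)
  then have "((\<lambda>y. C * (min (dist y x / r) 1) powr \<delta>) \<longlongrightarrow> 0) (at x)" by simp
  then have "((\<lambda>y. \<phi> y - \<phi> x) \<longlongrightarrow> 0) (at x)"
    by (rule Lim_null_comparison[rotated]) (simp add: H)
  then show "(\<phi> \<longlongrightarrow> \<phi> x) (at x within UNIV)" by (simp add: LIM_zero_iff)
qed

text \<open>Turns the almost everywhere conditions in \<open>cutoff\<close> into pointwise ones, as
  \<open>cap_cutoffs\<close> requires.\<close>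

lemma continuous_cutoffD:
  fixes \<phi> :: "'a \<Rightarrow> real"
  assumes cont: "continuous_on UNIV \<phi>" and cut: "cutoff m U V \<phi>"
  shows "0 \<le> \<phi> x" "\<phi> x \<le> 1" "x \<in> U \<Longrightarrow> \<phi> x = 1" "x \<notin> V \<Longrightarrow> \<phi> x = 0"
proof -
  have "AE x in m. x \<in> UNIV \<longrightarrow> \<phi> x \<in> {0..1}" using cut by (auto simp: cutoff_def)
  from AE_open_continuous[OF cont _ _ this, of x] show "0 \<le> \<phi> x" "\<phi> x \<le> 1" by auto
  obtain W where W: "open W" "closure U \<subseteq> W" "AE x in m. x \<in> W \<longrightarrow> \<phi> x = 1"
    using cut by (auto simp: cutoff_def)
  have W3: "AE x in m. x \<in> W \<longrightarrow> \<phi> x \<in> {1}" using W(3) by simp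
  show "\<phi> x = 1" if "x \<in> U"
    using AE_open_continuous[OF cont _ W(1) W3, of x] W(2) closure_subset[of U] that by auto
  show "\<phi> x = 0" if "x \<notin> V"
  proof -
    have "x \<notin> esupp m \<phi>" using cut that by (auto simp: cutoff_def)
    then obtain U' where U': "open U'" "x \<in> U'" "AE y in m. y \<in> U' \<longrightarrow> \<phi> y = 0"
      by (auto simp: esupp_def)
    have "AE y in m. y \<in> U' \<longrightarrow> \<phi> y \<in> {0}" using U'(3) by simp
    from AE_open_continuous[OF cont _ U'(1) this U'(2)] show ?thesis by simp
  qed
qed

lemma far_point_exists: "\<exists>y::'a. R < dist x y"
proof (rule ccontr)
  assume "\<not> (\<exists>y::'a. R < dist x y)"
  then have "bounded (UNIV :: 'a set)" by (auto simp: bounded_def not_less)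
  then show False using standing by (simp add: standing_space_def)
qed

end

context jump_form
begin

section \<open>From control of short jumps to the full statement\<close>

text \<open>Together with \<open>near_CE\<close>, this is the interface through which the local and
  the non-local case enter. The constant may depend on \<open>R\<close> but not on the
  function.\<close>

definition near_controlled :: "('a \<Rightarrow> real) set \<Rightarrow> (('a \<Rightarrow> real) \<Rightarrow> real) \<Rightarrow> bool" where
  "near_controlled F E \<longleftrightarrow> (\<forall>R>0. \<exists>C. \<forall>u\<in>F. JGamma m p (trunc R K) u UNIV \<le> ennreal (C * E u))"

text \<open>The energy bound concerns only jumps shorter than \<open>min s r\<close>, the scale at
  which \<open>\<Upsilon>\<close> is evaluated on the right.\<close>

definition near_CE :: "('a \<Rightarrow> real) set \<Rightarrow> bool" where
  "near_CE F \<longleftrightarrow> (\<exists>\<delta> Ae C. 0 < \<delta> \<and> \<delta> < 1 \<and> Ae > 1 \<and> C > 0 \<and>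
     (\<forall>x0 r. r > 0 \<longrightarrow> (\<exists>\<phi>\<in>F. cutoff m (ball x0 r) (ball x0 (Ae * r)) \<phi> \<and>
        (\<forall>x y. \<bar>\<phi> x - \<phi> y\<bar> \<le> C * (min (dist x y / r) 1) powr \<delta>) \<and>
        (\<forall>x s. s > 0 \<longrightarrow> JGamma m p (trunc (min s r) K) \<phi> (ball x s)
            \<le> ennreal (C * (min (s / r) 1) powr \<delta> * Vol m x s / \<Upsilon> (min s r))))))"

lemma near_controlled_subset:
  assumes pf: "p_form m p F E" and nc: "near_controlled F E"
  shows "F \<subseteq> JF m p K"
proof
  fix u assume u: "u \<in> F"
  then have L: "Lp m p u" using pf by (auto simp: p_form_def)
  then have um: "u \<in> borel_measurable m" by (rule LpD)
  obtain C where C: "JGamma m p (trunc 1 K) u UNIV \<le> ennreal (C * E u)"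
    using nc u unfolding near_controlled_def by (meson zero_less_one)
  obtain D where D: "0 < D" "\<And>R u. 0 < R \<Longrightarrow> u \<in> borel_measurable m \<Longrightarrow>
       JGamma m p (far R K) u UNIV \<le> ennreal (D / \<Upsilon> R) * (\<integral>\<^sup>+x. ennreal (\<bar>u x\<bar> powr p) \<partial>m)"
    by (rule far_energy_le) blast
  have "JGamma m p K u UNIV = JGamma m p (trunc 1 K) u UNIV + JGamma m p (far 1 K) u UNIV"
    by (rule JGamma_trunc_far[OF K_meas um]) simp
  also have "\<dots> \<le> ennreal (C * E u) + ennreal (D / \<Upsilon> 1) * ennreal (Lp_pow m p u)"
    using C D(2)[of 1, OF _ um] LpD(3)[OF L] by (intro add_mono) auto
  also have "\<dots> < \<infinity>" by (simp add: ennreal_mult_less_top)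
  finally show "u \<in> JF m p K" using L by (simp add: JF_def)
qed

text \<open>The near part of the energy is controlled by hypothesis; for the far part the Hoelder
  bound on the cutoff function is integrated against the tail of the kernel.\<close>
lemma cutoffs_full_energy:
  assumes ne: "near_CE F" and sub: "F \<subseteq> JF m p K"
  obtains \<delta> Ae C where "0 < \<delta>" "\<delta> < 1" "Ae > 1" "C > 0"
     "\<And>x0 r. r > 0 \<Longrightarrow> \<exists>\<phi>\<in>F. cutoff m (ball x0 r) (ball x0 (Ae * r)) \<phi> \<and> continuous_on UNIV \<phi> \<and>
        (\<forall>x y. \<bar>\<phi> x - \<phi> y\<bar> \<le> C * (min (dist x y / r) 1) powr \<delta>) \<and>
        (\<forall>x s. s > 0 \<longrightarrow> JGamma m p K \<phi> (ball x s)
            \<le> ennreal (C * (min (s / r) 1) powr \<delta> * Vol m x s / \<Upsilon> (min s r)))"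
proof -
  obtain \<delta> Ae C where dAC: "0 < \<delta>" "\<delta> < 1" "Ae > 1" "C > 0"
    and cut: "\<And>x0 r. r > 0 \<Longrightarrow> \<exists>\<phi>\<in>F. cutoff m (ball x0 r) (ball x0 (Ae * r)) \<phi> \<and>
        (\<forall>x y. \<bar>\<phi> x - \<phi> y\<bar> \<le> C * (min (dist x y / r) 1) powr \<delta>) \<and>
        (\<forall>x s. s > 0 \<longrightarrow> JGamma m p (trunc (min s r) K) \<phi> (ball x s)
            \<le> ennreal (C * (min (s / r) 1) powr \<delta> * Vol m x s / \<Upsilon> (min s r)))"
    using ne unfolding near_CE_def by blast
  obtain b where b: "0 < b" "\<And>a. 0 \<le> a \<Longrightarrow> a < b \<Longrightarrow> \<exists>C>0. \<forall>x R. 0 < R \<longrightarrow>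
       (\<integral>\<^sup>+y. ennreal (dist x y powr a * far R K x y) \<partial>m) \<le> ennreal (C * R powr a / \<Upsilon> R)"
    by (rule K_tail) blast
  \<comment> \<open>An exponent below \<open>b\<close> makes the weight
    \<open>dist x y powr d\<close> integrable against the tail of the kernel.\<close>
  define d where "d = min \<delta> (b / 2)"
  have d: "0 < d" "d < 1" "d \<le> \<delta>" "d < b" using dAC b(1) by (auto simp: d_def)
  obtain D where D: "D > 0" "\<And>x R. 0 < R \<Longrightarrow>
       (\<integral>\<^sup>+y. ennreal (dist x y powr d * far R K x y) \<partial>m) \<le> ennreal (D * R powr d / \<Upsilon> R)"
    using b(2)[of d] d by auto
  have le1: "t powr \<delta>' \<le> t powr d" if "d \<le> \<delta>'" "0 \<le> t" "t \<le> 1" for t \<delta>' :: real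
    using that by (intro powr_mono') auto
  show ?thesis
  proof (rule that[of d Ae "C + C powr p * D"])
    show "0 < C + C powr p * D" using dAC(4) D(1) by (simp add: add_pos_pos)
    fix x0 :: 'a and r :: real assume r: "r > 0"
    obtain \<phi> where \<phi>: "\<phi> \<in> F" "cutoff m (ball x0 r) (ball x0 (Ae * r)) \<phi>"
      "\<And>x y. \<bar>\<phi> x - \<phi> y\<bar> \<le> C * (min (dist x y / r) 1) powr \<delta>"
      "\<And>x s. s > 0 \<Longrightarrow> JGamma m p (trunc (min s r) K) \<phi> (ball x s)
            \<le> ennreal (C * (min (s / r) 1) powr \<delta> * Vol m x s / \<Upsilon> (min s r))"
      using cut[OF r] by blast
    have \<phi>m: "\<phi> \<in> borel_measurable m" using JFD(2) sub \<phi>(1) by blast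
    have cont: "continuous_on UNIV \<phi>" by (rule Hoelder_continuous[OF dAC(1) r \<phi>(3)])
    have H: "\<bar>\<phi> x - \<phi> y\<bar> \<le> (C + C powr p * D) * (min (dist x y / r) 1) powr d" for x y
    proof -
      have "C * (min (dist x y / r) 1) powr \<delta> \<le> (C + C powr p * D) * (min (dist x y / r) 1) powr d"
        using dAC(4) D(1) d(3) r by (intro mult_mono le1) auto
      then show ?thesis using \<phi>(3)[of x y] by linarith
    qed
    have J: "JGamma m p K \<phi> (ball x s) \<le> ennreal ((C + C powr p * D) * (min (s / r) 1) powr d * Vol m x s / \<Upsilon> (min s r))"
      if s: "s > 0" for x s
    proof -
      define S where "S = min s r"
      have S: "0 < S" "min (s / r) 1 = S / r" using s r by (auto simp: S_def min_def field_simps)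
      have U: "0 < \<Upsilon> S" by (rule \<Upsilon>_pos[OF S(1)])
      have near: "JGamma m p (trunc S K) \<phi> (ball x s) \<le> ennreal (C * (S / r) powr d * Vol m x s / \<Upsilon> S)"
      proof -
        have "C * (S / r) powr \<delta> * Vol m x s / \<Upsilon> S \<le> C * (S / r) powr d * Vol m x s / \<Upsilon> S"
          using dAC(4) U S(1) r d(3) by (intro divide_right_mono mult_right_mono mult_left_mono le1) (auto simp: S_def)
        then show ?thesis using \<phi>(4)[OF s, of x] S(2) unfolding S_def[symmetric]
          by (metis ennreal_leI order_trans)
      qed
      have inner: "(\<integral>\<^sup>+y'. ennreal (\<bar>\<phi> y - \<phi> y'\<bar> powr p * far S K y y') \<partial>m) \<le> ennreal (C powr p * D * (S / r) powr d / \<Upsilon> S)" for y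
      proof -
        have [measurable]: "(\<lambda>y'. far S K y y') \<in> borel_measurable m"
          using measurable_compose[OF measurable_Pair1' kernel_measurable_trunc(2)[OF K_meas], of y] by simp
        have [measurable]: "(\<lambda>y'. dist y y') \<in> borel_measurable m"
          using measurable_compose[OF measurable_Pair1' measurable_dist, of y] by simp
        have "(\<integral>\<^sup>+y'. ennreal (\<bar>\<phi> y - \<phi> y'\<bar> powr p * far S K y y') \<partial>m)
            \<le> (\<integral>\<^sup>+y'. ennreal (C powr p / r powr d) * ennreal (dist y y' powr d * far S K y y') \<partial>m)"
        proof (rule nn_integral_mono)
          fix y'
          show "ennreal (\<bar>\<phi> y - \<phi> y'\<bar> powr p * far S K y y')
             \<le> ennreal (C powr p / r powr d) * ennreal (dist y y' powr d * far S K y y')"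
          proof (cases "y = y'")
            case False
            have fK: "0 \<le> far S K y y'" using K_nonneg[OF False] by (simp add: far_def)
            let ?t = "min (dist y y' / r) 1"
            have t: "0 \<le> ?t" "?t \<le> 1" "?t \<le> dist y y' / r" using r by auto
            have "\<bar>\<phi> y - \<phi> y'\<bar> powr p \<le> (C * ?t powr \<delta>) powr p"
              using \<phi>(3)[of y y'] p_pos by (intro powr_mono2) auto
            also have "\<dots> = C powr p * ?t powr (\<delta> * p)" by (simp add: powr_mult powr_powr)
            \<comment> \<open>On the unit interval a smaller exponent gives a larger power, and
              \<open>d \<le> \<delta> \<le> \<delta> * p\<close>.\<close>
            also have "\<dots> \<le> C powr p * ?t powr d"
            proof (intro mult_left_mono le1)
              have "\<delta> * 1 \<le> \<delta> * p" using dAC(1) p_gt_1 by (intro mult_left_mono) auto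
              then show "d \<le> \<delta> * p" using d(3) by simp
            qed (use t in auto)
            also have "\<dots> \<le> C powr p * (dist y y' / r) powr d"
              using t d by (intro mult_left_mono powr_mono2) auto
            finally have "\<bar>\<phi> y - \<phi> y'\<bar> powr p \<le> C powr p / r powr d * dist y y' powr d"
              by (simp add: powr_divide)
            then have "\<bar>\<phi> y - \<phi> y'\<bar> powr p * far S K y y' \<le> C powr p / r powr d * dist y y' powr d * far S K y y'"
              using fK by (rule mult_right_mono)
            then have "ennreal (\<bar>\<phi> y - \<phi> y'\<bar> powr p * far S K y y') \<le> ennreal (C powr p / r powr d * (dist y y' powr d * far S K y y'))"
              by (intro ennreal_leI) (simp add: mult.assoc)
            also have "\<dots> = ennreal (C powr p / r powr d) * ennreal (dist y y' powr d * far S K y y')"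
              using fK by (intro ennreal_mult) auto
            finally show ?thesis .
          qed simp
        qed
        also have "\<dots> = ennreal (C powr p / r powr d) * (\<integral>\<^sup>+y'. ennreal (dist y y' powr d * far S K y y') \<partial>m)"
          by (rule nn_integral_cmult) measurable
        also have "\<dots> \<le> ennreal (C powr p / r powr d) * ennreal (D * S powr d / \<Upsilon> S)"
          by (intro mult_left_mono D(2)[OF S(1)]) simp
        also have "\<dots> = ennreal (C powr p / r powr d * (D * S powr d / \<Upsilon> S))"
          using D(1) U by (intro ennreal_mult[symmetric]) auto
        also have "C powr p / r powr d * (D * S powr d / \<Upsilon> S) = C powr p * D * (S / r) powr d / \<Upsilon> S"
          by (simp add: powr_divide)
        finally show ?thesis .
      qed
      have "JGamma m p (far S K) \<phi> (ball x s) \<le> (\<integral>\<^sup>+y. ennreal (C powr p * D * (S / r) powr d / \<Upsilon> S) * indicator (ball x s) y \<partial>m)"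
        unfolding JGamma_def by (intro nn_integral_mono mult_right_mono inner) simp
      also have "\<dots> = ennreal (C powr p * D * (S / r) powr d / \<Upsilon> S * Vol m x s)"
      proof -
        have "0 \<le> C powr p * D * (S / r) powr d / \<Upsilon> S" using D(1) U by simp
        from ennreal_mult[OF this Vol_nonneg] show ?thesis
          by (subst nn_integral_cmult_indicator) (simp_all only: emeasure_ball sets_m ball_in_sets)
      qed
      finally have far: "JGamma m p (far S K) \<phi> (ball x s) \<le> ennreal (C powr p * D * (S / r) powr d * Vol m x s / \<Upsilon> S)"
        by simp
      have "JGamma m p K \<phi> (ball x s) \<le> ennreal (C * (S / r) powr d * Vol m x s / \<Upsilon> S) + ennreal (C powr p * D * (S / r) powr d * Vol m x s / \<Upsilon> S)"
        using near far by (subst JGamma_trunc_far[OF K_meas \<phi>m, where R = S]) (auto intro: add_mono)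
      also have "\<dots> = ennreal (C * (S / r) powr d * Vol m x s / \<Upsilon> S + C powr p * D * (S / r) powr d * Vol m x s / \<Upsilon> S)"
        using dAC(4) D(1) U by (intro ennreal_plus[symmetric]) auto
      also have "C * (S / r) powr d * Vol m x s / \<Upsilon> S + C powr p * D * (S / r) powr d * Vol m x s / \<Upsilon> S
          = (C + C powr p * D) * (S / r) powr d * Vol m x s / \<Upsilon> S"
        by (simp add: distrib_right add_divide_distrib)
      finally show ?thesis using S(2) by (simp add: S_def)
    qed
    show "\<exists>\<phi>\<in>F. cutoff m (ball x0 r) (ball x0 (Ae * r)) \<phi> \<and> continuous_on UNIV \<phi> \<and>
        (\<forall>x y. \<bar>\<phi> x - \<phi> y\<bar> \<le> (C + C powr p * D) * (min (dist x y / r) 1) powr d) \<and>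
        (\<forall>x s. s > 0 \<longrightarrow> JGamma m p K \<phi> (ball x s)
            \<le> ennreal ((C + C powr p * D) * (min (s / r) 1) powr d * Vol m x s / \<Upsilon> (min s r)))"
      using \<phi>(1,2) cont H J by blast
  qed (use d dAC in auto)
qed

text \<open>Jumps from the unit ball around \<open>a\<close>, where the function is 1, to the one
  around \<open>b\<close>, where it is 0, are shorter than \<open>dist a b + 2\<close> and have
  positive mass. This provides the function of positive energy for the scalar Clarkson
  inequality.\<close>

lemma positive_near_energy:
  fixes \<phi> :: "'a \<Rightarrow> real"
  assumes \<phi>: "\<phi> \<in> borel_measurable m" "\<And>x. dist a x < 1 \<Longrightarrow> \<phi> x = 1" "\<And>x. dist b x < 1 \<Longrightarrow> \<phi> x = 0"
  shows "0 < JGamma m p (trunc (dist a b + 2) K) \<phi> UNIV"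
proof -
  define R where "R = dist a b + 2"
  have R: "0 < R" by (simp add: R_def add_nonneg_pos)
  obtain C where C: "1 \<le> C"
    "\<And>x y z r. \<lbrakk>0 < r; x \<noteq> y; dist x y \<le> R * r; dist x z \<le> R * r\<rbrakk> \<Longrightarrow>
       1 \<le> C * (Vol m z r * \<Upsilon> r) * K x y"
    using K_lower[of R] by metis
  define c where "c = 1 / (C * (Vol m b 1 * \<Upsilon> 1))"
  have V: "0 < Vol m b 1" "0 < Vol m a 1" "0 < \<Upsilon> 1" by (auto intro: Vol_pos \<Upsilon>_pos)
  have c: "0 < c" using C(1) V by (simp add: c_def)
  have low: "c \<le> \<bar>\<phi> x - \<phi> y\<bar> powr p * trunc R K x y" if xy: "dist a x < 1" "dist b y < 1" for x y
  proof -
    have e: "\<phi> x = 1" "\<phi> y = 0" using \<phi> xy by auto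
    then have ne: "x \<noteq> y" by auto
    have d: "dist x y < R" "dist x b \<le> R"
      using xy dist_triangle[of x b a] dist_triangle[of x y b] by (auto simp: R_def dist_commute)
    have "1 \<le> C * (Vol m b 1 * \<Upsilon> 1) * K x y" using C(2)[of 1 x y b] ne d by simp
    then have "c \<le> K x y" using C(1) V by (simp add: c_def field_simps)
    then show ?thesis using d e by (simp add: trunc_def)
  qed
  have "(\<integral>\<^sup>+x. ennreal (c * Vol m b 1) * indicator (ball a 1) x \<partial>m) \<le> JGamma m p (trunc R K) \<phi> UNIV"
    unfolding JGamma_def
  proof (rule nn_integral_mono)
    fix x
    show "ennreal (c * Vol m b 1) * indicator (ball a 1) x
       \<le> (\<integral>\<^sup>+y. ennreal (\<bar>\<phi> x - \<phi> y\<bar> powr p * trunc R K x y) \<partial>m) * indicator UNIV x"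
    proof (cases "x \<in> ball a 1")
      case True
      have "ennreal (c * Vol m b 1) = (\<integral>\<^sup>+y. ennreal c * indicator (ball b 1) y \<partial>m)"
        using c by (subst nn_integral_cmult_indicator) (auto simp: emeasure_ball ennreal_mult)
      also have "\<dots> \<le> (\<integral>\<^sup>+y. ennreal (\<bar>\<phi> x - \<phi> y\<bar> powr p * trunc R K x y) \<partial>m)"
        using low True by (intro nn_integral_mono) (auto simp: indicator_def intro!: ennreal_leI)
      finally show ?thesis using True by simp
    qed simp
  qed
  moreover have "(\<integral>\<^sup>+x. ennreal (c * Vol m b 1) * indicator (ball a 1) x \<partial>m) = ennreal (c * Vol m b 1 * Vol m a 1)"
    using c by (subst nn_integral_cmult_indicator) (auto simp: emeasure_ball ennreal_mult)
  moreover have "0 < ennreal (c * Vol m b 1 * Vol m a 1)" using c V by simp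
  ultimately show ?thesis unfolding R_def by (metis less_le_trans)
qed

text \<open>The given form supplies density in L^p, uniform density in \<open>Cc\<close>, the cutoff
  functions and the scalar Clarkson inequality. Completeness and the Markov property hold for every
  jump form, and density in the energy norm follows from the cutoff functions.\<close>

theorem jump_form_regular_CE:
  assumes energy: "p_energy m p F E" and reg: "regular_form m p F E"
    and nc: "near_controlled F E" and ne: "near_CE F"
  shows "p_energy m p (JF m p K) (JE m p K) \<and> regular_form m p (JF m p K) (JE m p K) \<and> CE_strong_J m p K \<Upsilon>"
proof -
  have pf: "p_form m p F E" and cl: "clarkson p F E"
    and dense: "\<And>u \<epsilon>. Lp m p u \<Longrightarrow> \<epsilon> > 0 \<Longrightarrow> \<exists>f\<in>F. Lp_pow m p (\<lambda>x. u x - f x) < \<epsilon>"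
    using energy unfolding p_energy_def by blast+
  have E0: "0 \<le> E u" if "u \<in> F" for u using pf that by (auto simp: p_form_def)
  have sub: "F \<subseteq> JF m p K" by (rule near_controlled_subset[OF pf nc])
  obtain \<delta> Ae C where dAC: "0 < \<delta>" "\<delta> < 1" "Ae > 1" "C > 0"
    and cut: "\<And>x0 r. r > 0 \<Longrightarrow> \<exists>\<phi>\<in>F. cutoff m (ball x0 r) (ball x0 (Ae * r)) \<phi> \<and> continuous_on UNIV \<phi> \<and>
        (\<forall>x y. \<bar>\<phi> x - \<phi> y\<bar> \<le> C * (min (dist x y / r) 1) powr \<delta>) \<and>
        (\<forall>x s. s > 0 \<longrightarrow> JGamma m p K \<phi> (ball x s)
            \<le> ennreal (C * (min (s / r) 1) powr \<delta> * Vol m x s / \<Upsilon> (min s r)))"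
    by (rule cutoffs_full_energy[OF ne sub]) blast
  have CE: "CE_strong_J m p K \<Upsilon>"
    unfolding CE_strong_def
  proof (intro exI conjI allI impI)
    fix x0 :: 'a and r :: real assume "r > 0"
    from cut[OF this, of x0] sub
    show "\<exists>\<phi>\<in>JF m p K. cutoff m (ball x0 r) (ball x0 (Ae * r)) \<phi> \<and>
        (\<forall>x y. \<bar>\<phi> x - \<phi> y\<bar> \<le> C * (min (dist x y / r) 1) powr \<delta>) \<and>
        (\<forall>x s. s > 0 \<longrightarrow> JGamma m p K \<phi> (ball x s)
            \<le> ennreal (C * (min (s / r) 1) powr \<delta> * Vol m x s / \<Upsilon> (min s r)))"
      by blast
  qed (use dAC in auto)
  obtain CV where CV: "1 \<le> CV"
    "\<And>x y r s. 0 < r \<Longrightarrow> dist x y + s \<le> Ae * r \<Longrightarrow> Vol m x s \<le> CV * Vol m y r"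
    using Vol_comparable[of Ae] by metis
  have cap: "cap_cutoffs Ae (2 * C * CV)"
    unfolding cap_cutoffs_def
  proof (intro allI impI)
    fix x r assume r: "0 < (r::real)"
    obtain \<phi> where \<phi>: "\<phi> \<in> F" "cutoff m (ball x r) (ball x (Ae * r)) \<phi>" "continuous_on UNIV \<phi>"
      "\<And>y s. s > 0 \<Longrightarrow> JGamma m p K \<phi> (ball y s)
            \<le> ennreal (C * (min (s / r) 1) powr \<delta> * Vol m y s / \<Upsilon> (min s r))"
      using cut[OF r, of x] by blast
    note c = continuous_cutoffD[OF \<phi>(3,2)]
    have J: "JGamma m p K \<phi> UNIV \<le> 2 * JGamma m p K \<phi> (ball x (Ae * r))"
      by (rule JGamma_support[OF K_meas K_sym]) (use \<phi>(1) sub c(4) JFD(2) in auto)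
    have Ar: "r \<le> Ae * r" "0 < Ae * r" using dAC(3) r by auto
    \<comment> \<open>At \<open>s = Ae * r\<close> both minima in the cutoff inequality attain their
      caps, 1 and \<open>r\<close>.\<close>
    have "JGamma m p K \<phi> (ball x (Ae * r)) \<le> ennreal (C * Vol m x (Ae * r) / \<Upsilon> r)"
      using \<phi>(4)[OF Ar(2), of x] Ar(1) dAC(3) r by (simp add: min_def)
    also have "\<dots> \<le> ennreal (C * CV * Vol m x r / \<Upsilon> r)"
    proof (rule ennreal_leI, rule divide_right_mono)
      have "Vol m x (Ae * r) \<le> CV * Vol m x r" using r by (intro CV(2)) auto
      then show "C * Vol m x (Ae * r) \<le> C * CV * Vol m x r"
        using dAC(4) by (simp add: mult.assoc)
    qed (use \<Upsilon>_pos[OF r] in simp)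
    finally have "JGamma m p K \<phi> UNIV \<le> 2 * ennreal (C * CV * Vol m x r / \<Upsilon> r)"
      using J by (meson mult_left_mono order_trans zero_le)
    also have "2 * ennreal (C * CV * Vol m x r / \<Upsilon> r) = ennreal (2 * (C * CV * Vol m x r / \<Upsilon> r))"
      unfolding ennreal_mult'[of 2, OF zero_le_numeral] by simp
    finally have "JGamma m p K \<phi> UNIV \<le> ennreal (2 * C * CV * Vol m x r / \<Upsilon> r)" by (simp add: mult.assoc)
    then show "\<exists>\<phi>\<in>JF m p K. continuous_on UNIV \<phi> \<and>
       (\<forall>y. 0 \<le> \<phi> y \<and> \<phi> y \<le> 1) \<and> (\<forall>y. dist x y < r \<longrightarrow> \<phi> y = 1) \<and>
       (\<forall>y. Ae * r \<le> dist x y \<longrightarrow> \<phi> y = 0) \<and>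
       JGamma m p K \<phi> UNIV \<le> ennreal (2 * C * CV * Vol m x r / \<Upsilon> r)"
      using \<phi>(1,3) sub c by (intro bexI[of _ \<phi>]) (auto simp: not_less)
  qed
  have regJ: "regular_form m p (JF m p K) (JE m p K)"
    unfolding regular_form_def
  proof (intro conjI allI impI ballI)
    fix u :: "'a \<Rightarrow> real" and \<epsilon> :: real assume "Cc u" "\<epsilon> > 0"
    then show "\<exists>f\<in>JF m p K. Cc f \<and> (\<forall>x. \<bar>u x - f x\<bar> < \<epsilon>)"
      using reg sub unfolding regular_form_def by (meson subsetD)
  next
    fix f and \<epsilon> :: real assume "f \<in> JF m p K" "\<epsilon> > 0"
    then show "\<exists>g\<in>JF m p K. Cc g \<and> E1 m p (JE m p K) (\<lambda>x. f x - g x) < \<epsilon>"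
      using dAC(3,4) CV(1) by (intro Cc_dense_JF[OF cap]) auto
  qed
  have sc: "scalar_clarkson p"
  proof -
    obtain a :: 'a where True by simp
    \<comment> \<open>So far out, the unit ball around \<open>b\<close> misses
      \<open>ball a Ae\<close>, the set outside which the cutoff function vanishes.\<close>
    obtain b where b: "Ae + 1 < dist a b" using far_point_exists by blast
    obtain \<phi> where \<phi>: "\<phi> \<in> F" "cutoff m (ball a 1) (ball a (Ae * 1)) \<phi>" "continuous_on UNIV \<phi>"
      using cut[of 1 a] by auto
    note c = continuous_cutoffD[OF \<phi>(3,2)]
    have pos: "0 < JGamma m p (trunc (dist a b + 2) K) \<phi> UNIV"
    proof (rule positive_near_energy)
      show "\<phi> \<in> borel_measurable m" using \<phi>(1) sub JFD(2) by blast
      show "\<phi> x = 1" if "dist a x < 1" for x using c(3)[of x] that by simp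
      show "\<phi> x = 0" if "dist b x < 1" for x
        using c(4)[of x] that b dist_triangle2[of a b x] by simp
    qed
    \<comment> \<open>Positive energy in short jumps forces \<open>E \<phi>\<close> to be nonzero,
      since it is bounded by a multiple of \<open>E \<phi>\<close>.\<close>
    obtain C where "JGamma m p (trunc (dist a b + 2) K) \<phi> UNIV \<le> ennreal (C * E \<phi>)"
      using nc \<phi>(1) unfolding near_controlled_def by (meson add_nonneg_pos zero_le_dist zero_less_numeral)
    with pos have "0 < ennreal (C * E \<phi>)" by (rule less_le_trans)
    then have "E \<phi> \<noteq> 0" by auto
    then have "0 < E \<phi>" using E0[OF \<phi>(1)] by simp
    then show ?thesis by (rule scalar_clarksonI[OF p_gt_1 pf cl \<phi>(1)])
  qed
  have "p_energy m p (JF m p K) (JE m p K)"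
    unfolding p_energy_def
  proof (intro conjI p_form_JF JF_clarkson sc)
    show "\<forall>u. Lp m p u \<longrightarrow> (\<forall>\<epsilon>>0. \<exists>f\<in>JF m p K. Lp_pow m p (\<lambda>x. u x - f x) < \<epsilon>)"
      using dense sub by (meson subsetD)
    show "\<forall>f. (\<forall>n. f n \<in> JF m p K) \<and>
        (\<forall>\<epsilon>>0. \<exists>N. \<forall>n\<ge>N. \<forall>k\<ge>N. E1 m p (JE m p K) (\<lambda>x. f n x - f k x) < \<epsilon>) \<longrightarrow>
        (\<exists>g\<in>JF m p K. (\<lambda>n. E1 m p (JE m p K) (\<lambda>x. f n x - g x)) \<longlonglongrightarrow> 0)"
      using JF_complete by blast
    show "\<forall>\<phi>. (\<forall>s t. \<bar>\<phi> s - \<phi> t\<bar> \<le> \<bar>s - t\<bar>) \<and> \<phi> 0 = 0 \<longrightarrow>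
        (\<forall>f\<in>JF m p K. \<phi> \<circ> f \<in> JF m p K \<and> JE m p K (\<phi> \<circ> f) \<le> JE m p K f)"
      using JF_Markov by blast
  qed
  then show ?thesis using regJ CE by blast
qed

section \<open>Comparison of two jump forms\<close>

text \<open>The growth condition solved for \<open>\<Psi> / \<Upsilon>\<close>: passing to a smaller
  scale costs at most the factor \<open>c\<close>, which is constant for \<open>UG\<close> and a
  value of \<open>\<Theta>\<close> for \<open>SUG\<close>.\<close>

lemma UG_ratio:
  assumes \<Psi>: "doubling_function \<Psi>" and r: "0 < r" "r \<le> R"
    and ug: "\<Upsilon> R / \<Upsilon> r \<le> c * (\<Psi> R / \<Psi> r)"
  shows "\<Psi> r / \<Upsilon> r \<le> c * (\<Psi> R / \<Upsilon> R)"
proof -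
  have "0 < \<Upsilon> r" "0 < \<Upsilon> R" "0 < \<Psi> r" using r \<Upsilon>_pos doubling_function_pos[OF \<Psi>] by auto
  then show ?thesis using ug by (simp add: field_simps)
qed

text \<open>At distance \<open>d\<close> the volumes in the two kernels cancel and their ratio is of
  order \<open>\<Psi> d / \<Upsilon> d\<close>, which for \<open>d < R\<close> is at most a multiple
  of its value at \<open>R\<close>.\<close>

lemma trunc_le_kernel:
  assumes \<Psi>: "doubling_function \<Psi>" and ug: "UG \<Upsilon> \<Psi>" and K': "jump_kernel m \<Psi> K'"
  obtains C where "0 < C"
    "\<And>R x y. 0 < R \<Longrightarrow> x \<noteq> y \<Longrightarrow> trunc R K x y \<le> C * (\<Psi> R / \<Upsilon> R) * K' x y"
proof -
  interpret J': jump_form m p \<Psi> K' by unfold_locales (use p_gt_1 \<Psi> K' in auto)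
  obtain C1 where C1: "1 \<le> C1"
    "\<And>x y. x \<noteq> y \<Longrightarrow> K x y \<le> C1 / (Vol m x (dist x y) * \<Upsilon> (dist x y))"
    by (rule K_bounds) blast
  obtain C2 where C2: "1 \<le> C2"
    "\<And>x y. x \<noteq> y \<Longrightarrow> 1 / (C2 * (Vol m x (dist x y) * \<Psi> (dist x y))) \<le> K' x y"
    by (rule J'.K_bounds) blast
  obtain c where c: "1 \<le> c" "\<And>r R. 0 < r \<Longrightarrow> r \<le> R \<Longrightarrow> \<Upsilon> R / \<Upsilon> r \<le> c * (\<Psi> R / \<Psi> r)"
    using ug unfolding UG_def by blast
  show ?thesis
  proof (rule that[of "C1 * C2 * c"])
    show "0 < C1 * C2 * c" using C1(1) C2(1) c(1) by simp
    fix R :: real and x y :: 'a assume R: "0 < R" and xy: "x \<noteq> y"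
    let ?d = "dist x y"
    have d: "0 < ?d" using xy by simp
    have V: "0 < Vol m x ?d" "0 < \<Upsilon> ?d" "0 < \<Psi> ?d" "0 < \<Psi> R" "0 < \<Upsilon> R"
      using d R by (auto intro: Vol_pos \<Upsilon>_pos J'.\<Upsilon>_pos)
    show "trunc R K x y \<le> C1 * C2 * c * (\<Psi> R / \<Upsilon> R) * K' x y"
    proof (cases "?d < R")
      case True
      have "K x y \<le> C1 / (Vol m x ?d * \<Upsilon> ?d)" by (rule C1(2)[OF xy])
      also have "\<dots> = C1 * C2 * (\<Psi> ?d / \<Upsilon> ?d) * (1 / (C2 * (Vol m x ?d * \<Psi> ?d)))"
        using V C2(1) by (simp add: field_simps)
      also have "\<dots> \<le> C1 * C2 * (c * (\<Psi> R / \<Upsilon> R)) * K' x y"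
        using C1(1) C2 V d xy True c
        by (intro mult_mono mult_left_mono UG_ratio[OF \<Psi>] mult_nonneg_nonneg) auto
      finally show ?thesis using True by (simp add: trunc_def mult.assoc)
    next
      case False
      then show ?thesis using J'.K_nonneg[OF xy] V C1(1) C2(1) c(1) by (simp add: trunc_def)
    qed
  qed
qed

lemma JGamma_trunc_le:
  assumes K': "kernel_measurable K'" and u: "u \<in> borel_measurable m" and A: "A \<in> sets borel" and "0 \<le> c"
    and le: "\<And>x y. x \<noteq> y \<Longrightarrow> trunc R K x y \<le> c * K' x y"
  shows "JGamma m p (trunc R K) u A \<le> ennreal c * JGamma m p K' u A"
proof (rule JGamma_mono[OF K' u _ A])
  fix x y
  show "ennreal (\<bar>u x - u y\<bar> powr p * trunc R K x y) \<le> ennreal c * ennreal (\<bar>u x - u y\<bar> powr p * K' x y)"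
  proof (cases "x = y")
    case False
    have "\<bar>u x - u y\<bar> powr p * trunc R K x y \<le> \<bar>u x - u y\<bar> powr p * (c * K' x y)"
      using le[OF False] by (intro mult_left_mono) auto
    then have "ennreal (\<bar>u x - u y\<bar> powr p * trunc R K x y) \<le> ennreal (c * (\<bar>u x - u y\<bar> powr p * K' x y))"
      by (intro ennreal_leI) (simp add: mult_ac)
    then show ?thesis using \<open>0 \<le> c\<close> by (simp add: ennreal_mult')
  qed simp
qed

lemma jump_comparison:
  assumes \<Psi>: "doubling_function \<Psi>" and ug: "UG \<Upsilon> \<Psi>" and K': "jump_kernel m \<Psi> K'"
    and CE: "CE_strong_J m p K' \<Psi>"
  shows "near_controlled (JF m p K') (JE m p K')" "near_CE (JF m p K')"
proof -
  interpret J': jump_form m p \<Psi> K' by unfold_locales (use p_gt_1 \<Psi> K' in auto)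
  obtain C where C: "0 < C"
    "\<And>R x y. 0 < R \<Longrightarrow> x \<noteq> y \<Longrightarrow> trunc R K x y \<le> C * (\<Psi> R / \<Upsilon> R) * K' x y"
    by (rule trunc_le_kernel[OF \<Psi> ug K']) blast
  have le: "JGamma m p (trunc R K) u A \<le> ennreal (C * (\<Psi> R / \<Upsilon> R)) * JGamma m p K' u A"
    if "0 < R" "u \<in> JF m p K'" "A \<in> sets borel" for R u A
    using that C(1) \<Upsilon>_pos[of R] J'.\<Upsilon>_pos[of R]
    by (intro JGamma_trunc_le[OF J'.K_meas J'.JFD(2)] C(2)) auto
  show "near_controlled (JF m p K') (JE m p K')"
    unfolding near_controlled_def
  proof (intro allI impI exI ballI)
    fix R :: real and u assume R: "0 < R" and u: "u \<in> JF m p K'"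
    have "0 \<le> C * (\<Psi> R / \<Upsilon> R)" using C(1) \<Upsilon>_pos[OF R] J'.\<Upsilon>_pos[OF R] by simp
    then have "ennreal (C * (\<Psi> R / \<Upsilon> R) * JE m p K' u) = ennreal (C * (\<Psi> R / \<Upsilon> R)) * JGamma m p K' u UNIV"
      unfolding J'.JFD(5)[OF u, symmetric] by (rule ennreal_mult')
    then show "JGamma m p (trunc R K) u UNIV \<le> ennreal (C * (\<Psi> R / \<Upsilon> R) * JE m p K' u)"
      using le[OF R u, of UNIV] by simp
  qed
  obtain \<delta> Ae C' where dAC: "0 < \<delta>" "\<delta> < 1" "Ae > 1" "C' > 0"
    and cut: "\<And>x0 r. r > 0 \<Longrightarrow> \<exists>\<phi>\<in>JF m p K'. cutoff m (ball x0 r) (ball x0 (Ae * r)) \<phi> \<and>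
        (\<forall>x y. \<bar>\<phi> x - \<phi> y\<bar> \<le> C' * (min (dist x y / r) 1) powr \<delta>) \<and>
        (\<forall>x s. s > 0 \<longrightarrow> JGamma m p K' \<phi> (ball x s)
            \<le> ennreal (C' * (min (s / r) 1) powr \<delta> * Vol m x s / \<Psi> (min s r)))"
    using CE unfolding CE_strong_def by blast
  show "near_CE (JF m p K')"
    unfolding near_CE_def
  proof (intro exI conjI allI impI)
    show "0 < \<delta>" "\<delta> < 1" "Ae > 1" by (rule dAC)+
    \<comment> \<open>One constant for both conditions: \<open>C'\<close> for the Hoelder bound,
      \<open>C * C'\<close> for the energy.\<close>
    show "C' + C * C' > 0" using C(1) dAC(4) by (simp add: add_pos_pos)
    fix x0 :: 'a and r :: real assume r: "r > 0"
    obtain \<phi> where \<phi>: "\<phi> \<in> JF m p K'" "cutoff m (ball x0 r) (ball x0 (Ae * r)) \<phi>"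
        "\<And>x y. \<bar>\<phi> x - \<phi> y\<bar> \<le> C' * (min (dist x y / r) 1) powr \<delta>"
        "\<And>x s. s > 0 \<Longrightarrow> JGamma m p K' \<phi> (ball x s)
            \<le> ennreal (C' * (min (s / r) 1) powr \<delta> * Vol m x s / \<Psi> (min s r))"
      using cut[OF r] by blast
    have H: "\<bar>\<phi> x - \<phi> y\<bar> \<le> (C' + C * C') * (min (dist x y / r) 1) powr \<delta>" for x y
      using \<phi>(3)[of x y] C(1) dAC(4) mult_right_mono[of C' "C' + C * C'" "(min (dist x y / r) 1) powr \<delta>"] by simp
    have J: "JGamma m p (trunc (min s r) K) \<phi> (ball x s)
            \<le> ennreal ((C' + C * C') * (min (s / r) 1) powr \<delta> * Vol m x s / \<Upsilon> (min s r))" if s: "s > 0" for x s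
    proof -
      let ?S = "min s r" and ?q = "(min (s / r) 1) powr \<delta> * Vol m x s"
      have S: "0 < ?S" using s r by simp
      have V: "0 < \<Upsilon> ?S" "0 < \<Psi> ?S" using \<Upsilon>_pos[OF S] J'.\<Upsilon>_pos[OF S] by auto
      have "JGamma m p (trunc ?S K) \<phi> (ball x s) \<le> ennreal (C * (\<Psi> ?S / \<Upsilon> ?S)) * JGamma m p K' \<phi> (ball x s)"
        by (rule le[OF S \<phi>(1)]) simp
      also have "\<dots> \<le> ennreal (C * (\<Psi> ?S / \<Upsilon> ?S)) * ennreal (C' * (min (s / r) 1) powr \<delta> * Vol m x s / \<Psi> ?S)"
        by (intro mult_left_mono \<phi>(4) s) simp
      also have "\<dots> = ennreal (C * (\<Psi> ?S / \<Upsilon> ?S) * (C' * (min (s / r) 1) powr \<delta> * Vol m x s / \<Psi> ?S))"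
        using C(1) dAC(4) V by (intro ennreal_mult[symmetric]) auto
      also have "C * (\<Psi> ?S / \<Upsilon> ?S) * (C' * (min (s / r) 1) powr \<delta> * Vol m x s / \<Psi> ?S) = (C * C') * (?q / \<Upsilon> ?S)"
        using V by simp
      also have "ennreal \<dots> \<le> ennreal ((C' + C * C') * (?q / \<Upsilon> ?S))"
        using dAC(4) V by (intro ennreal_leI mult_right_mono) auto
      finally show ?thesis by (simp add: mult.assoc)
    qed
    show "\<exists>\<phi>\<in>JF m p K'. cutoff m (ball x0 r) (ball x0 (Ae * r)) \<phi> \<and>
        (\<forall>x y. \<bar>\<phi> x - \<phi> y\<bar> \<le> (C' + C * C') * (min (dist x y / r) 1) powr \<delta>) \<and>
        (\<forall>x s. s > 0 \<longrightarrow> JGamma m p (trunc (min s r) K) \<phi> (ball x s)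
            \<le> ennreal ((C' + C * C') * (min (s / r) 1) powr \<delta> * Vol m x s / \<Upsilon> (min s r)))"
      using \<phi>(1,2) H J by blast
  qed
qed

section \<open>Comparison with a local form\<close>

text \<open>For jumps of size comparable to \<open>t\<close>, the Poincare inequality on balls of radius \<open>2 t\<close>
  around the points of a \<open>t\<close>-net.\<close>
lemma annulus_energy_le:
  assumes \<Psi>: "doubling_function \<Psi>" and PI: "PI_L m p F \<Gamma> \<Psi>"
    and Lp: "\<And>f. f \<in> F \<Longrightarrow> Lp m p f" and sets: "\<And>f. f \<in> F \<Longrightarrow> sets (\<Gamma> f) = sets borel"
  obtains C L where "0 < C" "1 \<le> L"
    "\<And>f t x s. f \<in> F \<Longrightarrow> 0 < t \<Longrightarrow> JGamma m p (trunc t (far (t / 2) K)) f (ball x s)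
       \<le> ennreal (C * (\<Psi> t / \<Upsilon> t)) * emeasure (\<Gamma> f) (ball x (s + L * t))"
    "\<And>f t. f \<in> F \<Longrightarrow> 0 < t \<Longrightarrow> JGamma m p (trunc t (far (t / 2) K)) f UNIV
       \<le> ennreal (C * (\<Psi> t / \<Upsilon> t)) * emeasure (\<Gamma> f) UNIV"
proof -
  obtain C0 A where C0: "C0 > 0" "A \<ge> 1" "\<And>x r f. r > 0 \<Longrightarrow> f \<in> F \<Longrightarrow>
     (\<integral>\<^sup>+y\<in>ball x r. ennreal (\<bar>f y - (\<integral>z\<in>ball x r. f z \<partial>m) / Vol m x r\<bar> powr p) \<partial>m)
       \<le> ennreal (C0 * \<Psi> r) * emeasure (\<Gamma> f) (ball x (A * r))"
    using PI unfolding PI_L_def by blast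
  \<comment> \<open>The factor 4 relates jumps of length at least \<open>t / 2\<close> to the scale
    \<open>2 * t\<close>.\<close>
  obtain C1 where C1: "1 \<le> C1"
    "\<And>x y z r. \<lbrakk>0 < r; r \<le> 4 * dist x y; dist x z \<le> 4 * dist x y\<rbrakk> \<Longrightarrow>
       K x y \<le> C1 / (Vol m z r * \<Upsilon> r)"
    using K_upper[of 4] by (metis zero_less_numeral)
  obtain C2 where C2: "1 \<le> C2" "\<And>s r. 0 < s \<Longrightarrow> 0 < r \<Longrightarrow> s \<le> 2 * r \<Longrightarrow> \<Psi> s \<le> C2 * \<Psi> r"
    using doubling_function_comparable[OF \<Psi>, of 2] by metis
  obtain C3 where C3: "1 \<le> C3" "\<And>s r. 0 < s \<Longrightarrow> 0 < r \<Longrightarrow> s \<le> 1 * r \<Longrightarrow> \<Upsilon> s \<le> C3 * \<Upsilon> r"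
    using doubling_function_comparable[OF dfun, of 1] by metis
  have "1 \<le> 2 * A" using C0(2) by simp
  then obtain M :: real where M: "1 \<le> M"
    "\<And>e N g \<nu> c x s. \<lbrakk>0 < e; is_net e N; g \<in> borel_measurable m; sets \<nu> = sets borel;
       \<And>z. z \<in> N \<Longrightarrow> (\<integral>\<^sup>+y\<in>ball z e. g y \<partial>m) \<le> c * emeasure \<nu> (ball z (2 * A * e))\<rbrakk> \<Longrightarrow>
       (\<integral>\<^sup>+y\<in>ball x s. g y \<partial>m) \<le> c * ennreal M * emeasure \<nu> (ball x (s + (2 * A + 1) * e))"
    "\<And>e N g \<nu> c. \<lbrakk>0 < e; is_net e N; g \<in> borel_measurable m; sets \<nu> = sets borel;
       \<And>z. z \<in> N \<Longrightarrow> (\<integral>\<^sup>+y\<in>ball z e. g y \<partial>m) \<le> c * emeasure \<nu> (ball z (2 * A * e))\<rbrakk> \<Longrightarrow>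
       (\<integral>\<^sup>+y. g y \<partial>m) \<le> c * ennreal M * emeasure \<nu> UNIV"
    by (rule net_integral_bound) blast
  define D where "D = C1 * 2 powr p * 2 * C0 * C2 * C3"
  have D: "0 < D" using C0 C1 C2 C3 by (simp add: D_def)
  have loc: "(\<integral>\<^sup>+y\<in>ball z t. (\<integral>\<^sup>+w. ennreal (\<bar>f y - f w\<bar> powr p * trunc t (far (t / 2) K) y w) \<partial>m) \<partial>m)
      \<le> ennreal (D * (\<Psi> t / \<Upsilon> t)) * emeasure (\<Gamma> f) (ball z (2 * A * t))"
    if f: "f \<in> F" and t: "0 < t" for f t z
  proof -
    \<comment> \<open>A jump shorter than \<open>t\<close> from \<open>ball z t\<close> ends in
      \<open>?B\<close>. Comparing both ends with the mean \<open>a\<close> over \<open>?B\<close>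
      leads to the integral \<open>I\<close> of the Poincare inequality.\<close>
    let ?B = "ball z (2 * t)" and ?V = "Vol m z (2 * t)" and ?T = "trunc t (far (t / 2) K)"
    have [measurable]: "f \<in> borel_measurable m" using Lp[OF f] by (rule LpD)
    define a where "a = (\<integral>w\<in>?B. f w \<partial>m) / ?V"
    let ?h = "\<lambda>y. ennreal (\<bar>f y - a\<bar> powr p)"
    define I where "I = (\<integral>\<^sup>+y\<in>?B. ?h y \<partial>m)"
    have V: "0 < ?V" "0 < \<Upsilon> (2 * t)" "0 < \<Upsilon> t" "0 < \<Psi> t" "0 < \<Psi> (2 * t)"
      using t by (auto intro: Vol_pos \<Upsilon>_pos doubling_function_pos[OF \<Psi>])
    define c where "c = C1 / (?V * \<Upsilon> (2 * t)) * 2 powr p"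
    have c: "0 \<le> c" using C1(1) V by (simp add: c_def)
    have pw: "ennreal (\<bar>f y - f w\<bar> powr p * ?T y w) \<le> ennreal c * ((?h y + ?h w) * indicator ?B w)"
      if y: "y \<in> ball z t" for y w
    proof (cases "t / 2 \<le> dist y w \<and> dist y w < t")
      case True
      have w: "w \<in> ?B" using y True dist_triangle[of z w y] by simp
      have "?T y w \<le> C1 / (?V * \<Upsilon> (2 * t))"
        using True C1(2)[of "2 * t" y w z] y t by (simp add: trunc_def far_def dist_commute)
      moreover have "\<bar>f y - f w\<bar> powr p \<le> 2 powr p * (\<bar>f y - a\<bar> powr p + \<bar>f w - a\<bar> powr p)"
        using abs_diff_powr_le[OF p_pos(2), of "f y - a" "f w - a"] by simp
      moreover have "0 \<le> ?T y w"
        using True t K_nonneg[of y w] by (cases "y = w") (auto simp: trunc_def far_def)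
      ultimately have "\<bar>f y - f w\<bar> powr p * ?T y w
          \<le> (2 powr p * (\<bar>f y - a\<bar> powr p + \<bar>f w - a\<bar> powr p)) * (C1 / (?V * \<Upsilon> (2 * t)))"
        by (intro mult_mono) auto
      also have "\<dots> = c * (\<bar>f y - a\<bar> powr p + \<bar>f w - a\<bar> powr p)" by (simp add: c_def)
      finally have "ennreal (\<bar>f y - f w\<bar> powr p * ?T y w) \<le> ennreal (c * (\<bar>f y - a\<bar> powr p + \<bar>f w - a\<bar> powr p))"
        by (rule ennreal_leI)
      also have "\<dots> = ennreal c * (?h y + ?h w)"
        using c by (simp add: ennreal_mult)
      finally show ?thesis using w by simp
    next
      case False
      then have "?T y w = 0" by (auto simp: trunc_def far_def)
      then show ?thesis by simp
    qed
    have "(\<integral>\<^sup>+y\<in>ball z t. (\<integral>\<^sup>+w. ennreal (\<bar>f y - f w\<bar> powr p * ?T y w) \<partial>m) \<partial>m)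
        \<le> (\<integral>\<^sup>+y. ennreal c * (ennreal ?V * (?h y * indicator ?B y) + I * indicator ?B y) \<partial>m)"
    proof (rule nn_integral_mono)
      fix y
      show "(\<integral>\<^sup>+w. ennreal (\<bar>f y - f w\<bar> powr p * ?T y w) \<partial>m) * indicator (ball z t) y
         \<le> ennreal c * (ennreal ?V * (?h y * indicator ?B y) + I * indicator ?B y)"
      proof (cases "y \<in> ball z t")
        case True
        have "(\<integral>\<^sup>+w. ennreal (\<bar>f y - f w\<bar> powr p * ?T y w) \<partial>m) \<le> (\<integral>\<^sup>+w. ennreal c * ((?h y + ?h w) * indicator ?B w) \<partial>m)"
          by (intro nn_integral_mono pw True)
        also have "\<dots> = ennreal c * (\<integral>\<^sup>+w. ?h y * indicator ?B w + ?h w * indicator ?B w \<partial>m)"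
          by (subst nn_integral_cmult) (auto simp: distrib_right)
        also have "(\<integral>\<^sup>+w. ?h y * indicator ?B w + ?h w * indicator ?B w \<partial>m) = ?h y * ennreal ?V + I"
          by (subst nn_integral_add) (auto simp: I_def nn_integral_cmult_indicator emeasure_ball)
        finally show ?thesis using True t by (simp add: indicator_def mult.commute)
      qed simp
    qed
    also have "\<dots> = ennreal c * (\<integral>\<^sup>+y. ennreal ?V * (?h y * indicator ?B y) + I * indicator ?B y \<partial>m)"
      by (rule nn_integral_cmult) simp
    also have "(\<integral>\<^sup>+y. ennreal ?V * (?h y * indicator ?B y) + I * indicator ?B y \<partial>m) = ennreal ?V * I + ennreal ?V * I"
    proof -
      have "(\<integral>\<^sup>+y. ennreal ?V * (?h y * indicator ?B y) \<partial>m) = ennreal ?V * I"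
        unfolding I_def by (rule nn_integral_cmult) simp
      moreover have "(\<integral>\<^sup>+y. I * indicator ?B y \<partial>m) = ennreal ?V * I"
        by (subst nn_integral_cmult_indicator) (auto simp: emeasure_ball mult.commute)
      ultimately show ?thesis by (subst nn_integral_add) auto
    qed
    also have "ennreal ?V * I + ennreal ?V * I = ennreal (2 * ?V) * I"
      unfolding mult_2 ennreal_plus[OF Vol_nonneg Vol_nonneg] distrib_right ..
    also have "ennreal c * (ennreal (2 * ?V) * I) = ennreal (c * (2 * ?V)) * I"
      using c by (intro ennreal_mult_assoc) auto
    also have "c * (2 * ?V) = C1 * 2 powr p * 2 / \<Upsilon> (2 * t)"
      using V by (simp add: c_def)
    also have "ennreal (C1 * 2 powr p * 2 / \<Upsilon> (2 * t)) * I
        \<le> ennreal (C1 * 2 powr p * 2 / \<Upsilon> (2 * t)) * (ennreal (C0 * \<Psi> (2 * t)) * emeasure (\<Gamma> f) (ball z (A * (2 * t))))"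
      unfolding I_def a_def using t f by (intro mult_left_mono C0(3)) auto
    also have "\<dots> = ennreal (C1 * 2 powr p * 2 / \<Upsilon> (2 * t) * (C0 * \<Psi> (2 * t))) * emeasure (\<Gamma> f) (ball z (A * (2 * t)))"
      using C1(1) V C0(1) by (intro ennreal_mult_assoc) auto
    also have "\<dots> \<le> ennreal (D * (\<Psi> t / \<Upsilon> t)) * emeasure (\<Gamma> f) (ball z (A * (2 * t)))"
    proof (intro mult_right_mono ennreal_leI)
      have "\<Psi> (2 * t) \<le> C2 * \<Psi> t" "\<Upsilon> t \<le> C3 * \<Upsilon> (2 * t)" using C2(2) C3(2) t by auto
      then have "\<Psi> (2 * t) * \<Upsilon> t \<le> (C2 * \<Psi> t) * (C3 * \<Upsilon> (2 * t))" using V C2(1) by (intro mult_mono) auto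
      then have "\<Psi> (2 * t) / \<Upsilon> (2 * t) \<le> C2 * C3 * (\<Psi> t / \<Upsilon> t)" using V by (simp add: field_simps)
      then have "C1 * 2 powr p * 2 * C0 * (\<Psi> (2 * t) / \<Upsilon> (2 * t)) \<le> C1 * 2 powr p * 2 * C0 * (C2 * C3 * (\<Psi> t / \<Upsilon> t))"
        using C0(1) C1(1) by (intro mult_left_mono) auto
      then show "C1 * 2 powr p * 2 / \<Upsilon> (2 * t) * (C0 * \<Psi> (2 * t)) \<le> D * (\<Psi> t / \<Upsilon> t)"
        by (simp add: D_def mult_ac)
    qed auto
    finally show ?thesis by (simp add: mult_ac)
  qed
  have meas: "(\<lambda>y. \<integral>\<^sup>+w. ennreal (\<bar>f y - f w\<bar> powr p * trunc t (far (t / 2) K) y w) \<partial>m) \<in> borel_measurable m"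
    if "f \<in> F" for f t
    using jump_integrand_measurable(4)[OF kernel_measurable_trunc(1)[OF kernel_measurable_trunc(2)[OF K_meas]] LpD(1)[OF Lp[OF that]]] .
  have fin: "ennreal (D * (\<Psi> t / \<Upsilon> t)) * ennreal M = ennreal (D * M * (\<Psi> t / \<Upsilon> t))" if "0 < t" for t
    using D M(1) \<Upsilon>_pos[OF that] doubling_function_pos[OF \<Psi> that]
    by (subst ennreal_mult[symmetric]) (auto simp: mult_ac)
  show ?thesis
  proof (rule that[of "D * M" "2 * A + 1"])
    show "0 < D * M" using D M(1) by simp
    show "1 \<le> 2 * A + 1" using C0(2) by simp
    fix f t assume f: "f \<in> F" and t: "0 < (t::real)"
    obtain N :: "'a set" where N: "is_net t N" using is_net_exists[OF t] .
    show "JGamma m p (trunc t (far (t / 2) K)) f (ball x s)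
       \<le> ennreal (D * M * (\<Psi> t / \<Upsilon> t)) * emeasure (\<Gamma> f) (ball x (s + (2 * A + 1) * t))" for x s
      using M(2)[OF t N meas[OF f] sets[OF f] loc[OF f t]] unfolding JGamma_def fin[OF t] .
    show "JGamma m p (trunc t (far (t / 2) K)) f UNIV \<le> ennreal (D * M * (\<Psi> t / \<Upsilon> t)) * emeasure (\<Gamma> f) UNIV"
      using M(3)[OF t N meas[OF f] sets[OF f] loc[OF f t]] unfolding JGamma_def fin[OF t] by simp
  qed
qed

lemma near_energy_le_local:
  assumes \<Psi>: "doubling_function \<Psi>" and PI: "PI_L m p F \<Gamma> \<Psi>" and sug: "SUG \<Upsilon> \<Psi>"
    and Lp: "\<And>f. f \<in> F \<Longrightarrow> Lp m p f" and sets: "\<And>f. f \<in> F \<Longrightarrow> sets (\<Gamma> f) = sets borel"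
  obtains C L where "0 \<le> C" "1 \<le> L"
    "\<And>f S x s. f \<in> F \<Longrightarrow> 0 < S \<Longrightarrow> JGamma m p (trunc S K) f (ball x s)
       \<le> ennreal (C * (\<Psi> S / \<Upsilon> S)) * emeasure (\<Gamma> f) (ball x (s + L * S))"
    "\<And>f S. f \<in> F \<Longrightarrow> 0 < S \<Longrightarrow> JGamma m p (trunc S K) f UNIV
       \<le> ennreal (C * (\<Psi> S / \<Upsilon> S)) * emeasure (\<Gamma> f) UNIV"
proof -
  obtain C L where CL: "0 < C" "1 \<le> L"
    "\<And>f t x s. f \<in> F \<Longrightarrow> 0 < t \<Longrightarrow> JGamma m p (trunc t (far (t / 2) K)) f (ball x s)
       \<le> ennreal (C * (\<Psi> t / \<Upsilon> t)) * emeasure (\<Gamma> f) (ball x (s + L * t))"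
    "\<And>f t. f \<in> F \<Longrightarrow> 0 < t \<Longrightarrow> JGamma m p (trunc t (far (t / 2) K)) f UNIV
       \<le> ennreal (C * (\<Psi> t / \<Upsilon> t)) * emeasure (\<Gamma> f) UNIV"
    by (rule annulus_energy_le[OF \<Psi> PI Lp sets]) blast+
  obtain \<Theta> :: "real \<Rightarrow> real" where \<Theta>: "\<forall>t\<in>{0..1}. \<Theta> t \<ge> 0" "summable (\<lambda>n::nat. \<Theta> ((1/2) ^ n))"
     "\<And>r R. 0 < r \<Longrightarrow> r \<le> R \<Longrightarrow> \<Upsilon> R / \<Upsilon> r \<le> \<Theta> (r / R) * (\<Psi> R / \<Psi> r)"
    using sug unfolding SUG_def by blast
  let ?\<theta> = "\<lambda>n::nat. \<Theta> ((1/2) ^ n)"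
  have \<theta>0: "0 \<le> ?\<theta> n" for n using \<Theta>(1) by (auto simp: power_le_one)
  \<comment> \<open>With these radii the ratios \<open>t S n / S\<close> are exactly the points at
    which \<open>\<Theta>\<close> is summable.\<close>
  define t where "t S n = S * (1/2) ^ n" for S :: real and n :: nat
  have pw: "ennreal (\<bar>f x - f y\<bar> powr p * trunc S K x y)
      \<le> (\<Sum>n. ennreal (\<bar>f x - f y\<bar> powr p * trunc (t S n) (far (t S n / 2) K) x y))"
    if S: "0 < S" for f x y S
  proof (cases "dist x y < S \<and> x \<noteq> y")
    case True
    define n where "n = (LEAST n. t S n / 2 \<le> dist x y)"
    have "\<exists>n. t S n / 2 \<le> dist x y"
    proof -
      have "0 < dist x y / S" using True S by simp
      then obtain n where "(1/2) ^ n < dist x y / S" using real_arch_pow_inv[of "dist x y / S" "1/2"] by auto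
      then have "t S n < dist x y" using S by (simp add: t_def field_simps)
      moreover have "0 < t S n" using S by (simp add: t_def)
      ultimately show ?thesis by (intro exI[of _ n]) simp
    qed
    then have n: "t S n / 2 \<le> dist x y" unfolding n_def by (rule LeastI_ex)
    have n': "dist x y < t S n"
    proof (cases n)
      case 0
      then show ?thesis using True by (simp add: t_def)
    next
      case (Suc k)
      then have "\<not> t S k / 2 \<le> dist x y" using not_less_Least[of k "\<lambda>n. t S n / 2 \<le> dist x y"] n_def by simp
      then show ?thesis using Suc by (simp add: t_def)
    qed
    have "ennreal (\<bar>f x - f y\<bar> powr p * trunc S K x y) = ennreal (\<bar>f x - f y\<bar> powr p * trunc (t S n) (far (t S n / 2) K) x y)"
      using True n n' by (simp add: trunc_def far_def)
    also have "\<dots> \<le> (\<Sum>n. ennreal (\<bar>f x - f y\<bar> powr p * trunc (t S n) (far (t S n / 2) K) x y))"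
      by (rule term_le_suminf_ennreal)
    finally show ?thesis .
  qed (auto simp: trunc_def)
  \<comment> \<open>\<open>G\<close> stands for the energy measure of a ball or for its total mass,
    so that the summation is done once for both claims.\<close>
  have sum: "JGamma m p (trunc S K) f A \<le> ennreal (C * (\<Sum>n. ?\<theta> n) * (\<Psi> S / \<Upsilon> S)) * G"
    if f: "f \<in> F" and S: "0 < S" and A: "A \<in> sets borel"
      and each: "\<And>n. JGamma m p (trunc (t S n) (far (t S n / 2) K)) f A \<le> ennreal (C * (\<Psi> (t S n) / \<Upsilon> (t S n))) * G"
    for f S A G
  proof -
    have V: "0 < \<Psi> S" "0 < \<Upsilon> S" using S by (auto intro: \<Upsilon>_pos doubling_function_pos[OF \<Psi>])
    have "JGamma m p (trunc S K) f A \<le> (\<Sum>n. JGamma m p (trunc (t S n) (far (t S n / 2) K)) f A)"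
      by (rule JGamma_suminf[OF kernel_measurable_trunc(1)[OF kernel_measurable_trunc(2)[OF K_meas]] LpD(1)[OF Lp[OF f]] pw[OF S] A])
    also have "\<dots> \<le> (\<Sum>n. ennreal (C * (\<Psi> S / \<Upsilon> S) * ?\<theta> n) * G)"
    proof (rule suminf_le)
      fix n
      have tS: "0 < t S n" "t S n \<le> S" "t S n / S = (1/2) ^ n"
        using S by (auto simp: t_def mult_left_le power_le_one)
      have "\<Psi> (t S n) / \<Upsilon> (t S n) \<le> ?\<theta> n * (\<Psi> S / \<Upsilon> S)"
        using UG_ratio[OF \<Psi> tS(1,2) \<Theta>(3)[OF tS(1,2)]] tS(3) by simp
      then have "C * (\<Psi> (t S n) / \<Upsilon> (t S n)) \<le> C * (?\<theta> n * (\<Psi> S / \<Upsilon> S))"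
        using CL(1) by (intro mult_left_mono) auto
      then have "ennreal (C * (\<Psi> (t S n) / \<Upsilon> (t S n))) * G \<le> ennreal (C * (\<Psi> S / \<Upsilon> S) * ?\<theta> n) * G"
        by (intro mult_right_mono ennreal_leI) (auto simp: mult_ac)
      then show "JGamma m p (trunc (t S n) (far (t S n / 2) K)) f A \<le> ennreal (C * (\<Psi> S / \<Upsilon> S) * ?\<theta> n) * G"
        using each[of n] by (rule order_trans[rotated])
    qed auto
    also have "\<dots> = (\<Sum>n. ennreal (C * (\<Psi> S / \<Upsilon> S) * ?\<theta> n)) * G"
      by simp
    also have "(\<Sum>n. ennreal (C * (\<Psi> S / \<Upsilon> S) * ?\<theta> n)) = ennreal (\<Sum>n. C * (\<Psi> S / \<Upsilon> S) * ?\<theta> n)"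
      using CL(1) V \<theta>0 \<Theta>(2) by (intro suminf_ennreal2 summable_mult) auto
    also have "(\<Sum>n. C * (\<Psi> S / \<Upsilon> S) * ?\<theta> n) = C * (\<Sum>n. ?\<theta> n) * (\<Psi> S / \<Upsilon> S)"
      using suminf_mult[OF \<Theta>(2), of "C * (\<Psi> S / \<Upsilon> S)"] by (simp add: mult_ac)
    finally show ?thesis .
  qed
  show ?thesis
  proof (rule that[of "C * (\<Sum>n. ?\<theta> n)" L])
    show "0 \<le> C * (\<Sum>n. ?\<theta> n)" using CL(1) \<theta>0 \<Theta>(2) by (simp add: suminf_nonneg)
    show "1 \<le> L" by (rule CL)
    fix f S assume f: "f \<in> F" and S: "0 < (S::real)"
    have tS: "0 < t S n" "t S n \<le> S" for n
      using S by (auto simp: t_def mult_left_le power_le_one)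
    show "JGamma m p (trunc S K) f (ball x s)
       \<le> ennreal (C * (\<Sum>n. ?\<theta> n) * (\<Psi> S / \<Upsilon> S)) * emeasure (\<Gamma> f) (ball x (s + L * S))" for x s
    proof (rule sum[OF f S])
      fix n
      \<comment> \<open>The enlargement is greatest for the widest annulus, so one ball serves all
        of them.\<close>
      have "ball x (s + L * t S n) \<subseteq> ball x (s + L * S)"
        using tS[of n] CL(2) by (intro subset_ball add_left_mono mult_left_mono) auto
      then have "emeasure (\<Gamma> f) (ball x (s + L * t S n)) \<le> emeasure (\<Gamma> f) (ball x (s + L * S))"
        using sets[OF f] by (intro emeasure_mono) auto
      then show "JGamma m p (trunc (t S n) (far (t S n / 2) K)) f (ball x s)
        \<le> ennreal (C * (\<Psi> (t S n) / \<Upsilon> (t S n))) * emeasure (\<Gamma> f) (ball x (s + L * S))"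
        using CL(3)[OF f tS(1)] by (meson mult_left_mono order_trans zero_le)
    qed simp
    show "JGamma m p (trunc S K) f UNIV \<le> ennreal (C * (\<Sum>n. ?\<theta> n) * (\<Psi> S / \<Upsilon> S)) * emeasure (\<Gamma> f) UNIV"
      by (rule sum[OF f S _ CL(4)[OF f tS(1)]]) simp
  qed
qed

lemma local_comparison:
  assumes \<Psi>: "doubling_function \<Psi>" and PI: "PI_L m p F \<Gamma> \<Psi>" and sug: "SUG \<Upsilon> \<Psi>"
    and pf: "p_form m p F E" and em: "local_energy_measure m p F E \<Gamma>" and CE: "CE_strong_L m F \<Gamma> \<Psi>"
  shows "near_controlled F E" "near_CE F"
proof -
  have "\<forall>f\<in>F. Lp m p f" using pf unfolding p_form_def by (rule conjunct1)
  then have Lp: "\<And>f. f \<in> F \<Longrightarrow> Lp m p f" by (rule bspec)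
  have "\<forall>f\<in>F. sets (\<Gamma> f) = sets borel \<and> emeasure (\<Gamma> f) UNIV = ennreal (E f)"
    using em unfolding local_energy_measure_def by (rule conjunct1)
  then have sets: "\<And>f. f \<in> F \<Longrightarrow> sets (\<Gamma> f) = sets borel" and mass: "\<And>f. f \<in> F \<Longrightarrow> emeasure (\<Gamma> f) UNIV = ennreal (E f)"
    by (simp_all add: Ball_def)
  obtain C L where CL: "0 \<le> C" "1 \<le> L"
    "\<And>f S x s. f \<in> F \<Longrightarrow> 0 < S \<Longrightarrow> JGamma m p (trunc S K) f (ball x s)
       \<le> ennreal (C * (\<Psi> S / \<Upsilon> S)) * emeasure (\<Gamma> f) (ball x (s + L * S))"
    "\<And>f S. f \<in> F \<Longrightarrow> 0 < S \<Longrightarrow> JGamma m p (trunc S K) f UNIV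
       \<le> ennreal (C * (\<Psi> S / \<Upsilon> S)) * emeasure (\<Gamma> f) UNIV"
    by (rule near_energy_le_local[OF \<Psi> PI sug Lp sets]) blast+
  show "near_controlled F E"
    unfolding near_controlled_def
  proof (intro allI impI exI ballI)
    fix R :: real and u assume R: "0 < R" and u: "u \<in> F"
    have "0 \<le> C * (\<Psi> R / \<Upsilon> R)" using CL(1) \<Upsilon>_pos[OF R] doubling_function_pos[OF \<Psi> R] by simp
    from ennreal_mult'[OF this] show "JGamma m p (trunc R K) u UNIV \<le> ennreal (C * (\<Psi> R / \<Upsilon> R) * E u)"
      using CL(4)[OF u R] unfolding mass[OF u] by simp
  qed
  obtain \<delta> Ae C' where dAC: "0 < \<delta>" "\<delta> < 1" "Ae > 1" "C' > 0"
    and cut: "\<And>x0 r. r > 0 \<Longrightarrow> \<exists>\<phi>\<in>F. cutoff m (ball x0 r) (ball x0 (Ae * r)) \<phi> \<and>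
        (\<forall>x y. \<bar>\<phi> x - \<phi> y\<bar> \<le> C' * (min (dist x y / r) 1) powr \<delta>) \<and>
        (\<forall>x s. s > 0 \<longrightarrow> emeasure (\<Gamma> \<phi>) (ball x s)
            \<le> ennreal (C' * (min (s / r) 1) powr \<delta> * Vol m x s / \<Psi> (min s r)))"
    using CE unfolding CE_strong_def by blast
  obtain CV where CV: "1 \<le> CV"
    "\<And>x y r s. 0 < r \<Longrightarrow> dist x y + s \<le> (1 + L) * r \<Longrightarrow> Vol m x s \<le> CV * Vol m y r"
    using Vol_comparable[of "1 + L"] by metis
  obtain C2 where C2: "1 \<le> C2" "\<And>s r. 0 < s \<Longrightarrow> 0 < r \<Longrightarrow> s \<le> 1 * r \<Longrightarrow> \<Psi> s \<le> C2 * \<Psi> r"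
    using doubling_function_comparable[OF \<Psi>, of 1] by metis
  \<comment> \<open>\<open>C\<close> comes from the bound on short jumps and \<open>C'\<close> from
    the cutoff inequality; the other factors compare, between the radii \<open>(1 + L) * s\<close>
    and \<open>s\<close>, the Hoelder factor, the volume and the value of
    \<open>\<Psi>\<close>.\<close>
  define D where "D = C * C' * (1 + L) powr \<delta> * CV * C2"
  have D: "0 \<le> D" using CL(1) dAC(4) CV(1) C2(1) by (simp add: D_def)
  show "near_CE F"
    unfolding near_CE_def
  proof (intro exI conjI allI impI)
    show "0 < \<delta>" "\<delta> < 1" "Ae > 1" by (rule dAC)+
    show "C' + D > 0" using D dAC(4) by simp
    fix x0 :: 'a and r :: real assume r: "r > 0"
    obtain \<phi> where \<phi>: "\<phi> \<in> F" "cutoff m (ball x0 r) (ball x0 (Ae * r)) \<phi>"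
        "\<And>x y. \<bar>\<phi> x - \<phi> y\<bar> \<le> C' * (min (dist x y / r) 1) powr \<delta>"
        "\<And>x s. s > 0 \<Longrightarrow> emeasure (\<Gamma> \<phi>) (ball x s)
            \<le> ennreal (C' * (min (s / r) 1) powr \<delta> * Vol m x s / \<Psi> (min s r))"
      using cut[OF r] by blast
    have H: "\<bar>\<phi> x - \<phi> y\<bar> \<le> (C' + D) * (min (dist x y / r) 1) powr \<delta>" for x y
      using \<phi>(3)[of x y] D mult_right_mono[of C' "C' + D" "(min (dist x y / r) 1) powr \<delta>"] by simp
    have J: "JGamma m p (trunc (min s r) K) \<phi> (ball x s)
            \<le> ennreal ((C' + D) * (min (s / r) 1) powr \<delta> * Vol m x s / \<Upsilon> (min s r))" if s: "s > 0" for x s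
    proof -
      define S where "S = min s r"
      have S: "0 < S" "S \<le> s" using s r by (auto simp: S_def)
      \<comment> \<open>Short jumps from \<open>ball x s\<close> are bounded by the energy measure
        of \<open>ball x (s + L * S)\<close>, which lies in \<open>ball x s'\<close> as
        \<open>S \<le> s\<close>. The cutoff inequality is applied at radius \<open>s'\<close> and
        its right side brought back to \<open>s\<close>.\<close>
      define s' where "s' = (1 + L) * s"
      have s': "0 < s'" "s \<le> s'" using s CL(2) by (auto simp: s'_def mult_le_cancel_right1)
      have V: "0 < \<Upsilon> S" "0 < \<Psi> S" "0 < \<Psi> (min s' r)"
        using S s' r by (auto intro: \<Upsilon>_pos doubling_function_pos[OF \<Psi>])
      have q: "(min (s' / r) 1) powr \<delta> \<le> (1 + L) powr \<delta> * (min (s / r) 1) powr \<delta>"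
      proof -
        have "min (s' / r) 1 \<le> (1 + L) * min (s / r) 1"
        proof (cases "s \<le> r")
          case True
          then show ?thesis using r by (simp add: s'_def min_def)
        next
          case False
          then have "min (s / r) 1 = 1" using r by (simp add: min_def)
          then show ?thesis using CL(2) by (simp add: min.coboundedI2)
        qed
        then have "(min (s' / r) 1) powr \<delta> \<le> ((1 + L) * min (s / r) 1) powr \<delta>"
          using dAC(1) s' r by (intro powr_mono2) auto
        then show ?thesis by (simp add: powr_mult)
      qed
      have v: "Vol m x s' \<le> CV * Vol m x s" using s by (intro CV(2)) (auto simp: s'_def)
      have "S \<le> 1 * min s' r" using s'(2) by (auto simp: S_def)
      then have "\<Psi> S \<le> C2 * \<Psi> (min s' r)" using S s' r by (intro C2(2)) auto
      then have i: "1 / \<Psi> (min s' r) \<le> C2 / \<Psi> S" using V by (simp add: field_simps)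
      have "C' * (min (s' / r) 1) powr \<delta> * Vol m x s' * (1 / \<Psi> (min s' r))
         \<le> C' * ((1 + L) powr \<delta> * (min (s / r) 1) powr \<delta>) * (CV * Vol m x s) * (C2 / \<Psi> S)"
        using dAC(4) q v i V CV(1) by (intro mult_mono mult_nonneg_nonneg) auto
      then have b: "C' * (min (s' / r) 1) powr \<delta> * Vol m x s' / \<Psi> (min s' r)
         \<le> C' * (1 + L) powr \<delta> * CV * C2 * ((min (s / r) 1) powr \<delta> * Vol m x s / \<Psi> S)"
        by (simp add: mult_ac)
      have "emeasure (\<Gamma> \<phi>) (ball x (s + L * S)) \<le> emeasure (\<Gamma> \<phi>) (ball x s')"
      proof (rule emeasure_mono)
        have "L * S \<le> L * s" using S CL(2) by (intro mult_left_mono) auto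
        then show "ball x (s + L * S) \<subseteq> ball x s'" by (intro subset_ball) (simp add: s'_def distrib_right)
      qed (simp add: sets[OF \<phi>(1)])
      also have "\<dots> \<le> ennreal (C' * (1 + L) powr \<delta> * CV * C2 * ((min (s / r) 1) powr \<delta> * Vol m x s / \<Psi> S))"
        using \<phi>(4)[OF s'(1), of x] ennreal_leI[OF b] by (rule order_trans)
      finally have g: "emeasure (\<Gamma> \<phi>) (ball x (s + L * S)) \<le> ennreal (C' * (1 + L) powr \<delta> * CV * C2 * ((min (s / r) 1) powr \<delta> * Vol m x s / \<Psi> S))" .
      have "JGamma m p (trunc S K) \<phi> (ball x s) \<le> ennreal (C * (\<Psi> S / \<Upsilon> S)) * emeasure (\<Gamma> \<phi>) (ball x (s + L * S))"
        by (rule CL(3)[OF \<phi>(1) S(1)])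
      also have "\<dots> \<le> ennreal (C * (\<Psi> S / \<Upsilon> S)) * ennreal (C' * (1 + L) powr \<delta> * CV * C2 * ((min (s / r) 1) powr \<delta> * Vol m x s / \<Psi> S))"
        by (intro mult_left_mono g) simp
      also have "\<dots> = ennreal (C * (\<Psi> S / \<Upsilon> S) * (C' * (1 + L) powr \<delta> * CV * C2 * ((min (s / r) 1) powr \<delta> * Vol m x s / \<Psi> S)))"
        using CL(1) dAC(4) V by (intro ennreal_mult'[symmetric]) auto
      also have "C * (\<Psi> S / \<Upsilon> S) * (C' * (1 + L) powr \<delta> * CV * C2 * ((min (s / r) 1) powr \<delta> * Vol m x s / \<Psi> S))
          = D * ((min (s / r) 1) powr \<delta> * Vol m x s / \<Upsilon> S)"
        using V by (simp add: D_def)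
      also have "ennreal \<dots> \<le> ennreal ((C' + D) * ((min (s / r) 1) powr \<delta> * Vol m x s / \<Upsilon> S))"
        using dAC(4) V by (intro ennreal_leI mult_right_mono) auto
      finally show ?thesis by (simp add: S_def mult.assoc)
    qed
    show "\<exists>\<phi>\<in>F. cutoff m (ball x0 r) (ball x0 (Ae * r)) \<phi> \<and>
        (\<forall>x y. \<bar>\<phi> x - \<phi> y\<bar> \<le> (C' + D) * (min (dist x y / r) 1) powr \<delta>) \<and>
        (\<forall>x s. s > 0 \<longrightarrow> JGamma m p (trunc (min s r) K) \<phi> (ball x s)
            \<le> ennreal ((C' + D) * (min (s / r) 1) powr \<delta> * Vol m x s / \<Upsilon> (min s r)))"
      using \<phi>(1,2) H J by blast
  qed
qed

end

theorem mainTheorem5: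
  fixes m :: "'a::metric_space measure" and p :: real
  assumes "1 < p"
    and "standing_space TYPE('a)"
    and "radon_full_support m"
    and "chain_condition TYPE('a)"
    and "volume_doubling m"
  shows
   "(\<forall>(F::('a \<Rightarrow> real) set) E \<Gamma> \<Psi> \<Upsilon> K.
       p_energy m p F E \<and> strongly_local m F E \<and> regular_form m p F E \<and>
       local_energy_measure m p F E \<Gamma> \<and>
       doubling_function \<Psi> \<and> PI_L m p F \<Gamma> \<Psi> \<and> CE_strong_L m F \<Gamma> \<Psi> \<and>
       doubling_function \<Upsilon> \<and> SUG \<Upsilon> \<Psi> \<and> jump_kernel m \<Upsilon> K
     \<longrightarrow> p_energy m p (JF m p K) (JE m p K) \<and> regular_form m p (JF m p K) (JE m p K) \<and>
         CE_strong_J m p K \<Upsilon>)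
  \<and> (\<forall>\<Psi> K\<Psi> \<Upsilon> K.
       doubling_function \<Psi> \<and> jump_kernel m \<Psi> K\<Psi> \<and>
       p_energy m p (JF m p K\<Psi>) (JE m p K\<Psi>) \<and> regular_form m p (JF m p K\<Psi>) (JE m p K\<Psi>) \<and>
       CE_strong_J m p K\<Psi> \<Psi> \<and>
       doubling_function \<Upsilon> \<and> UG \<Upsilon> \<Psi> \<and> jump_kernel m \<Upsilon> K
     \<longrightarrow> p_energy m p (JF m p K) (JE m p K) \<and> regular_form m p (JF m p K) (JE m p K) \<and>
         CE_strong_J m p K \<Upsilon>)"
proof (intro conjI allI impI; elim conjE)
  have ds: "doubling_space m"
    by unfold_locales (use assms in auto)
  {
    fix F :: "('a \<Rightarrow> real) set" and E \<Gamma> \<Psi> \<Upsilon> K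
    assume en: "p_energy m p F E" and reg: "regular_form m p F E"
      and em: "local_energy_measure m p F E \<Gamma>" and \<Psi>: "doubling_function \<Psi>"
      and PI: "PI_L m p F \<Gamma> \<Psi>" and CE: "CE_strong_L m F \<Gamma> \<Psi>"
      and \<Upsilon>: "doubling_function \<Upsilon>" and sug: "SUG \<Upsilon> \<Psi>" and K: "jump_kernel m \<Upsilon> K"
    interpret jump_form m p \<Upsilon> K
      by (intro jump_form.intro ds jump_form_axioms.intro assms(1) \<Upsilon> K)
    have pf: "p_form m p F E" using en unfolding p_energy_def by (rule conjunct1)
    have R: "p_energy m p (JF m p K) (JE m p K) \<and> regular_form m p (JF m p K) (JE m p K) \<and> CE_strong_J m p K \<Upsilon>"
      by (rule jump_form_regular_CE[OF en reg local_comparison[OF \<Psi> PI sug pf em CE]])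
    show "p_energy m p (JF m p K) (JE m p K)" "regular_form m p (JF m p K) (JE m p K)" "CE_strong_J m p K \<Upsilon>"
      using R by simp_all
  }
  {
    fix \<Psi> K\<Psi> \<Upsilon> K
    assume \<Psi>: "doubling_function \<Psi>" and K\<Psi>: "jump_kernel m \<Psi> K\<Psi>"
      and en: "p_energy m p (JF m p K\<Psi>) (JE m p K\<Psi>)" and reg: "regular_form m p (JF m p K\<Psi>) (JE m p K\<Psi>)"
      and CE: "CE_strong_J m p K\<Psi> \<Psi>"
      and \<Upsilon>: "doubling_function \<Upsilon>" and ug: "UG \<Upsilon> \<Psi>" and K: "jump_kernel m \<Upsilon> K"
    interpret jump_form m p \<Upsilon> K
      by (intro jump_form.intro ds jump_form_axioms.intro assms(1) \<Upsilon> K)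
    have R: "p_energy m p (JF m p K) (JE m p K) \<and> regular_form m p (JF m p K) (JE m p K) \<and> CE_strong_J m p K \<Upsilon>"
      by (rule jump_form_regular_CE[OF en reg jump_comparison[OF \<Psi> ug K\<Psi> CE]])
    show "p_energy m p (JF m p K) (JE m p K)" "regular_form m p (JF m p K) (JE m p K)" "CE_strong_J m p K \<Upsilon>"
      using R by simp_all
  }
qed

end
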